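(* For any hyperbolic complex $X$ there is a canonically associated metric $\hat d=\hat d_X$ on $X$ with the following properties. (a) $\hat d$ is quasiisometric to the word metric $d=d_X$, i.e. there exist $A\in[1,\infty)$ and $B\in[0,\infty)$ depending only on $X$ such that for all $x,y\in X$, $$d(x,y)/A-B\le \hat d(x,y)\le A\,d(x,y)+B.$$ (b) $\hat d$ is $\mathrm{Isom}(X)$-invariant: $\hat d(gx,gy)=\hat d(x,y)$ for all $x,y\in X$ and $g\in\mathrm{Isom}(X)$. (c) $(X,\hat d)$ is a metric complex, that is, $\hat d$ is induced from the $0$-skeleton. (d) There exist constants $L\in[0,\infty)$ and $\mu\in[0,1)$ depending only on $X$ with the following property. If $a,a',b,b'\in X^{(0)}$, $\alpha\in\mathrm{Geod}(a,a')$, $\beta\in\mathrm{Geod}(b,b')$ and $d(\alpha,\beta)\ge 2\delta$, then $|\langle a,a'|b,b'\rangle|\le L\mu^{d(\alpha,\beta)}$.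
   Context: Let $X$ be a simplicial complex. Every point of $X$ is a convex combination of the vertices of a simplex. A metric $\rho$ on $X^{(0)}$ is extended to $X$ by the formula $\rho(\sum_x\alpha_x x,\sum_y\beta_y y)=\sum_x\sum_y\alpha_x\beta_y\,\rho(x,y)$. A metric on $X$ is induced from the $0$-skeleton if it is the extension, by this formula, of its restriction to $X^{(0)}$. A metric complex is a pair consisting of a simplicial complex and a metric on it that is induced from the $0$-skeleton. The word metric $d=d_X$ of a connected simplicial complex is obtained by taking the path metric on the $1$-skeleton with all edges of length $1$, restricting it to $X^{(0)}$ and extending it to $X$ by the formula above; on the $1$-skeleton (for geodesics and distances between geodesics) $d$ means the path metric. $\mathrm{Geod}(a,b)$ is the set of geodesics from $a$ to $b$ in the $1$-skeleton; $d(\alpha,\beta)$ is the distance between the images of $\alpha$ and $\beta$. A connected graph is hyperbolic if for some $\delta\ge0$ all its geodesic triangles are $\delta$-fine: for a geodesic triangle with vertices $a,b,c$ and sides $\alpha$ (from $b$ to $c$), $\beta$ (from $c$ to $a$), $\gamma$ (from $a$ to $b$), let $\bar a\in\alpha,\bar b\in\beta,\bar c\in\gamma$ be the unique points with $d(a,\bar b)=d(a,\bar c)$, $d(b,\bar a)=d(b,\bar c)$, $d(c,\bar a)=d(c,\bar b)$; then $x\in\beta$, $y\in\gamma$, $d(a,x)=d(a,y)\le d(a,\bar b)$ imply $d(x,y)\le\delta$. A hyperbolic complex is a connected, uniformly locally finite simplicial complex $X$ (with its word metric) whose $1$-skeleton is a hyperbolic graph. A positive integer $\delta$ is fixed such that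 all geodesic triangles in the $1$-skeleton of $X$ are $\delta$-fine. $\mathrm{Isom}(X)$ is the group of simplicial automorphisms of $X$. The double difference with respect to $\hat d$ is $\langle a,a'|b,b'\rangle:=\frac12\big(\hat d(a,b)-\hat d(a',b)-\hat d(a,b')+\hat d(a',b')\big)$.
   Formalization: "Metric on X" requires zero self-distance only at vertices (all other metric axioms hold on all of X), since any metric induced from the 0-skeleton gives the midpoint of an edge a positive distance to itself. *)

theory Defs
  imports Complex_Main
begin

section \<open>Simplicial complexes and their points\<close>

text \<open>A simplicial complex is given by its set of nonempty simplices.\<close>

definition is_complex :: "'a set set \<Rightarrow> bool" where
  "is_complex X \<longleftrightarrow>
     (\<forall>s\<in>X. finite s \<and> s \<noteq> {}) \<and> (\<forall>s\<in>X. \<forall>t. t \<noteq> {} \<and> t \<subseteq> s \<longrightarrow> t \<in> X)"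

definition verts :: "'a set set \<Rightarrow> 'a set" where
  "verts X = \<Union> X"

text \<open>Points are given by their barycentric coordinates.\<close>

definition supp :: "('a \<Rightarrow> real) \<Rightarrow> 'a set" where
  "supp p = {v. p v \<noteq> 0}"

definition points :: "'a set set \<Rightarrow> ('a \<Rightarrow> real) set" where
  "points X = {p. (\<forall>v. 0 \<le> p v) \<and> supp p \<in> X \<and> (\<Sum>v\<in>supp p. p v) = 1}"

definition vpt :: "'a \<Rightarrow> 'a \<Rightarrow> real" where
  "vpt v = (\<lambda>u. if u = v then 1 else 0)"

definition complex_connected :: "'a set set \<Rightarrow> bool" where
  "complex_connected X \<longleftrightarrow> (\<forall>u\<in>verts X. \<forall>v\<in>verts X. (u, v) \<in> {(x, y). {x, y} \<in> X}\<^sup>*)"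

definition unif_locally_finite :: "'a set set \<Rightarrow> bool" where
  "unif_locally_finite X \<longleftrightarrow>
     (\<exists>N::nat. \<forall>v\<in>verts X. finite {s\<in>X. v \<in> s} \<and> card {s\<in>X. v \<in> s} \<le> N)"

section \<open>Simplicial isomorphisms\<close>

definition complex_iso :: "('a \<Rightarrow> 'b) \<Rightarrow> 'a set set \<Rightarrow> 'b set set \<Rightarrow> bool" where
  "complex_iso g X Y \<longleftrightarrow> bij_betw g (verts X) (verts Y) \<and> (\<lambda>s. g ` s) ` X = Y"

definition Isom :: "'a set set \<Rightarrow> ('a \<Rightarrow> 'a) set" where
  "Isom X = {g. complex_iso g X X}"

text \<open>The affine extension of a vertex map to points.\<close>

definition act :: "('a \<Rightarrow> 'b) \<Rightarrow> ('a \<Rightarrow> real) \<Rightarrow> 'b \<Rightarrow> real" where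
  "act g p = (\<lambda>w. \<Sum>v\<in>{v\<in>supp p. g v = w}. p v)"

section \<open>Metric complexes\<close>

definition bary_extend :: "('a \<Rightarrow> 'a \<Rightarrow> real) \<Rightarrow> ('a \<Rightarrow> real) \<Rightarrow> ('a \<Rightarrow> real) \<Rightarrow> real" where
  "bary_extend \<rho> p q = (\<Sum>u\<in>supp p. \<Sum>v\<in>supp q. p u * q v * \<rho> u v)"

text \<open>The barycentric extension of a metric on the vertices gives every point that is not a
  vertex a positive distance to itself (for the word metric, the midpoint of an edge has
  distance 1/2 to itself). Hence \<open>metric on X\<close> can only demand \<open>\<rho> p p = 0\<close> at vertices;
  all other axioms are required for all points, so that \<open>\<rho>\<close> is a genuine metric on the
  vertices.\<close>

definition complex_metric :: "'a set set \<Rightarrow> (('a \<Rightarrow> real) \<Rightarrow> ('a \<Rightarrow> real) \<Rightarrow> real) \<Rightarrow> bool" where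
  "complex_metric X \<rho> \<longleftrightarrow>
     (\<forall>p\<in>points X. \<forall>q\<in>points X. 0 \<le> \<rho> p q) \<and>
     (\<forall>p\<in>points X. \<forall>q\<in>points X. \<rho> p q = 0 \<longrightarrow> p = q) \<and>
     (\<forall>v\<in>verts X. \<rho> (vpt v) (vpt v) = 0) \<and>
     (\<forall>p\<in>points X. \<forall>q\<in>points X. \<rho> p q = \<rho> q p) \<and>
     (\<forall>p\<in>points X. \<forall>q\<in>points X. \<forall>r\<in>points X. \<rho> p r \<le> \<rho> p q + \<rho> q r)"

definition induced_from_verts ::
    "'a set set \<Rightarrow> (('a \<Rightarrow> real) \<Rightarrow> ('a \<Rightarrow> real) \<Rightarrow> real) \<Rightarrow> bool" where
  "induced_from_verts X \<rho> \<longleftrightarrow>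
     (\<forall>p\<in>points X. \<forall>q\<in>points X. \<rho> p q = bary_extend (\<lambda>u v. \<rho> (vpt u) (vpt v)) p q)"

definition metric_complex :: "'a set set \<Rightarrow> (('a \<Rightarrow> real) \<Rightarrow> ('a \<Rightarrow> real) \<Rightarrow> real) \<Rightarrow> bool" where
  "metric_complex X \<rho> \<longleftrightarrow> is_complex X \<and> complex_metric X \<rho> \<and> induced_from_verts X \<rho>"

section \<open>The 1-skeleton, its path metric and the word metric\<close>

definition skel1 :: "'a set set \<Rightarrow> 'a set set" where
  "skel1 X = {s\<in>X. card s \<le> 2}"

text \<open>The path metric is the infimum of the lengths of piecewise linear paths. Such a path is
  listed by its break points, consecutive ones lying on a common edge (or vertex). On an edge
  with endpoints u and v, the points (1-s)u + s v and (1-t)u + t v have distance |s - t|,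
  which is half of the l1-distance of their barycentric coordinates.\<close>

definition seg_length :: "('a \<Rightarrow> real) \<Rightarrow> ('a \<Rightarrow> real) \<Rightarrow> real" where
  "seg_length p q = (\<Sum>v\<in>supp p \<union> supp q. \<bar>p v - q v\<bar>) / 2"

definition pl_path :: "'a set set \<Rightarrow> ('a \<Rightarrow> real) list \<Rightarrow> bool" where
  "pl_path X ps \<longleftrightarrow> ps \<noteq> [] \<and> set ps \<subseteq> points (skel1 X) \<and>
     successively (\<lambda>p q. supp p \<union> supp q \<in> skel1 X) ps"

definition pl_length :: "('a \<Rightarrow> real) list \<Rightarrow> real" where
  "pl_length ps = (\<Sum>i<length ps - 1. seg_length (ps ! i) (ps ! Suc i))"

definition path_dist :: "'a set set \<Rightarrow> ('a \<Rightarrow> real) \<Rightarrow> ('a \<Rightarrow> real) \<Rightarrow> real" where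
  "path_dist X p q = Inf (pl_length ` {ps. pl_path X ps \<and> hd ps = p \<and> last ps = q})"

definition word_metric :: "'a set set \<Rightarrow> ('a \<Rightarrow> real) \<Rightarrow> ('a \<Rightarrow> real) \<Rightarrow> real" where
  "word_metric X = bary_extend (\<lambda>u v. path_dist X (vpt u) (vpt v))"

section \<open>Geodesics and hyperbolicity\<close>

text \<open>Geodesics are parametrized by arc length on the interval from 0 to the distance of their
  endpoints; only the values on that interval matter.\<close>

definition Geod :: "'a set set \<Rightarrow> ('a \<Rightarrow> real) \<Rightarrow> ('a \<Rightarrow> real) \<Rightarrow> (real \<Rightarrow> 'a \<Rightarrow> real) set" where
  "Geod X p q = {\<gamma>. \<gamma> ` {0..path_dist X p q} \<subseteq> points (skel1 X) \<and>
     \<gamma> 0 = p \<and> \<gamma> (path_dist X p q) = q \<and>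
     (\<forall>s\<in>{0..path_dist X p q}. \<forall>t\<in>{0..path_dist X p q}. path_dist X (\<gamma> s) (\<gamma> t) = \<bar>s - t\<bar>)}"

definition geod_image ::
    "'a set set \<Rightarrow> ('a \<Rightarrow> real) \<Rightarrow> ('a \<Rightarrow> real) \<Rightarrow> (real \<Rightarrow> 'a \<Rightarrow> real) \<Rightarrow> ('a \<Rightarrow> real) set" where
  "geod_image X p q \<gamma> = \<gamma> ` {0..path_dist X p q}"

definition set_dist :: "'a set set \<Rightarrow> ('a \<Rightarrow> real) set \<Rightarrow> ('a \<Rightarrow> real) set \<Rightarrow> real" where
  "set_dist X S T = Inf {path_dist X p q |p q. p \<in> S \<and> q \<in> T}"

text \<open>The condition for one geodesic triangle is stated at the corner a only; the other two
  corners are covered by cyclically relabelling the triangle.\<close>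

definition fine_triangles :: "'a set set \<Rightarrow> real \<Rightarrow> bool" where
  "fine_triangles X \<delta> \<longleftrightarrow>
     (\<forall>a\<in>points (skel1 X). \<forall>b\<in>points (skel1 X). \<forall>c\<in>points (skel1 X).
      \<forall>\<alpha>\<in>Geod X b c. \<forall>\<beta>\<in>Geod X c a. \<forall>\<gamma>\<in>Geod X a b.
      \<forall>a'\<in>geod_image X b c \<alpha>. \<forall>b'\<in>geod_image X c a \<beta>. \<forall>c'\<in>geod_image X a b \<gamma>.
        path_dist X a b' = path_dist X a c' \<and>
        path_dist X b a' = path_dist X b c' \<and>
        path_dist X c a' = path_dist X c b' \<longrightarrow>
        (\<forall>x\<in>geod_image X c a \<beta>. \<forall>y\<in>geod_image X a b \<gamma>.
           path_dist X a x = path_dist X a y \<and> path_dist X a y \<le> path_dist X a b' \<longrightarrow>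
           path_dist X x y \<le> \<delta>))"

definition hyperbolic_complex :: "'a set set \<Rightarrow> bool" where
  "hyperbolic_complex X \<longleftrightarrow>
     is_complex X \<and> complex_connected X \<and> unif_locally_finite X \<and>
     (\<exists>\<delta>\<ge>0. fine_triangles X \<delta>)"

definition double_diff ::
    "(('a \<Rightarrow> real) \<Rightarrow> ('a \<Rightarrow> real) \<Rightarrow> real) \<Rightarrow> 'a \<Rightarrow> 'a \<Rightarrow> 'a \<Rightarrow> 'a \<Rightarrow> real" where
  "double_diff \<rho> a a' b b' =
     (\<rho> (vpt a) (vpt b) - \<rho> (vpt a') (vpt b) - \<rho> (vpt a) (vpt b') + \<rho> (vpt a') (vpt b')) / 2"

end

theory Submission
  imports Defs "HOL-Analysis.Infinite_Sum"
begin

text \<open>For vertices \<open>x\<close> and \<open>a\<close>, let a random flow start at \<open>a\<close> and descend towards \<open>x\<close> through the spheres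
  about \<open>x\<close> whose radius is a multiple of \<open>5 * \<delta>\<close>, choosing uniformly among the vertices of the next
  sphere that are, up to \<open>\<delta>\<close>, as close as possible; let \<open>\<nu>\<^sub>x(a)\<close> be the distribution of the vertex near
  \<open>x\<close> where it stops. Fineness of triangles keeps the flows from \<open>a\<close> and \<open>b\<close> close together below the
  level of the Gromov product \<open>(a|b)\<^sub>x\<close>, and each step couples them with a fixed probability, so
  \<open>\<nu>\<^sub>x(a)\<close> and \<open>\<nu>\<^sub>x(b)\<close> differ by at most \<open>c * \<lambda>^(a|b)\<^sub>x\<close> for some \<open>\<lambda> < 1\<close>.
  The metric is \<open>C + (\<Sum>x. \<parallel>\<nu>\<^sub>x(a) - \<nu>\<^sub>x(b)\<parallel>\<^sub>p\<^sup>p)\<close> for distinct vertices, where \<open>p\<close> is even and so large that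
  \<open>\<lambda>^p\<close> beats the growth of balls. Then the sum over all \<open>x\<close> is comparable with the sum over the vertices
  \<open>x\<close> of a geodesic from \<open>a\<close> to \<open>b\<close>, where both distributions have disjoint supports; this gives
  the quasiisometry. In \<open>\<parallel>\<nu>\<^sub>x(a) - \<nu>\<^sub>x(c)\<parallel>\<^sub>p\<^sup>p - \<parallel>\<nu>\<^sub>x(a) - \<nu>\<^sub>x(b)\<parallel>\<^sub>p\<^sup>p - \<parallel>\<nu>\<^sub>x(b) - \<nu>\<^sub>x(c)\<parallel>\<^sub>p\<^sup>p\<close> the terms decay
  with the distance of \<open>x\<close> from the centre of the triangle, so the triangle inequality fails at most by a
  constant, which \<open>C\<close> absorbs. The second difference of \<open>t \<mapsto> t^p\<close> is bounded by
  \<open>\<bar>\<nu>\<^sub>x(a) - \<nu>\<^sub>x(a')\<bar> * \<bar>\<nu>\<^sub>x(b) - \<nu>\<^sub>x(b')\<bar>\<close> times a power \<open>p - 2\<close>, and a vertex \<open>x\<close> on the bridge between the two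
  geodesics cannot be close to both, which gives the exponential decay of the double difference. The parameters
  are determined by the least admissible \<open>\<delta>\<close> and the maximal valence, so that the construction commutes
  with isomorphisms.\<close>

section \<open>Geometry of fine triangles\<close>

text \<open>Only vertices occur, so all distances are natural numbers, and geodesics enter through
  single points on them. \<open>fine\<close> is fineness at the corner \<open>x\<close>: its last
  premise says that \<open>p\<close> and \<open>q\<close> lie at height at most the Gromov product
  \<open>(y|z)\<^sub>x\<close>, so the internal points of the triangle, which may be midpoints of
  edges, never have to be named.\<close>

locale fine_graph =
  fixes V :: "'a set" and d :: "'a \<Rightarrow> 'a \<Rightarrow> nat" and \<delta> N :: nat
  assumes d_eq_0: "x \<in> V \<Longrightarrow> y \<in> V \<Longrightarrow> d x y = 0 \<longleftrightarrow> x = y"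
    and d_sym: "x \<in> V \<Longrightarrow> y \<in> V \<Longrightarrow> d x y = d y x"
    and d_tri: "x \<in> V \<Longrightarrow> y \<in> V \<Longrightarrow> z \<in> V \<Longrightarrow> d x z \<le> d x y + d y z"
    and geo: "x \<in> V \<Longrightarrow> y \<in> V \<Longrightarrow> k \<le> d x y \<Longrightarrow> \<exists>w\<in>V. d x w = k \<and> d w y = d x y - k"
    and fine: "x \<in> V \<Longrightarrow> y \<in> V \<Longrightarrow> z \<in> V \<Longrightarrow> p \<in> V \<Longrightarrow> q \<in> V \<Longrightarrow>
      d x p + d p y = d x y \<Longrightarrow> d x q + d q z = d x z \<Longrightarrow> d x p = d x q \<Longrightarrow>
      2 * d x p + d y z \<le> d x y + d x z \<Longrightarrow> d p q \<le> \<delta>"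
    and delta_pos: "0 < \<delta>"
    and N_ge_2: "2 \<le> N"
    and unit_ball: "x \<in> V \<Longrightarrow> finite {y \<in> V. d x y \<le> 1} \<and> card {y \<in> V. d x y \<le> 1} \<le> N"
begin

lemma d_self [simp]: "x \<in> V \<Longrightarrow> d x x = 0"
  using d_eq_0 by blast

section \<open>Points on geodesics to nearby vertices\<close>

text \<open>The points are chosen independently of each other: each lies on some geodesic, but
  \<open>w\<close> need not trace one path.\<close>

lemma geo_sequence:
  assumes "a \<in> V" "b \<in> V"
  obtains w where "\<And>i. i \<le> d a b \<Longrightarrow> w i \<in> V \<and> d a (w i) = i \<and> d (w i) b = d a b - i"
proof -
  have "\<exists>w. \<forall>i. i \<le> d a b \<longrightarrow> w i \<in> V \<and> d a (w i) = i \<and> d (w i) b = d a b - i"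
    using geo[OF assms] by (intro choice) blast
  then show ?thesis using that by blast
qed

text \<open>With \<open>i\<close> the Gromov product \<open>(b|x)\<^sub>a\<close> rounded down,
  fineness at \<open>a\<close> puts \<open>w i\<close> within \<delta> of a geodesic from
  \<open>a\<close> to \<open>x\<close>. So the distance from \<open>x\<close> to the geodesic is
  about \<open>(a|b)\<^sub>x\<close>; the summand 1 pays for the rounding.\<close>

lemma geodesic_near_point:
  assumes V: "x \<in> V" "a \<in> V" "b \<in> V"
    and w: "\<And>i. i \<le> d a b \<Longrightarrow> w i \<in> V \<and> d a (w i) = i \<and> d (w i) b = d a b - i"
  shows "\<exists>i\<le>d a b. 2 * d x (w i) + d a b \<le> d x a + d x b + 2 * \<delta> + 1"
proof -
  define i where "i = (d a x + d a b - d x b) div 2"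
  have t: "d a x \<le> d a b + d x b" "d x b \<le> d a x + d a b" "d a b \<le> d a x + d x b"
    using d_tri V d_sym by metis+
  have i: "i \<le> d a b" "i \<le> d a x" "2 * i + d x b \<le> d a x + d a b" "d a x + d a b \<le> 2 * i + 1 + d x b"
    using t unfolding i_def by linarith+
  obtain p where p: "p \<in> V" "d a p = i" "d p x = d a x - i"
    using geo[OF V(2,1) i(2)] by blast
  have "d p (w i) \<le> \<delta>"
    using fine[of a x b p "w i"] V p w[OF i(1)] i by simp
  moreover have "d x (w i) \<le> d x p + d p (w i)" using d_tri V p w[OF i(1)] by blast
  moreover have "d x p = d a x - i" "d x a = d a x" using p V d_sym by auto
  ultimately have "2 * d x (w i) + d a b \<le> d x a + d x b + 2 * \<delta> + 1"
    using i by linarith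
  then show ?thesis using i by blast
qed

text \<open>An excess of at most \<open>4 * \<delta>\<close> means
  \<open>(u|a)\<^sub>x \<ge> t - 2 * \<delta>\<close>, and likewise for \<open>v\<close> and
  \<open>b\<close>. At level \<open>t - 2 * \<delta>\<close> the geodesics from \<open>x\<close> to
  \<open>u\<close>, \<open>a\<close>, \<open>b\<close>, \<open>v\<close> are therefore consecutively
  within \<delta>, and 7 = 2 + 3 + 2.\<close>

lemma level_points_close:
  assumes V: "x \<in> V" "a \<in> V" "b \<in> V" "u \<in> V" "v \<in> V"
    and lev: "d x u = t" "d x v = t"
    and ex: "d x u + d u a \<le> d x a + 4 * \<delta>" "d x v + d v b \<le> d x b + 4 * \<delta>"
    and g: "2 * t + d a b \<le> d x a + d x b"
  shows "d u v \<le> 7 * \<delta>"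
proof (cases "t \<le> 2 * \<delta>")
  case True
  then show ?thesis using d_tri[of u x v] d_sym[of u x] V lev by linarith
next
  case False
  define l where "l = t - 2 * \<delta>"
  have t: "t \<le> d x a" "t \<le> d x b"
    using g d_tri[of x a b] d_tri[of x b a] d_sym[of a b] V by linarith+
  have l: "l \<le> d x u" "l \<le> d x a" "l \<le> d x b" "l \<le> d x v" using t lev by (auto simp: l_def)
  obtain p where p: "p \<in> V" "d x p = l" "d p u = d x u - l" using geo[OF V(1,4) l(1)] by blast
  obtain q where q: "q \<in> V" "d x q = l" "d q a = d x a - l" using geo[OF V(1,2) l(2)] by blast
  obtain r where r: "r \<in> V" "d x r = l" "d r b = d x b - l" using geo[OF V(1,3) l(3)] by blast
  obtain s where s: "s \<in> V" "d x s = l" "d s v = d x v - l" using geo[OF V(1,5) l(4)] by blast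
  have "d p q \<le> \<delta>" using fine[of x u a p q] V p q l ex lev False by (simp add: l_def)
  moreover have "2 * l + d a b \<le> d x a + d x b" using g by (simp add: l_def)
  then have "d q r \<le> \<delta>" using fine[of x a b q r] V q r l by simp
  moreover have "d s r \<le> \<delta>" using fine[of x v b s r] V s r l ex lev False by (simp add: l_def)
  moreover have "d p u = 2 * \<delta>" "d s v = 2 * \<delta>" using p s lev False by (auto simp: l_def)
  moreover have "d u v \<le> d u p + d p v" "d p v \<le> d p q + d q v" "d q v \<le> d q r + d r v" "d r v \<le> d r s + d s v"
    using d_tri V p q r s by blast+
  moreover have "d u p = d p u" "d r s = d s r" using d_sym V p r s by blast+
  ultimately show ?thesis by linarith
qed

text \<open>The errors of successive steps do not add up. At level \<delta> below \<open>u'\<close>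
  the geodesics to \<open>u'\<close>, \<open>u\<close> and \<open>a\<close> are consecutively within
  \<delta>; the new excess is \<delta> for going down from \<open>u'\<close>,
  \<open>2 * \<delta>\<close> for crossing over and \<delta> for the lower starting level. The old
  excess only serves to make fineness applicable between \<open>u\<close> and
  \<open>a\<close>.\<close>

lemma excess_step:
  assumes V: "x \<in> V" "a \<in> V" "u \<in> V" "u' \<in> V"
    and ex: "d x u + d u a \<le> d x a + 4 * \<delta>"
    and st: "d u u' + d x u' \<le> d x u + \<delta>" "\<delta> \<le> d x u'" "d x u' \<le> d x u"
    and far: "u = a \<or> d x u' + 2 * \<delta> \<le> d x u"
  shows "d x u' + d u' a \<le> d x a + 4 * \<delta>"
proof -
  define l where "l = d x u' - \<delta>"
  have "l \<le> d x a" using far ex st d_tri[of x a u] d_sym[of a u] d_tri[of x u a] V unfolding l_def by (elim disjE) auto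
  then have l: "l \<le> d x u'" "l \<le> d x u" "l \<le> d x a" using st by (auto simp: l_def)
  obtain p where p: "p \<in> V" "d x p = l" "d p u' = d x u' - l" using geo[OF V(1,4) l(1)] by blast
  obtain q where q: "q \<in> V" "d x q = l" "d q u = d x u - l" using geo[OF V(1,3) l(2)] by blast
  obtain r where r: "r \<in> V" "d x r = l" "d r a = d x a - l" using geo[OF V(1,2) l(3)] by blast
  have "d p q \<le> \<delta>" using fine[of x u' u p q] V p q l st d_sym[of u u'] by (simp add: l_def)
  moreover have "2 * l + d u a \<le> d x u + d x a" using far
  proof
    assume "u = a" then show ?thesis using l V by simp
  next
    assume "d x u' + 2 * \<delta> \<le> d x u" then show ?thesis using ex st by (simp add: l_def)
  qed
  then have "d q r \<le> \<delta>" using fine[of x u a q r] V q r l by simp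
  moreover have "d u' a \<le> d u' p + d p a" "d p a \<le> d p q + d q a" "d q a \<le> d q r + d r a"
    using d_tri V p q r by blast+
  moreover have "d u' p = d p u'" using d_sym V p by blast
  ultimately show ?thesis using p r l st by (simp add: l_def)
qed

text \<open>Here \<open>(u|v)\<^sub>x\<close> is at least
  \<open>t + 5 * \<delta> - 7 * \<delta> / 2\<close>, which exceeds \<open>t\<close>, so the
  geodesics to \<open>u\<close> and \<open>v\<close> are within \<delta> at level \<open>t\<close>.
  Spheres \<open>5 * \<delta>\<close> apart are far enough for this.\<close>

lemma descent_overlap:
  assumes V: "x \<in> V" "u \<in> V" "v \<in> V"
    and lev: "d x u = t + 5 * \<delta>" "d x v = t + 5 * \<delta>" and near: "d u v \<le> 7 * \<delta>"
  shows "\<exists>y\<in>V. d x y = t \<and> d u y \<le> 6 * \<delta> \<and> d v y \<le> 6 * \<delta>"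
proof -
  obtain p where p: "p \<in> V" "d x p = t" "d p u = d x u - t" using geo[OF V(1,2), of t] lev by auto
  obtain q where q: "q \<in> V" "d x q = t" "d q v = d x v - t" using geo[OF V(1,3), of t] lev by auto
  have "d p q \<le> \<delta>" using fine[of x u v p q] V p q lev near by simp
  then have "d v p \<le> 6 * \<delta>" using d_tri[of v q p] d_sym[of v q] d_sym[of p q] V p q lev by simp
  moreover have "d u p \<le> 6 * \<delta>" using d_sym[of u p] V p lev by simp
  ultimately show ?thesis using p by blast
qed

text \<open>Closeness reproduces itself from one sphere to the next: at level
  \<open>t - \<delta>\<close> the geodesics to \<open>u'\<close>, \<open>u\<close>,
  \<open>v\<close>, \<open>v'\<close> are consecutively within \<delta>, which even yields
  \<open>5 * \<delta>\<close>.\<close>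

lemma descent_close:
  assumes V: "x \<in> V" "u \<in> V" "v \<in> V" "u' \<in> V" "v' \<in> V"
    and lev: "d x u = t + 5 * \<delta>" "d x v = t + 5 * \<delta>" and near: "d u v \<le> 7 * \<delta>"
    and lev': "d x u' = t" "d x v' = t" and st: "d u u' \<le> 6 * \<delta>" "d v v' \<le> 6 * \<delta>" and t: "\<delta> \<le> t"
  shows "d u' v' \<le> 7 * \<delta>"
proof -
  define l where "l = t - \<delta>"
  have l: "l \<le> d x u'" "l \<le> d x u" "l \<le> d x v" "l \<le> d x v'" using lev lev' by (auto simp: l_def)
  obtain p where p: "p \<in> V" "d x p = l" "d p u' = d x u' - l" using geo[OF V(1,4) l(1)] by blast
  obtain q where q: "q \<in> V" "d x q = l" "d q u = d x u - l" using geo[OF V(1,2) l(2)] by blast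
  obtain r where r: "r \<in> V" "d x r = l" "d r v = d x v - l" using geo[OF V(1,3) l(3)] by blast
  obtain s where s: "s \<in> V" "d x s = l" "d s v' = d x v' - l" using geo[OF V(1,5) l(4)] by blast
  have "d p q \<le> \<delta>" using fine[of x u' u p q] V p q l lev lev' st t d_sym[of u u'] by (simp add: l_def)
  moreover have "d q r \<le> \<delta>" using fine[of x u v q r] V q r l lev near t by (simp add: l_def)
  moreover have "d s r \<le> \<delta>" using fine[of x v' v s r] V s r l lev lev' st t d_sym[of v v'] by (simp add: l_def)
  moreover have "d p u' = \<delta>" "d s v' = \<delta>" using p s lev' t by (auto simp: l_def)
  moreover have "d u' v' \<le> d u' p + d p v'" "d p v' \<le> d p q + d q v'" "d q v' \<le> d q r + d r v'" "d r v' \<le> d r s + d s v'"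
    using d_tri V p q r s by blast+
  moreover have "d u' p = d p u'" "d r s = d s r" using d_sym V p r s by blast+
  ultimately show ?thesis by linarith
qed

section \<open>Geodesics that run side by side\<close>

text \<open>If two geodesics stay within \<open>2 * \<delta>\<close> of each other for long enough, then the
  defect \<open>d (u i) (v j) - (j - i)\<close> takes the same value on an interval and on two separated
  subintervals of it. Crossing over in the left or in the right subinterval gives two geodesics
  with common end points, and fineness of this bigon makes the two given geodesics meet within
  \<open>\<delta>\<close>.\<close>

primrec overlap_bound :: "nat \<Rightarrow> nat" where
  "overlap_bound 0 = 0"
| "overlap_bound (Suc k) = 2 * overlap_bound k + 2 * \<delta>"

lemma overlap_defect:
  assumes V: "\<And>i. i \<le> K \<Longrightarrow> u i \<in> V \<and> v i \<in> V"
    and u: "\<And>i j. i \<le> j \<Longrightarrow> j \<le> K \<Longrightarrow> d (u i) (u j) = j - i"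
    and v: "\<And>i j. i \<le> j \<Longrightarrow> j \<le> K \<Longrightarrow> d (v i) (v j) = j - i"
    and near: "\<And>i. i \<le> K \<Longrightarrow> d (u i) (v i) \<le> 2 * \<delta>"
    and apart: "\<And>i j. i \<le> K \<Longrightarrow> j \<le> K \<Longrightarrow> \<delta> < d (u i) (v j)"
  shows "lo + overlap_bound k \<le> K \<Longrightarrow> d (u lo) (v (lo + overlap_bound k)) + k \<le> overlap_bound k + 2 * \<delta>"
proof (induction k arbitrary: lo)
  case 0
  then show ?case using near by simp
next
  case (Suc k)
  define L where "L = overlap_bound k"
  define t1 where "t1 = lo + L"
  define s2 where "s2 = t1 + 2 * \<delta>"
  define hi where "hi = s2 + L"
  have hi: "hi \<le> K" "lo + overlap_bound (Suc k) = hi" using Suc.prems by (auto simp: hi_def s2_def t1_def L_def)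
  have ord: "lo \<le> t1" "t1 \<le> s2" "s2 \<le> hi" by (auto simp: hi_def s2_def t1_def)
  have I1: "d (u lo) (v t1) + k \<le> L + 2 * \<delta>" using Suc.IH[of lo] hi ord by (simp add: t1_def L_def)
  have I2: "d (u s2) (v hi) + k \<le> L + 2 * \<delta>" using Suc.IH[of s2] hi ord by (simp add: hi_def L_def)
  have VV: "u lo \<in> V" "v t1 \<in> V" "u s2 \<in> V" "v hi \<in> V" "v lo \<in> V" "u hi \<in> V" using V hi ord by auto
  have J1: "d (u lo) (v hi) \<le> d (u lo) (v t1) + (hi - t1)"
    using d_tri[of "u lo" "v t1" "v hi"] v[of t1 hi] VV hi ord by simp
  have J2: "d (u lo) (v hi) \<le> (s2 - lo) + d (u s2) (v hi)"
    using d_tri[of "u lo" "u s2" "v hi"] u[of lo s2] VV hi ord by simp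
  show ?case
  proof (rule ccontr)
    assume "\<not> ?case"
    then have n: "2 * L + 4 * \<delta> \<le> d (u lo) (v hi) + k" using hi by (simp add: L_def)
    have low: "hi - lo \<le> d (u lo) (v hi) + 2 * \<delta>"
      using d_tri[of "u lo" "v hi" "u hi"] near[of hi] d_sym[of "u hi" "v hi"] u[of lo hi] VV hi ord by simp
    \<comment> \<open>One of the two truncated differences is 0, and \<open>i - j\<close> is
      \<open>2 * \<delta> - k\<close> as an integer. This choice gives \<open>u i\<close> and
      \<open>v j\<close> the same distance from \<open>u lo\<close>.\<close>
    define i where "i = t1 + (2 * \<delta> - k)"
    define j where "j = t1 + (k - 2 * \<delta>)"
    \<comment> \<open>Failure of the claim turns all previous estimates into equalities: the defect
      is exactly \<open>2 * \<delta> - k\<close> on the left part, on the right part and on the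
      whole interval.\<close>
    have e: "d (u lo) (v hi) + k = 2 * L + 4 * \<delta>" "d (u lo) (v t1) + k = L + 2 * \<delta>" "d (u s2) (v hi) + k = L + 2 * \<delta>"
      using n J1 J2 I1 I2 by (auto simp: hi_def s2_def t1_def)
    have k: "k \<le> 4 * \<delta>" using low e by (simp add: hi_def s2_def t1_def)
    have ij: "lo \<le> i" "t1 \<le> i" "i \<le> s2" "i \<le> hi" "t1 \<le> j" "j \<le> s2" "j \<le> hi" "lo \<le> j"
      using k ord by (auto simp: i_def j_def s2_def t1_def)
    have Vij: "u i \<in> V" "v j \<in> V" using V ij hi by auto
    have a1: "d (u lo) (u i) = i - lo" using u ij hi by simp
    \<comment> \<open>\<open>u i\<close> lies on the path that crosses over in the right part,
      \<open>v j\<close> below on the path that crosses over in the left part; both paths are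
      geodesics from \<open>u lo\<close> to \<open>v hi\<close>.\<close>
    have "d (u i) (v hi) \<le> (s2 - i) + d (u s2) (v hi)"
      using d_tri[of "u i" "u s2" "v hi"] u[of i s2] VV Vij hi ord ij by simp
    then have a2: "d (u lo) (u i) + d (u i) (v hi) = d (u lo) (v hi)"
      using d_tri[of "u lo" "u i" "v hi"] VV Vij a1 e ij k ord by (simp add: hi_def s2_def t1_def)
    have a3: "d (v j) (v hi) = hi - j" using v ij hi by simp
    have "d (u lo) (v j) \<le> d (u lo) (v t1) + (j - t1)"
      using d_tri[of "u lo" "v t1" "v j"] v[of t1 j] VV Vij hi ord ij by simp
    then have a4: "d (u lo) (v j) + d (v j) (v hi) = d (u lo) (v hi)"
      using d_tri[of "u lo" "v j" "v hi"] VV Vij a3 e ij k ord by (simp add: hi_def s2_def t1_def)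
    have "d (u lo) (u i) = d (u lo) (v j)"
      using a1 a3 a4 e ij k unfolding i_def j_def hi_def s2_def t1_def by linarith
    then have "d (u i) (v j) \<le> \<delta>"
      using fine[of "u lo" "v hi" "v hi" "u i" "v j"] VV Vij a2 a4 by simp
    then show False using apart[of i j] ij hi by simp
  qed
qed

text \<open>Since matching points are within \<open>2 * \<delta>\<close>, the defect cannot fall
  below \<open>- 2 * \<delta>\<close>. It starts at most at \<open>2 * \<delta>\<close>, and each
  stage of \<open>overlap_bound\<close> lowers the bound by one, so stage
  \<open>4 * \<delta> + 1\<close> is out of reach.\<close>

lemma overlap_length:
  assumes "\<And>i. i \<le> K \<Longrightarrow> u i \<in> V \<and> v i \<in> V"
    and u: "\<And>i j. i \<le> j \<Longrightarrow> j \<le> K \<Longrightarrow> d (u i) (u j) = j - i"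
    and "\<And>i j. i \<le> j \<Longrightarrow> j \<le> K \<Longrightarrow> d (v i) (v j) = j - i"
    and near: "\<And>i. i \<le> K \<Longrightarrow> d (u i) (v i) \<le> 2 * \<delta>"
    and "\<And>i j. i \<le> K \<Longrightarrow> j \<le> K \<Longrightarrow> \<delta> < d (u i) (v j)"
  shows "K < overlap_bound (4 * \<delta> + 1)"
proof (rule ccontr)
  define L where "L = overlap_bound (4 * \<delta> + 1)"
  assume "\<not> K < overlap_bound (4 * \<delta> + 1)"
  then have L: "L \<le> K" by (simp add: L_def)
  have "d (u 0) (v L) + (4 * \<delta> + 1) \<le> L + 2 * \<delta>"
    using overlap_defect[OF assms, where k = "4 * \<delta> + 1" and lo = 0] L by (simp add: L_def)
  moreover have "d (u 0) (u L) \<le> d (u 0) (v L) + d (v L) (u L)" using d_tri assms(1) L by blast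
  moreover have "d (v L) (u L) \<le> 2 * \<delta>" using near[OF L] d_sym assms(1)[OF L] by simp
  ultimately show False using u[of 0 L] L by simp
qed

section \<open>The bridge between two separated geodesics\<close>

text \<open>In a tree this is the equality for two disjoint segments joined by a bridge of length
  \<open>D\<close>. A geodesic from \<open>a\<close> to \<open>b\<close> follows \<alpha> up to
  \<open>(a'|b)\<^sub>a\<close>, then the bridge, then \<beta> backwards from
  \<open>(b'|a)\<^sub>b\<close> on. If the two stretches do not overlap, the gap between them is at
  least \<open>D - 2 * \<delta>\<close>; if they do, \<open>overlap_length\<close> bounds the
  overlap.\<close>

lemma bridge:
  assumes V: "a \<in> V" "a' \<in> V" "b \<in> V" "b' \<in> V"
    and \<alpha>: "\<And>i. i \<le> d a a' \<Longrightarrow> \<alpha> i \<in> V \<and> d a (\<alpha> i) = i \<and> d (\<alpha> i) a' = d a a' - i"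
      "\<And>i j. i \<le> j \<Longrightarrow> j \<le> d a a' \<Longrightarrow> d (\<alpha> i) (\<alpha> j) = j - i"
    and \<beta>: "\<And>i. i \<le> d b b' \<Longrightarrow> \<beta> i \<in> V \<and> d b (\<beta> i) = i \<and> d (\<beta> i) b' = d b b' - i"
      "\<And>i j. i \<le> j \<Longrightarrow> j \<le> d b b' \<Longrightarrow> d (\<beta> i) (\<beta> j) = j - i"
    and D: "\<And>i j. i \<le> d a a' \<Longrightarrow> j \<le> d b b' \<Longrightarrow> D \<le> d (\<alpha> i) (\<beta> j)" "\<delta> < D"
  shows "d a a' + d b b' + 2 * D \<le> d a' b + d a b' + (2 * overlap_bound (4 * \<delta> + 1) + 4 * \<delta> + 2)"
proof -
  define i0 where "i0 = (d a a' + d a b - d a' b) div 2"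
  define j0 where "j0 = (d b b' + d a b - d a b') div 2"
  have s: "d b a = d a b" "d b' a = d a b'" using d_sym V by auto
  have t: "d a' b \<le> d a a' + d a b" "d a b \<le> d a a' + d a' b" "d a a' \<le> d a b + d a' b"
    "d a b' \<le> d b b' + d a b" "d a b \<le> d b b' + d a b'" "d b b' \<le> d a b + d a b'"
    using d_tri V d_sym by (metis add.commute)+
  have i0: "i0 \<le> d a a'" "i0 \<le> d a b" "2 * i0 + d a' b \<le> d a a' + d a b" "d a a' + d a b \<le> 2 * i0 + 1 + d a' b"
    using t(1-3) unfolding i0_def by linarith+
  have j0: "j0 \<le> d b b'" "j0 \<le> d a b" "2 * j0 + d a b' \<le> d b b' + d a b" "d b b' + d a b \<le> 2 * j0 + 1 + d a b'"
    using t(4-6) unfolding j0_def by linarith+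
  obtain w where w: "\<And>i. i \<le> d a b \<Longrightarrow> w i \<in> V \<and> d a (w i) = i \<and> d (w i) b = d a b - i"
    using geo_sequence V by blast
  have nearA: "d (\<alpha> i) (w i) \<le> \<delta>" if "i \<le> i0" for i
    using fine[of a a' b "\<alpha> i" "w i"] V \<alpha>(1)[of i] w[of i] i0 that by simp
  have nearB: "d (\<beta> j) (w (d a b - j)) \<le> \<delta>" if "j \<le> j0" for j
  proof -
    have "d b (w (d a b - j)) = j" "d (w (d a b - j)) a = d a b - j" "w (d a b - j) \<in> V"
      using w[of "d a b - j"] d_sym V that j0 by auto
    then show ?thesis
      using fine[of b b' a "\<beta> j" "w (d a b - j)"] V \<beta>(1)[of j] j0 that s by simp
  qed
  show ?thesis
  proof (cases "i0 + j0 \<le> d a b")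
    case True
    have "D \<le> d (\<alpha> i0) (\<beta> j0)" using D i0 j0 by simp
    define k where "k = d a b - j0"
    have Vs: "\<alpha> i0 \<in> V" "\<beta> j0 \<in> V" "w i0 \<in> V" "w k \<in> V" using \<alpha>(1) \<beta>(1) w i0 j0 by (auto simp: k_def)
    text \<open>The sequence \<open>w\<close> need not be a geodesic, so the distance of its entries is bounded through
      an auxiliary one.\<close>
    have "k - i0 \<le> d (w i0) b" using w[OF i0(2)] by (simp add: k_def)
    from geo[OF Vs(3) V(3) this]
    obtain p where p: "p \<in> V" "d (w i0) p = k - i0" "d p b = d (w i0) b - (k - i0)" by blast
    have "d a p \<le> k" using d_tri[of a "w i0" p] V Vs p w[OF i0(2)] True by (simp add: k_def)
    moreover have "d p b = j0" using p w[OF i0(2)] True j0 by (simp add: k_def)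
    moreover have "d a b \<le> d a p + d p b" using d_tri V p by blast
    ultimately have "d a p = k" "d p b = j0" using j0 by (auto simp: k_def)
    then have "d b p = j0" "d p a = d a b - j0" using d_sym p V by (auto simp: k_def)
    then have "d (\<beta> j0) p \<le> \<delta>"
      using fine[of b b' a "\<beta> j0" p] V \<beta>(1)[of j0] j0 p s by simp
    moreover have "d (\<alpha> i0) (\<beta> j0) \<le> d (\<alpha> i0) (w i0) + d (w i0) (\<beta> j0)" "d (w i0) (\<beta> j0) \<le> d (w i0) p + d p (\<beta> j0)"
      "d p (\<beta> j0) = d (\<beta> j0) p"
      using d_tri d_sym Vs p by blast+
    ultimately have "D \<le> 2 * \<delta> + (k - i0)" using nearA[of i0] p \<open>D \<le> _\<close> by simp
    then show ?thesis using i0 j0 True by (simp add: k_def)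
  next
    case False
    define K where "K = i0 + j0 - d a b"
    \<comment> \<open>The stretch of \<alpha> and the reversed stretch of \<beta> that accompany the
      same part of the geodesic from \<open>a\<close> to \<open>b\<close>, at equal
      positions.\<close>
    define u where "u = (\<lambda>i. \<alpha> (d a b - j0 + i))"
    define v where "v = (\<lambda>i. \<beta> (j0 - i))"
    have K: "d a b - j0 + i \<le> i0" "i \<le> j0" "d a b - (j0 - i) = d a b - j0 + i" if "i \<le> K" for i
      using that False i0 j0 by (auto simp: K_def)
    have Vuv: "u i \<in> V \<and> v i \<in> V" if "i \<le> K" for i
      using \<alpha>(1)[of "d a b - j0 + i"] \<beta>(1)[of "j0 - i"] K[OF that] i0 j0 by (auto simp: u_def v_def)
    have near: "d (u i) (v i) \<le> 2 * \<delta>" if "i \<le> K" for i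
    proof -
      have W: "w (d a b - j0 + i) \<in> V" using w K[OF that] i0 by simp
      have "d (u i) (w (d a b - j0 + i)) \<le> \<delta>" using nearA[OF K(1)[OF that]] by (simp add: u_def)
      moreover have "d (v i) (w (d a b - j0 + i)) \<le> \<delta>"
        using nearB[of "j0 - i"] K[OF that] by (simp add: v_def)
      ultimately show ?thesis
        using d_tri[of "u i" "w (d a b - j0 + i)" "v i"] d_sym[of "v i"] Vuv[OF that] W by fastforce
    qed
    have uu: "d (u i) (u j) = j - i" if "i \<le> j" "j \<le> K" for i j
      using \<alpha>(2)[of "d a b - j0 + i" "d a b - j0 + j"] that K[of j] i0 by (simp add: u_def)
    have vv: "d (v i) (v j) = j - i" if "i \<le> j" "j \<le> K" for i j
    proof -
      have "d (\<beta> (j0 - j)) (\<beta> (j0 - i)) = j - i" using \<beta>(2)[of "j0 - j" "j0 - i"] that K[of j] j0 by simp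
      then show ?thesis using d_sym[of "v i" "v j"] Vuv[of i] Vuv[of j] that by (simp add: v_def)
    qed
    have D': "D \<le> d (u i) (v j)" if "i \<le> K" "j \<le> K" for i j
      using D(1)[of "d a b - j0 + i" "j0 - j"] K[OF that(1)] K[OF that(2)] i0 j0 by (simp add: u_def v_def)
    then have "\<delta> < d (u i) (v j)" if "i \<le> K" "j \<le> K" for i j using D(2) that by fastforce
    then have "K < overlap_bound (4 * \<delta> + 1)"
      using overlap_length[OF Vuv uu vv near] by blast
    moreover have "D \<le> 2 * \<delta>" using D'[of 0 0] near[of 0] by simp
    ultimately show ?thesis using i0 j0 False unfolding K_def by linarith
  qed
qed

end

section \<open>The flow towards a vertex\<close>

definition descent :: "'a set \<Rightarrow> ('a \<Rightarrow> 'a \<Rightarrow> nat) \<Rightarrow> nat \<Rightarrow> 'a \<Rightarrow> 'a \<Rightarrow> 'a set" where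
  "descent V d \<delta> x y =
     {y' \<in> V. d x y' = 5 * \<delta> * ((d x y - 1) div (5 * \<delta>)) \<and> d y y' + d x y' \<le> d x y + \<delta>}"

lemma descent_less:
  assumes "y' \<in> descent V d \<delta> x y" "0 < d x y" shows "d x y' < d x y"
proof -
  have "5 * \<delta> * ((d x y - 1) div (5 * \<delta>)) \<le> d x y - 1" by simp
  then have "d x y' \<le> d x y - 1" using assms(1) unfolding descent_def mem_Collect_eq by metis
  then show ?thesis using assms(2) by linarith
qed

text \<open>\<open>flow V d \<delta> x y z\<close> is the probability that the flow towards
  \<open>x\<close> started at \<open>y\<close> stops at \<open>z\<close>, that is, the weight of
  \<open>z\<close> in \<open>\<nu>\<^sub>x(y)\<close>.\<close>

function flow :: "'a set \<Rightarrow> ('a \<Rightarrow> 'a \<Rightarrow> nat) \<Rightarrow> nat \<Rightarrow> 'a \<Rightarrow> 'a \<Rightarrow> 'a \<Rightarrow> real" where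
  "flow V d \<delta> x y z = (if d x y \<le> 5 * \<delta> then of_bool (z = y)
     else (\<Sum>y'\<in>descent V d \<delta> x y. flow V d \<delta> x y' z) / real (card (descent V d \<delta> x y)))"
  by pat_completeness auto
termination
proof (relation "measure (\<lambda>(V, d, \<delta>, x, y, z). d x y)", goal_cases)
  case (2 V d \<delta> x y z y')
  then show ?case using descent_less[of y' V d \<delta> x y] by simp
qed simp

declare flow.simps [simp del]

lemma flow_transfer:
  assumes g: "bij_betw g V V'" and iso: "\<And>x y. x \<in> V \<Longrightarrow> y \<in> V \<Longrightarrow> d' (g x) (g y) = d x y"
    and x: "x \<in> V" and z: "z \<in> V"
  shows "y \<in> V \<Longrightarrow> flow V' d' \<delta> (g x) (g y) (g z) = flow V d \<delta> x y z"
proof (induction "d x y" arbitrary: y rule: less_induct)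
  case less
  have inj: "inj_on g V" and im: "g ` V = V'" using g by (auto simp: bij_betw_def)
  have D: "descent V' d' \<delta> (g x) (g y) = g ` descent V d \<delta> x y"
    using iso x less.prems im by (auto simp: descent_def)
  have sub: "descent V d \<delta> x y \<subseteq> V" by (auto simp: descent_def)
  have injD: "inj_on g (descent V d \<delta> x y)" using inj sub by (rule inj_on_subset)
  show ?case
  proof (cases "d x y \<le> 5 * \<delta>")
    case True
    then show ?thesis using iso x z less.prems inj by (simp add: flow.simps inj_on_eq_iff)
  next
    case False
    have lt: "d x y' < d x y" if "y' \<in> descent V d \<delta> x y" for y'
      using descent_less[OF that] False by linarith
    have "(\<Sum>y'\<in>g ` descent V d \<delta> x y. flow V' d' \<delta> (g x) y' (g z)) = (\<Sum>y'\<in>descent V d \<delta> x y. flow V d \<delta> x y' z)"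
      using sub less.hyps lt by (subst sum.reindex[OF injD]) (auto intro!: sum.cong)
    then show ?thesis
      using False iso x less.prems injD
      by (subst (1 2) flow.simps) (simp add: D card_image)
  qed
qed

section \<open>Averages and coupling\<close>

lemma average_near:
  fixes f :: "'b \<Rightarrow> real"
  assumes "finite S" "S \<noteq> {}" and near: "\<And>y. y \<in> S \<Longrightarrow> \<bar>f y - c\<bar> \<le> e"
  shows "\<bar>sum f S / real (card S) - c\<bar> \<le> e"
proof -
  have pos: "real (card S) > 0" using assms by (simp add: card_gt_0_iff)
  have "\<bar>\<Sum>y\<in>S. f y - c\<bar> \<le> (\<Sum>y\<in>S. e)" using near by (intro order_trans[OF sum_abs] sum_mono) auto
  then have "\<bar>sum f S - real (card S) * c\<bar> \<le> real (card S) * e" by (simp add: sum_subtractf)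
  moreover have "sum f S / real (card S) - c = (sum f S - real (card S) * c) / real (card S)"
    using pos by (simp add: field_simps)
  ultimately show ?thesis using pos by (simp add: abs_divide field_simps)
qed

text \<open>Couple the two averages by drawing \<open>u\<close> and \<open>v\<close> independently
  and uniformly. The pair \<open>(y, y)\<close> contributes nothing to the difference, and its
  probability is at least \<open>1 / M\<^sup>2\<close>.\<close>

lemma averages_overlap:
  fixes f :: "'b \<Rightarrow> real"
  assumes S: "finite S" "card S \<le> M" and T: "finite T" "card T \<le> M" and y: "y \<in> S" "y \<in> T"
    and close: "\<And>u v. u \<in> S \<Longrightarrow> v \<in> T \<Longrightarrow> \<bar>f u - f v\<bar> \<le> e"
  shows "\<bar>sum f S / real (card S) - sum f T / real (card T)\<bar> \<le> (1 - 1 / (real M)\<^sup>2) * e"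
proof -
  have pos: "0 < card S" "0 < card T" using S T y by (auto simp: card_gt_0_iff)
  define n where "n = real (card S) * real (card T)"
  have n: "1 \<le> n" "n \<le> (real M)\<^sup>2" using pos S T unfolding n_def power2_eq_square
    by (metis One_nat_def Suc_leI mult_mono' of_nat_1 of_nat_mono of_nat_mult mult_1 zero_le_one, simp add: mult_mono)
  have e: "0 \<le> e" using close[OF y] by simp
  have "(\<Sum>(u, v)\<in>S \<times> T. f u - f v) = real (card T) * sum f S - real (card S) * sum f T"
    by (simp add: sum.cartesian_product[symmetric] sum_subtractf sum_distrib_left sum_distrib_right mult.commute)
  then have eq: "sum f S / real (card S) - sum f T / real (card T) = (\<Sum>(u, v)\<in>S \<times> T. f u - f v) / n"
    using pos by (simp add: n_def field_simps)
  have "(\<Sum>(u, v)\<in>S \<times> T. f u - f v) = (\<Sum>(u, v)\<in>S \<times> T - {(y, y)}. f u - f v)"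
    using S T y by (subst sum.remove[of _ "(y, y)"]) auto
  also have "\<bar>\<dots>\<bar> \<le> (\<Sum>(u, v)\<in>S \<times> T - {(y, y)}. e)"
    using close by (intro order_trans[OF sum_abs] sum_mono) auto
  also have "\<dots> = (n - 1) * e"
    using S T y pos by (simp add: n_def card_cartesian_product of_nat_diff Suc_leI algebra_simps)
  finally have "\<bar>(\<Sum>(u, v)\<in>S \<times> T. f u - f v) / n\<bar> \<le> (n - 1) * e / n"
    using n by (simp add: abs_divide divide_right_mono)
  also have "\<dots> = (1 - 1 / n) * e" using n by (simp add: field_simps)
  also have "1 / (real M)\<^sup>2 \<le> 1 / n" using n by (intro frac_le) auto
  then have "(1 - 1 / n) * e \<le> (1 - 1 / (real M)\<^sup>2) * e"
    using e by (intro mult_right_mono) auto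
  finally show ?thesis unfolding eq .
qed

text \<open>The factor gained in one step: descent sets of vertices on the spheres lie in balls of
  radius \<open>6 * \<delta>\<close>, which have at most \<open>N ^ (6 * \<delta>)\<close>
  vertices.\<close>

definition contraction :: "nat \<Rightarrow> nat \<Rightarrow> real" where
  "contraction \<delta> N = 1 - 1 / (real (N ^ (6 * \<delta>)))\<^sup>2"

text \<open>One step descends by \<open>5 * \<delta>\<close>, hence uses up
  \<open>10 * \<delta>\<close> of twice the Gromov product. So \<open>rate\<close> is the decay per
  unit of \<open>d x a + d x b - d a b\<close>.\<close>

definition rate :: "nat \<Rightarrow> nat \<Rightarrow> real" where
  "rate \<delta> N = contraction \<delta> N powr (1 / (10 * real \<delta>))"

context fine_graph
begin

section \<open>Balls and basic properties of the flow\<close>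

lemma ball_bound:
  assumes x: "x \<in> V"
  shows "finite {y \<in> V. d x y \<le> r} \<and> card {y \<in> V. d x y \<le> r} \<le> N ^ r"
proof (induction r)
  case 0
  have "{y \<in> V. d x y \<le> 0} = {x}" using x d_eq_0 by auto
  then show ?case by simp
next
  case (Suc r)
  have sub: "{y \<in> V. d x y \<le> Suc r} \<subseteq> (\<Union>w\<in>{y \<in> V. d x y \<le> r}. {y \<in> V. d w y \<le> 1})"
  proof
    fix y assume y: "y \<in> {y \<in> V. d x y \<le> Suc r}"
    then obtain w where "w \<in> V" "d x w = d x y - 1" "d w y = d x y - (d x y - 1)"
      using geo[of x y "d x y - 1"] x by auto
    then show "y \<in> (\<Union>w\<in>{y \<in> V. d x y \<le> r}. {y \<in> V. d w y \<le> 1})" using y by auto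
  qed
  have fin: "finite (\<Union>w\<in>{y \<in> V. d x y \<le> r}. {y \<in> V. d w y \<le> 1})" using Suc unit_ball by auto
  have "card (\<Union>w\<in>{y \<in> V. d x y \<le> r}. {y \<in> V. d w y \<le> 1}) \<le> (\<Sum>w\<in>{y \<in> V. d x y \<le> r}. card {y \<in> V. d w y \<le> 1})"
    using Suc by (intro card_UN_le) auto
  also have "\<dots> \<le> card {y \<in> V. d x y \<le> r} * N" using unit_ball by (intro order_trans[OF sum_bounded_above]) auto
  also have "\<dots> \<le> N ^ r * N" using Suc by simp
  finally show ?case using card_mono[OF fin sub] finite_subset[OF sub fin] by (simp add: mult.commute)
qed

abbreviation "fl \<equiv> flow V d \<delta>"
abbreviation "desc \<equiv> descent V d \<delta>"
abbreviation "\<theta> \<equiv> contraction \<delta> N"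
abbreviation "\<rho> \<equiv> rate \<delta> N"

lemma theta: "0 < \<theta>" "\<theta> < 1"
proof -
  have "1 < N ^ (6 * \<delta>)" using N_ge_2 delta_pos by (intro one_less_power) auto
  then have "1 < (real (N ^ (6 * \<delta>)))\<^sup>2" by (metis of_nat_1 of_nat_less_iff one_less_power zero_less_numeral)
  then have "0 < 1 / (real (N ^ (6 * \<delta>)))\<^sup>2" "1 / (real (N ^ (6 * \<delta>)))\<^sup>2 < 1"
    by (smt (verit) zero_less_divide_1_iff, simp only: divide_less_eq_1_pos)
  then show "0 < \<theta>" "\<theta> < 1" unfolding contraction_def by linarith+
qed

lemma rho: "0 < \<rho>" "\<rho> < 1"
proof -
  show "0 < \<rho>" using theta by (simp add: rate_def)
  have "\<theta> powr (1 / (10 * real \<delta>)) < 1 powr (1 / (10 * real \<delta>))" using theta delta_pos by (intro powr_less_mono2) auto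
  then show "\<rho> < 1" by (simp add: rate_def)
qed

lemma rho_mono: "s \<le> t \<Longrightarrow> \<rho> powr t \<le> \<rho> powr s"
  using rho by (intro powr_mono') auto

lemma rho_theta: "\<theta> ^ t = \<rho> powr (10 * real \<delta> * real t)"
  using theta delta_pos by (simp add: rate_def powr_powr powr_realpow)

lemma desc_sub: "y' \<in> desc x y \<Longrightarrow> y' \<in> V" by (simp add: descent_def)

lemma desc_less: "5 * \<delta> < d x y \<Longrightarrow> y' \<in> desc x y \<Longrightarrow> d x y' < d x y"
  by (rule descent_less) auto

lemma desc_finite: "y \<in> V \<Longrightarrow> finite (desc x y)"
  using ball_bound[of y "d x y + \<delta>"] by (auto simp: descent_def elim!: finite_subset[rotated])

lemma desc_nonempty:
  assumes "x \<in> V" "y \<in> V" shows "desc x y \<noteq> {}"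
proof -
  have "5 * \<delta> * ((d x y - 1) div (5 * \<delta>)) \<le> d x y - 1" by simp
  also have "\<dots> \<le> d x y" by simp
  finally have le: "5 * \<delta> * ((d x y - 1) div (5 * \<delta>)) \<le> d x y" .
  then obtain w where "w \<in> V" "d x w = 5 * \<delta> * ((d x y - 1) div (5 * \<delta>))" "d w y = d x y - d x w"
    using geo[OF assms] by metis
  moreover have "d y w = d w y" using d_sym assms \<open>w \<in> V\<close> by blast
  moreover have "d x w \<le> d x y" using calculation(2) le by metis
  ultimately show ?thesis by (auto simp: descent_def)
qed

lemma flow_near: "d x y \<le> 5 * \<delta> \<Longrightarrow> fl x y z = of_bool (z = y)"
  by (simp add: flow.simps)

lemma flow_far: "5 * \<delta> < d x y \<Longrightarrow> fl x y z = (\<Sum>y'\<in>desc x y. fl x y' z) / real (card (desc x y))"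
  by (subst flow.simps) simp

lemma flow_induct [consumes 2, case_names near far]:
  assumes "x \<in> V" "y \<in> V"
    and "\<And>y. y \<in> V \<Longrightarrow> d x y \<le> 5 * \<delta> \<Longrightarrow> P y"
    and "\<And>y. y \<in> V \<Longrightarrow> 5 * \<delta> < d x y \<Longrightarrow> (\<And>y'. y' \<in> desc x y \<Longrightarrow> P y') \<Longrightarrow> P y"
  shows "P y"
  using assms(2)
proof (induction "d x y" arbitrary: y rule: less_induct)
  case less
  show ?case
  proof (cases "d x y \<le> 5 * \<delta>")
    case False
    then show ?thesis using less assms(4)[of y] desc_less desc_sub by (metis not_le)
  qed (use less assms in blast)
qed

lemma flow_nonneg:
  assumes "x \<in> V" "y \<in> V" shows "0 \<le> fl x y z"
  using assms by (induction rule: flow_induct) (auto simp: flow_near flow_far intro!: divide_nonneg_nonneg sum_nonneg)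

lemma flow_supp:
  assumes "x \<in> V" "y \<in> V" "fl x y z \<noteq> 0" shows "z \<in> V \<and> d x z \<le> 5 * \<delta>"
proof -
  have "fl x y z \<noteq> 0 \<longrightarrow> z \<in> V \<and> d x z \<le> 5 * \<delta>"
    using assms(1,2)
  proof (induction rule: flow_induct)
    case (near y) then show ?case by (simp add: flow_near)
  next
    case (far y)
    then show ?case by (metis (no_types, lifting) div_0 flow_far sum.neutral)
  qed
  then show ?thesis using assms by blast
qed

lemma flow_sum:
  assumes "x \<in> V" "y \<in> V" shows "(\<Sum>z\<in>{z \<in> V. d x z \<le> 5 * \<delta>}. fl x y z) = 1"
  using assms
proof (induction rule: flow_induct)
  case (near y)
  then show ?case using ball_bound[OF assms(1), of "5 * \<delta>"] by (simp add: flow_near of_bool_def sum.delta)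
next
  case (far y)
  have "(\<Sum>z\<in>{z \<in> V. d x z \<le> 5 * \<delta>}. fl x y z) = (\<Sum>y'\<in>desc x y. \<Sum>z\<in>{z \<in> V. d x z \<le> 5 * \<delta>}. fl x y' z) / real (card (desc x y))"
    using far by (simp add: flow_far sum_divide_distrib[symmetric]) (subst sum.swap, simp)
  also have "\<dots> = 1" using far desc_finite[of y x] desc_nonempty[OF assms(1), of y] by simp
  finally show ?case .
qed

lemma flow_le_1:
  assumes "x \<in> V" "y \<in> V" shows "fl x y z \<le> 1"
proof (cases "fl x y z = 0")
  case False
  then have "z \<in> {z \<in> V. d x z \<le> 5 * \<delta>}" using flow_supp assms by blast
  then have "fl x y z \<le> (\<Sum>z\<in>{z \<in> V. d x z \<le> 5 * \<delta>}. fl x y z)"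
    using flow_nonneg assms ball_bound by (intro member_le_sum) auto
  then show ?thesis using flow_sum assms by simp
qed simp

section \<open>Contraction of the flow\<close>

text \<open>The value at \<open>a\<close> is an iterated average of the values at vertices of level
  \<open>5 * \<delta> * t\<close>, and by \<open>excess_step\<close> the flow only meets vertices of
  excess at most \<open>4 * \<delta>\<close>. Any interval containing the values at such vertices
  therefore contains the value at \<open>a\<close>.\<close>

lemma flow_hull:
  assumes x: "x \<in> V" and a: "a \<in> V" and t: "1 \<le> t"
    and hull: "\<And>u. u \<in> V \<Longrightarrow> d x u = 5 * \<delta> * t \<Longrightarrow> d x u + d u a \<le> d x a + 4 * \<delta> \<Longrightarrow> \<bar>fl x u z - c\<bar> \<le> e"
    and far: "5 * \<delta> * t \<le> d x a"
  shows "\<bar>fl x a z - c\<bar> \<le> e"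
proof -
  have "\<bar>fl x u z - c\<bar> \<le> e" if "u \<in> V" "5 * \<delta> * t \<le> d x u" "d x u + d u a \<le> d x a + 4 * \<delta>" "u = a \<or> 5 * \<delta> dvd d x u" for u
    using that
  proof (induction "d x u" arbitrary: u rule: less_induct)
    case less
    show ?case
    proof (cases "d x u = 5 * \<delta> * t")
      case True
      then show ?thesis using hull less.prems by blast
    next
      case False
      then have gt: "5 * \<delta> * t < d x u" using less.prems by simp
      moreover have "5 * \<delta> * 1 \<le> 5 * \<delta> * t" using t by (intro mult_le_mono) auto
      ultimately have far: "5 * \<delta> < d x u" by linarith
      have "\<bar>fl x y z - c\<bar> \<le> e" if y: "y \<in> desc x u" for y
      proof -
        define q where "q = (d x u - 1) div (5 * \<delta>)"
        have yV: "y \<in> V" and dy: "d x y = 5 * \<delta> * q" and st: "d u y + d x y \<le> d x u + \<delta>"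
          using y by (auto simp: descent_def q_def)
        have tq: "t \<le> q" unfolding q_def using gt delta_pos by (simp add: less_eq_div_iff_mult_less_eq mult.commute)
        have lt: "d x y < d x u" using desc_less far y by blast
        have yt: "5 * \<delta> * t \<le> d x y" using tq dy by simp
        \<comment> \<open>From one sphere to the next the drop is \<open>5 * \<delta>\<close>; only
          the first step, starting at \<open>a\<close>, may be shorter.\<close>
        have "u = a \<or> d x y + 2 * \<delta> \<le> d x u"
        proof (cases "u = a")
          case False
          then obtain k where k: "d x u = 5 * \<delta> * k" using less.prems by blast
          have "q < k" using lt dy k by simp
          then have "5 * \<delta> * (q + 1) \<le> 5 * \<delta> * k" by (intro mult_le_mono) auto
          then show ?thesis using dy k by simp
        qed simp
        moreover have "\<delta> \<le> d x y" using yt \<open>5 * \<delta> * 1 \<le> _\<close> by linarith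
        ultimately have "d x y + d y a \<le> d x a + 4 * \<delta>"
          using excess_step[of x a u y] x a less.prems yV st lt by simp
        then show ?thesis using less.hyps[OF lt yV yt] dy by simp
      qed
      then show ?thesis unfolding flow_far[OF far]
        using desc_finite desc_nonempty x less.prems by (intro average_near) auto
    qed
  qed
  then show ?thesis using a far by simp
qed

lemma flow_excess:
  assumes x: "x \<in> V" and a: "a \<in> V" and far: "5 * \<delta> \<le> d x a" and nz: "fl x a z \<noteq> 0"
  shows "z \<in> V" "d x z = 5 * \<delta>" "d x z + d z a \<le> d x a + 4 * \<delta>"
proof -
  have *: "z \<in> V \<and> d x z = 5 * \<delta> \<and> d x z + d z a \<le> d x a + 4 * \<delta>"
  proof (rule ccontr)
    assume no: "\<not> ?thesis"
    have "\<bar>fl x a z - 0\<bar> \<le> 0"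
    proof (rule flow_hull[OF x a, where t = 1])
      fix u assume "u \<in> V" "d x u = 5 * \<delta> * 1" "d x u + d u a \<le> d x a + 4 * \<delta>"
      then have "z \<noteq> u" "d x u \<le> 5 * \<delta>" using no by auto
      then show "\<bar>fl x u z - 0\<bar> \<le> 0" by (simp add: flow_near)
    qed (use far in auto)
    then show False using nz by simp
  qed
  then show "z \<in> V" "d x z = 5 * \<delta>" "d x z + d z a \<le> d x a + 4 * \<delta>" by auto
qed

text \<open>On every sphere the two descent sets share a vertex by \<open>descent_overlap\<close>,
  and all their elements are again within \<open>7 * \<delta>\<close> by
  \<open>descent_close\<close>. So each step contributes the coupling factor \<theta>; at the
  innermost sphere only the trivial bound 1 remains.\<close>

lemma flow_contract_level:
  assumes x: "x \<in> V"
  shows "u \<in> V \<Longrightarrow> v \<in> V \<Longrightarrow> d x u = 5 * \<delta> * Suc t \<Longrightarrow> d x v = 5 * \<delta> * Suc t \<Longrightarrow> d u v \<le> 7 * \<delta> \<Longrightarrow>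
    \<bar>fl x u z - fl x v z\<bar> \<le> \<theta> ^ t"
proof (induction t arbitrary: u v)
  case 0
  then show ?case by (simp add: flow_near)
next
  case (Suc t)
  have q: "(5 * \<delta> * Suc (Suc t) - 1) div (5 * \<delta>) = Suc t"
    using delta_pos by (intro div_nat_eqI) auto
  \<comment> \<open>On a sphere, the near-optimality of a target is just a distance bound:
    \<open>6 * \<delta>\<close> is the drop \<open>5 * \<delta>\<close> plus the tolerance
    \<delta>.\<close>
  have D: "desc x w = {y \<in> V. d x y = 5 * \<delta> * Suc t \<and> d w y \<le> 6 * \<delta>}" if "d x w = 5 * \<delta> * Suc (Suc t)" for w
    unfolding descent_def that q by auto
  have far: "5 * \<delta> < d x u" "5 * \<delta> < d x v" using Suc.prems delta_pos by auto
  have lev: "d x u = 5 * \<delta> * Suc t + 5 * \<delta>" "d x v = 5 * \<delta> * Suc t + 5 * \<delta>" using Suc.prems by auto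
  obtain y where y: "y \<in> desc x u" "y \<in> desc x v"
    using descent_overlap[OF x Suc.prems(1,2) lev Suc.prems(5)] D[OF Suc.prems(3)] D[OF Suc.prems(4)] by auto
  have small: "card (desc x w) \<le> N ^ (6 * \<delta>)" if "w \<in> V" "d x w = 5 * \<delta> * Suc (Suc t)" for w
    using ball_bound[OF that(1), of "6 * \<delta>"] unfolding D[OF that(2)]
    by (auto intro: order_trans[OF card_mono])
  have close: "\<bar>fl x u' z - fl x v' z\<bar> \<le> \<theta> ^ t" if "u' \<in> desc x u" "v' \<in> desc x v" for u' v'
  proof (rule Suc.IH)
    show "d u' v' \<le> 7 * \<delta>"
      using descent_close[OF x Suc.prems(1,2) _ _ lev Suc.prems(5), of u' v'] that D[OF Suc.prems(3)] D[OF Suc.prems(4)] by simp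
  qed (use that D[OF Suc.prems(3)] D[OF Suc.prems(4)] in auto)
  have "\<bar>fl x u z - fl x v z\<bar> \<le> (1 - 1 / (real (N ^ (6 * \<delta>)))\<^sup>2) * \<theta> ^ t"
    unfolding flow_far[OF far(1)] flow_far[OF far(2)]
    using desc_finite small y close Suc.prems by (intro averages_overlap) auto
  then show ?case by (simp add: contraction_def)
qed

text \<open>Take the last level \<open>5 * \<delta> * t\<close> not above
  \<open>(a|b)\<^sub>x\<close>. Applying \<open>flow_hull\<close> to both starting points reduces
  the claim to two vertices of that level, which \<open>level_points_close\<close> puts within
  \<open>7 * \<delta>\<close>. Rounding to a level and the idle innermost sphere cost
  \<open>10 * \<delta>\<close> each.\<close>

lemma flow_contract:
  assumes V: "x \<in> V" "a \<in> V" "b \<in> V"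
  shows "\<bar>fl x a z - fl x b z\<bar> \<le> \<rho> powr (real (d x a) + real (d x b) - real (d a b) - 20 * real \<delta>)"
proof -
  define G where "G = d x a + d x b - d a b"
  have tri: "d a b \<le> d x a + d x b" using d_tri[of a x b] d_sym V by simp
  define t where "t = G div (10 * \<delta>)"
  show ?thesis
  proof (cases "t = 0")
    case True
    then have "G < 10 * \<delta>" using delta_pos unfolding t_def by (simp add: div_eq_0_iff)
    \<comment> \<open>Below the first level the exponent is negative, so the bound is at least 1 and
      holds trivially.\<close>
    then have "1 \<le> \<rho> powr (real (d x a) + real (d x b) - real (d a b) - 20 * real \<delta>)"
      using rho_mono[of _ 0] rho tri unfolding G_def by (auto simp: not_less)
    moreover have "\<bar>fl x a z - fl x b z\<bar> \<le> 1" using flow_nonneg flow_le_1 V by (smt (verit))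
    ultimately show ?thesis by linarith
  next
    case False
    then obtain s where s: "t = Suc s" by (cases t) auto
    have "t * (10 * \<delta>) \<le> G" unfolding t_def by simp
    then have g: "2 * (5 * \<delta> * t) + d a b \<le> d x a + d x b" using tri unfolding G_def by (simp add: algebra_simps)
    have far: "5 * \<delta> * t \<le> d x a" "5 * \<delta> * t \<le> d x b"
      using g d_tri[of x a b] d_tri[of x b a] d_sym[of a b] V by linarith+
    have "\<bar>fl x a z - fl x b z\<bar> \<le> \<theta> ^ s"
    proof (rule flow_hull[where t = t])
      fix u assume u: "u \<in> V" "d x u = 5 * \<delta> * t" "d x u + d u a \<le> d x a + 4 * \<delta>"
      have "\<bar>fl x b z - fl x u z\<bar> \<le> \<theta> ^ s"
      proof (rule flow_hull[where t = t])
        fix v assume v: "v \<in> V" "d x v = 5 * \<delta> * t" "d x v + d v b \<le> d x b + 4 * \<delta>"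
        have "d v u \<le> 7 * \<delta>"
          using level_points_close[of x a b u v] V u v g d_sym[of u v] by auto
        then show "\<bar>fl x v z - fl x u z\<bar> \<le> \<theta> ^ s"
          using flow_contract_level[OF V(1), of v u s] u v s by simp
      qed (use V far s in auto)
      then show "\<bar>fl x u z - fl x b z\<bar> \<le> \<theta> ^ s" by (simp add: abs_minus_commute)
    qed (use V far s in auto)
    also have "\<dots> = \<rho> powr (10 * real \<delta> * real s)" by (rule rho_theta)
    also have "\<dots> \<le> \<rho> powr (real (d x a) + real (d x b) - real (d a b) - 20 * real \<delta>)"
    proof (rule rho_mono)
      have "G < 10 * \<delta> + t * (10 * \<delta>)" unfolding t_def using delta_pos
        by (intro dividend_less_div_times) simp
      then have "real G \<le> real (10 * \<delta> + Suc s * (10 * \<delta>))" unfolding s of_nat_le_iff by simp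
      then have "real G \<le> 10 * real \<delta> * real s + 20 * real \<delta>" by (simp add: algebra_simps)
      then show "real (d x a) + real (d x b) - real (d a b) - 20 * real \<delta> \<le> 10 * real \<delta> * real s"
        using tri by (simp add: G_def of_nat_diff)
    qed
    finally show ?thesis .
  qed
qed

end

section \<open>The metric on the vertices\<close>

text \<open>The power \<open>q\<close> outweighs the growth rate \<open>N\<close> of balls; evenness
  makes all summands nonnegative and symmetric. Of the four additional factors, the double
  difference spends two on its differences
  \<open>\<bar>\<nu>\<^sub>x(a) - \<nu>\<^sub>x(a')\<bar>\<close> and
  \<open>\<bar>\<nu>\<^sub>x(b) - \<nu>\<^sub>x(b')\<bar>\<close>, and two on moving the base point
  from \<open>x\<close> to a geodesic.\<close>

definition exponent :: "nat \<Rightarrow> nat \<Rightarrow> nat" where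
  "exponent \<delta> N = (LEAST q. even q \<and> real N * rate \<delta> N ^ q \<le> 1 / 2) + 4"

text \<open>\<open>N ^ (5 * \<delta>)\<close> bounds the number of stopping vertices. Each of the
  factors of the power loses \<open>20 * \<delta>\<close> in \<open>flow_contract\<close> and at
  most \<open>2 * \<delta> + 1\<close> in \<open>geodesic_near_point\<close>.\<close>

definition loss :: "nat \<Rightarrow> nat \<Rightarrow> real" where
  "loss \<delta> N = real (N ^ (5 * \<delta>)) * rate \<delta> N powr (- real (exponent \<delta> N) * (22 * real \<delta> + 1))"

text \<open>The bound on the total triangle defect: a factor 2 for the sum over the vertices near
  one point of a geodesic, \<open>exponent * loss\<close> for a single summand, and
  \<open>2 / (1 - rate powr (1 / 2))\<close> for the sum along the geodesic.\<close>

definition offset :: "nat \<Rightarrow> nat \<Rightarrow> real" where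
  "offset \<delta> N = 4 * real (exponent \<delta> N) * loss \<delta> N / (1 - rate \<delta> N powr (1 / 2))"

definition flow_term :: "'a set \<Rightarrow> ('a \<Rightarrow> 'a \<Rightarrow> nat) \<Rightarrow> nat \<Rightarrow> nat \<Rightarrow> 'a \<Rightarrow> 'a \<Rightarrow> 'a \<Rightarrow> real" where
  "flow_term V d \<delta> N a b x =
     (\<Sum>z\<in>{z \<in> V. d x z \<le> 5 * \<delta>}. (flow V d \<delta> x a z - flow V d \<delta> x b z) ^ exponent \<delta> N)"

definition flow_cost :: "'a set \<Rightarrow> ('a \<Rightarrow> 'a \<Rightarrow> nat) \<Rightarrow> nat \<Rightarrow> nat \<Rightarrow> 'a \<Rightarrow> 'a \<Rightarrow> real" where
  "flow_cost V d \<delta> N a b = infsum (flow_term V d \<delta> N a b) V"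

definition vertex_metric :: "'a set \<Rightarrow> ('a \<Rightarrow> 'a \<Rightarrow> nat) \<Rightarrow> nat \<Rightarrow> nat \<Rightarrow> 'a \<Rightarrow> 'a \<Rightarrow> real" where
  "vertex_metric V d \<delta> N a b = (if a = b then 0 else offset \<delta> N + flow_cost V d \<delta> N a b)"

lemma vertex_metric_transfer:
  assumes g: "bij_betw g V V'" and iso: "\<And>x y. x \<in> V \<Longrightarrow> y \<in> V \<Longrightarrow> d' (g x) (g y) = d x y"
    and V: "a \<in> V" "b \<in> V"
  shows "vertex_metric V' d' \<delta> N (g a) (g b) = vertex_metric V d \<delta> N a b"
proof -
  have inj: "inj_on g V" and im: "g ` V = V'" using g by (auto simp: bij_betw_def)
  have "flow_term V' d' \<delta> N (g a) (g b) (g x) = flow_term V d \<delta> N a b x" if x: "x \<in> V" for x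
  proof -
    have B: "{z \<in> V'. d' (g x) z \<le> 5 * \<delta>} = g ` {z \<in> V. d x z \<le> 5 * \<delta>}" using im iso x by auto
    have "inj_on g {z \<in> V. d x z \<le> 5 * \<delta>}" using inj by (rule inj_on_subset) auto
    then show ?thesis
      unfolding flow_term_def B
      using flow_transfer[where g = g and d = d and d' = d', OF g iso x _ V(1)]
        flow_transfer[where g = g and d = d and d' = d', OF g iso x _ V(2)]
      by (subst sum.reindex) (auto intro!: sum.cong)
  qed
  then have "flow_cost V' d' \<delta> N (g a) (g b) = flow_cost V d \<delta> N a b"
    unfolding flow_cost_def im[symmetric] by (subst infsum_reindex[OF inj]) (auto intro!: infsum_cong)
  moreover have "g a = g b \<longleftrightarrow> a = b" using inj V by (auto simp: inj_on_eq_iff)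
  ultimately show ?thesis by (simp add: vertex_metric_def)
qed

section \<open>Inequalities for powers and geometric sums\<close>

text \<open>By the mean value estimate, \<open>t ^ p - u ^ p\<close> is at most
  \<open>p * t ^ (p - 1) * (t - u)\<close>, and \<open>t - u \<le> v\<close>; then exchange
  \<open>u\<close> and \<open>v\<close>. The minimum matters because away from the centre of a
  triangle only one of \<open>u\<close>, \<open>v\<close> is small.\<close>

lemma power_sum_defect:
  fixes t u v :: real
  assumes "0 \<le> t" "0 \<le> u" "0 \<le> v" "t \<le> u + v"
  shows "t ^ p - u ^ p - v ^ p \<le> real p * t ^ (p - 1) * min u v"
proof -
  have main: "t ^ p - u ^ p \<le> real p * t ^ (p - 1) * v" if "0 \<le> u" "0 \<le> v" "t \<le> u + v" for u v
  proof (cases "t \<le> u")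
    case True
    then have "t ^ p \<le> u ^ p" using assms by (intro power_mono) auto
    moreover have "0 \<le> real p * t ^ (p - 1) * v" using assms that by simp
    ultimately show ?thesis by linarith
  next
    case False
    have "(\<Sum>i<p. u ^ (p - Suc i) * t ^ i) \<le> (\<Sum>i<p. t ^ (p - 1))"
    proof (intro sum_mono)
      fix i assume "i \<in> {..<p}"
      then have "p - 1 = (p - Suc i) + i" by auto
      then have "t ^ (p - 1) = t ^ (p - Suc i) * t ^ i" by (metis power_add)
      moreover have "u ^ (p - Suc i) \<le> t ^ (p - Suc i)" using False that by (intro power_mono) auto
      ultimately show "u ^ (p - Suc i) * t ^ i \<le> t ^ (p - 1)" using assms by (simp add: mult_right_mono)
    qed
    then have "t ^ p - u ^ p \<le> (t - u) * (real p * t ^ (p - 1))"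
      unfolding power_diff_sumr2 using False by (intro mult_left_mono) auto
    also have "\<dots> \<le> v * (real p * t ^ (p - 1))" using that assms by (intro mult_right_mono) auto
    finally show ?thesis by (simp add: mult.commute)
  qed
  have "0 \<le> u ^ p" "0 \<le> v ^ p" using assms by auto
  moreover have "t ^ p - u ^ p \<le> real p * t ^ (p - 1) * v" "t ^ p - v ^ p \<le> real p * t ^ (p - 1) * u"
    using main[of u v] main[of v u] assms by auto
  ultimately show ?thesis by (simp only: min_def split: if_split) linarith
qed

lemma power_diff_abs_le:
  fixes x y :: real
  assumes "\<bar>x\<bar> \<le> M" "\<bar>y\<bar> \<le> M"
  shows "\<bar>x ^ i - y ^ i\<bar> \<le> real i * M ^ (i - 1) * \<bar>x - y\<bar>"
proof -
  have M: "0 \<le> M" using assms by linarith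
  have "\<bar>\<Sum>j<i. y ^ (i - Suc j) * x ^ j\<bar> \<le> (\<Sum>j<i. M ^ (i - 1))"
  proof (intro order_trans[OF sum_abs] sum_mono)
    fix j assume "j \<in> {..<i}"
    then have "i - 1 = (i - Suc j) + j" by auto
    then have "M ^ (i - 1) = M ^ (i - Suc j) * M ^ j" by (metis power_add)
    then show "\<bar>y ^ (i - Suc j) * x ^ j\<bar> \<le> M ^ (i - 1)"
      using assms M by (auto simp: abs_mult power_abs intro!: mult_mono power_mono)
  qed
  then have "\<bar>x - y\<bar> * \<bar>\<Sum>j<i. y ^ (i - Suc j) * x ^ j\<bar> \<le> \<bar>x - y\<bar> * (real i * M ^ (i - 1))"
    by (intro mult_left_mono) auto
  then show ?thesis unfolding power_diff_sumr2 abs_mult by (simp add: mult.commute)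
qed

text \<open>Factoring \<open>x ^ p - y ^ p\<close> first splits off \<open>A - A'\<close>; the
  remaining sum of products is Lipschitz in \<open>B\<close>, which yields the factor
  \<open>\<bar>B - B'\<bar>\<close> and leaves \<open>p - 2\<close> powers.\<close>

lemma power_second_difference:
  fixes A A' B B' :: real
  assumes p: "2 \<le> p"
  shows "\<bar>(A - B) ^ p - (A' - B) ^ p - (A - B') ^ p + (A' - B') ^ p\<bar> \<le>
    real p ^ 2 * (\<bar>A - A'\<bar> * \<bar>B - B'\<bar> * (\<bar>A - B\<bar> ^ (p - 2) + \<bar>A' - B\<bar> ^ (p - 2) + \<bar>A - B'\<bar> ^ (p - 2) + \<bar>A' - B'\<bar> ^ (p - 2)))"
proof -
  define M where "M = Max {\<bar>A - B\<bar>, \<bar>A' - B\<bar>, \<bar>A - B'\<bar>, \<bar>A' - B'\<bar>}"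
  have M: "\<bar>A - B\<bar> \<le> M" "\<bar>A' - B\<bar> \<le> M" "\<bar>A - B'\<bar> \<le> M" "\<bar>A' - B'\<bar> \<le> M"
    unfolding M_def by (intro Max_ge; simp)+
  have M0: "0 \<le> M" using M by linarith
  have "M \<in> {\<bar>A - B\<bar>, \<bar>A' - B\<bar>, \<bar>A - B'\<bar>, \<bar>A' - B'\<bar>}" unfolding M_def by (intro Max_in) auto
  moreover have "0 \<le> \<bar>A - B\<bar> ^ (p - 2)" "0 \<le> \<bar>A' - B\<bar> ^ (p - 2)" "0 \<le> \<bar>A - B'\<bar> ^ (p - 2)" "0 \<le> \<bar>A' - B'\<bar> ^ (p - 2)" by auto
  \<comment> \<open>The maximum is replaced by a sum so that each of the four powers can later be
    summed along its own geodesic.\<close>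
  ultimately have Mp: "M ^ (p - 2) \<le> \<bar>A - B\<bar> ^ (p - 2) + \<bar>A' - B\<bar> ^ (p - 2) + \<bar>A - B'\<bar> ^ (p - 2) + \<bar>A' - B'\<bar> ^ (p - 2)"
    by (elim insertE emptyE) (simp_all del: zero_le_power_abs)
  \<comment> \<open>For \<open>i = 0\<close> the exponent \<open>i - 1\<close> is truncated, but the
    factor \<open>real i\<close> vanishes.\<close>
  have mono: "real i * M ^ (i - 1) * M ^ k = real i * M ^ (p - 2)" if "i + k = p - 1" for i k
  proof (cases i)
    case (Suc j)
    then have "p - 2 = j + k" using that p by simp
    then show ?thesis by (simp add: Suc power_add)
  qed simp
  have summand: "\<bar>(A' - B) ^ k * (A - B) ^ i - (A' - B') ^ k * (A - B') ^ i\<bar> \<le> real p * M ^ (p - 2) * \<bar>B - B'\<bar>"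
    if ik: "i + k = p - 1" for i k
  proof -
    have "(A' - B) ^ k * (A - B) ^ i - (A' - B') ^ k * (A - B') ^ i
        = (A' - B) ^ k * ((A - B) ^ i - (A - B') ^ i) + ((A' - B) ^ k - (A' - B') ^ k) * (A - B') ^ i"
      by (simp add: algebra_simps)
    also have "\<bar>\<dots>\<bar> \<le> \<bar>A' - B\<bar> ^ k * \<bar>(A - B) ^ i - (A - B') ^ i\<bar> + \<bar>(A' - B) ^ k - (A' - B') ^ k\<bar> * \<bar>A - B'\<bar> ^ i"
      by (metis abs_mult abs_triangle_ineq power_abs)
    also have "\<dots> \<le> M ^ k * (real i * M ^ (i - 1) * \<bar>B - B'\<bar>) + real k * M ^ (k - 1) * \<bar>B - B'\<bar> * M ^ i"
      using power_diff_abs_le[of "A - B" M "A - B'" i] power_diff_abs_le[of "A' - B" M "A' - B'" k] M M0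
      by (intro add_mono mult_mono power_mono) (auto simp: abs_minus_commute)
    also have "\<dots> = (real i * M ^ (i - 1) * M ^ k + real k * M ^ (k - 1) * M ^ i) * \<bar>B - B'\<bar>" by (simp add: algebra_simps)
    also have "\<dots> = real (i + k) * M ^ (p - 2) * \<bar>B - B'\<bar>"
      by (simp only: mono[OF ik] mono[OF trans[OF add.commute ik]] of_nat_add distrib_right)
    also have "\<dots> = real (p - 1) * M ^ (p - 2) * \<bar>B - B'\<bar>" unfolding ik ..
    also have "\<dots> \<le> real p * M ^ (p - 2) * \<bar>B - B'\<bar>" using M0 by (intro mult_right_mono) auto
    finally show ?thesis .
  qed
  have "(A - B) ^ p - (A' - B) ^ p - (A - B') ^ p + (A' - B') ^ p
      = ((A - B) ^ p - (A' - B) ^ p) - ((A - B') ^ p - (A' - B') ^ p)" by simp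
  also have "\<dots> = (A - A') * (\<Sum>i<p. (A' - B) ^ (p - Suc i) * (A - B) ^ i - (A' - B') ^ (p - Suc i) * (A - B') ^ i)"
    unfolding power_diff_sumr2 sum_subtractf by (simp add: algebra_simps)
  also have "\<bar>\<dots>\<bar> \<le> \<bar>A - A'\<bar> * (\<Sum>i<p. real p * M ^ (p - 2) * \<bar>B - B'\<bar>)"
    unfolding abs_mult using summand by (intro mult_left_mono order_trans[OF sum_abs] sum_mono) auto
  also have "\<dots> = real p ^ 2 * (\<bar>A - A'\<bar> * \<bar>B - B'\<bar> * M ^ (p - 2))" by (simp add: power2_eq_square)
  also have "\<dots> \<le> real p ^ 2 * (\<bar>A - A'\<bar> * \<bar>B - B'\<bar> * (\<bar>A - B\<bar> ^ (p - 2) + \<bar>A' - B\<bar> ^ (p - 2) + \<bar>A - B'\<bar> ^ (p - 2) + \<bar>A' - B'\<bar> ^ (p - 2)))"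
    using Mp by (intro mult_left_mono) auto
  finally show ?thesis .
qed

text \<open>Split at \<open>k = c div 2\<close>: on either side the distances
  \<open>\<bar>i - k\<bar>\<close> are distinct, and they are at most
  \<open>\<bar>2 * i - c\<bar>\<close>.\<close>

lemma two_sided_geometric:
  fixes r :: real and c :: int
  assumes r: "0 < r" "r < 1"
  shows "(\<Sum>i\<le>n. r powr \<bar>2 * real i - real_of_int c\<bar>) \<le> 2 / (1 - r)"
proof -
  define k where "k = c div 2"
  have geom: "(\<Sum>j\<in>J. r ^ j) \<le> 1 / (1 - r)" if "finite J" for J :: "nat set"
  proof -
    have "(\<Sum>j\<in>J. r ^ j) \<le> (\<Sum>j. r ^ j)" using r that by (intro sum_le_suminf summable_geometric) auto
    then show ?thesis using r by (simp add: suminf_geometric)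
  qed
  have le: "r powr \<bar>2 * real i - real_of_int c\<bar> \<le> r ^ nat \<bar>int i - k\<bar>" for i
  proof -
    have "\<bar>int i - k\<bar> \<le> \<bar>2 * int i - c\<bar>" unfolding k_def by linarith
    then have "real (nat \<bar>int i - k\<bar>) \<le> \<bar>2 * real i - real_of_int c\<bar>" by linarith
    then have "r powr \<bar>2 * real i - real_of_int c\<bar> \<le> r powr real (nat \<bar>int i - k\<bar>)" using r by (intro powr_mono') auto
    then show ?thesis using r by (simp only: powr_realpow)
  qed
  define S where "S = {i. i \<le> n \<and> int i \<le> k}"
  define T where "T = {i. i \<le> n \<and> \<not> int i \<le> k}"
  have fin: "finite S" "finite T" by (auto simp: S_def T_def)
  have "(\<Sum>i\<le>n. r powr \<bar>2 * real i - real_of_int c\<bar>) \<le> (\<Sum>i\<le>n. r ^ nat \<bar>int i - k\<bar>)" using le by (intro sum_mono) auto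
  also have "\<dots> = (\<Sum>i\<in>S \<union> T. r ^ nat \<bar>int i - k\<bar>)" by (intro sum.cong) (auto simp: S_def T_def)
  also have "(\<Sum>i\<in>S \<union> T. r ^ nat \<bar>int i - k\<bar>) = (\<Sum>i\<in>S. r ^ nat \<bar>int i - k\<bar>) + (\<Sum>i\<in>T. r ^ nat \<bar>int i - k\<bar>)"
    using fin by (intro sum.union_disjoint) (auto simp: S_def T_def)
  also have "(\<Sum>i\<in>S. r ^ nat \<bar>int i - k\<bar>) = (\<Sum>j\<in>(\<lambda>i. nat \<bar>int i - k\<bar>) ` S. r ^ j)"
    by (subst sum.reindex) (auto simp: inj_on_def S_def)
  also have "(\<Sum>i\<in>T. r ^ nat \<bar>int i - k\<bar>) = (\<Sum>j\<in>(\<lambda>i. nat \<bar>int i - k\<bar>) ` T. r ^ j)"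
    by (subst sum.reindex) (auto simp: inj_on_def T_def)
  also have "(\<Sum>j\<in>(\<lambda>i. nat \<bar>int i - k\<bar>) ` S. r ^ j) + (\<Sum>j\<in>(\<lambda>i. nat \<bar>int i - k\<bar>) ` T. r ^ j) \<le> 1 / (1 - r) + 1 / (1 - r)"
    using fin by (intro add_mono geom) auto
  finally show ?thesis by simp
qed

context fine_graph
begin

abbreviation "p \<equiv> exponent \<delta> N"
abbreviation "q \<equiv> p - 4"
abbreviation "near x \<equiv> {z \<in> V. d x z \<le> 5 * \<delta>}"

lemma exponent: "even p" "4 \<le> p" "real N * \<rho> ^ q \<le> 1 / 2"
proof -
  have "(\<lambda>q. \<rho> ^ q) \<longlonglongrightarrow> 0" using rho by (intro LIMSEQ_realpow_zero) auto
  then have "\<forall>\<^sub>F q in sequentially. \<rho> ^ q < 1 / (2 * real N)"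
    using N_ge_2 by (intro order_tendstoD(2)) auto
  then obtain k where k: "\<And>n. k \<le> n \<Longrightarrow> \<rho> ^ n < 1 / (2 * real N)" by (auto simp: eventually_sequentially)
  have "even (2 * k) \<and> real N * \<rho> ^ (2 * k) \<le> 1 / 2"
    using k[of "2 * k"] N_ge_2 by (simp add: field_simps)
  then have *: "even q \<and> real N * \<rho> ^ q \<le> 1 / 2"
    unfolding exponent_def add_diff_cancel_right' by (rule LeastI)
  show "4 \<le> p" by (simp add: exponent_def)
  then show "even p" using * by simp
  show "real N * \<rho> ^ q \<le> 1 / 2" using * by blast
qed

section \<open>Sums over all vertices along a geodesic\<close>

text \<open>At most \<open>N ^ h\<close> vertices lie at distance \<open>h\<close> from
  \<open>w\<close>, so the geometric series with ratio 1/2 dominates.\<close>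

lemma sphere_sum:
  assumes F: "finite F" "F \<subseteq> V" and w: "w \<in> V" and k: "0 \<le> k" "real N * k \<le> 1 / 2"
  shows "(\<Sum>x\<in>F. k ^ d x w) \<le> 2"
proof -
  define m where "m = Max (insert 0 ((\<lambda>x. d x w) ` F))"
  have m: "(\<lambda>x. d x w) ` F \<subseteq> {..m}" using F by (auto simp: m_def)
  have "(\<Sum>x\<in>F. k ^ d x w) = (\<Sum>h\<le>m. \<Sum>x\<in>{x \<in> F. d x w = h}. k ^ d x w)"
    using F m by (intro sum.group[symmetric]) auto
  also have "\<dots> \<le> (\<Sum>h\<le>m. (1 / 2) ^ h)"
  proof (intro sum_mono)
    fix h
    have sub: "{x \<in> F. d x w = h} \<subseteq> {y \<in> V. d w y \<le> h}" using F w d_sym by auto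
    have "card {x \<in> F. d x w = h} \<le> N ^ h" using card_mono[OF _ sub] ball_bound[OF w, of h] by linarith
    then have "(\<Sum>x\<in>{x \<in> F. d x w = h}. k ^ d x w) \<le> real (N ^ h) * k ^ h"
      using k by (simp add: mult_right_mono flip: of_nat_power)
    also have "\<dots> = (real N * k) ^ h" by (simp add: power_mult_distrib)
    also have "\<dots> \<le> (1 / 2) ^ h" using k by (intro power_mono) auto
    finally show "(\<Sum>x\<in>{x \<in> F. d x w = h}. k ^ d x w) \<le> (1 / 2) ^ h" .
  qed
  also have "\<dots> \<le> (\<Sum>h. (1 / 2 :: real) ^ h)" by (intro sum_le_suminf summable_geometric) auto
  also have "\<dots> = 2" by (simp add: suminf_geometric)
  finally show ?thesis .
qed

text \<open>Every \<open>x\<close> is charged to one point \<open>w i\<close> near it. The decay in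
  \<open>d x (w i)\<close> beats the growth of balls and sums to at most 2, so only the sum of the
  weights \<open>e i\<close> along the sequence remains.\<close>

lemma sum_along_sequence:
  fixes n :: nat
  assumes F: "finite F" "F \<subseteq> V" and w: "\<And>i. i \<le> n \<Longrightarrow> w i \<in> V"
    and C: "0 \<le> C" and e: "\<And>i. 0 \<le> e i"
    and f: "\<And>x. x \<in> F \<Longrightarrow> \<exists>i\<le>n. f x \<le> C * (\<rho> powr (2 * real q * real (d x (w i))) * e i)"
  shows "sum f F \<le> 2 * C * (\<Sum>i\<le>n. e i)"
proof -
  define k where "k = \<rho> ^ (2 * q)"
  have "\<rho> ^ (2 * q) \<le> \<rho> ^ q" using rho by (intro power_decreasing) auto
  then have "real N * k \<le> real N * \<rho> ^ q" unfolding k_def by (intro mult_left_mono) auto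
  then have k: "0 \<le> k" "real N * k \<le> 1 / 2" using exponent rho by (auto simp: k_def)
  have kp: "\<rho> powr (2 * real q * real h) = k ^ h" for h
  proof -
    have "k ^ h = \<rho> ^ (2 * q * h)" by (simp add: k_def power_mult)
    also have "\<dots> = \<rho> powr real (2 * q * h)" using rho by (simp only: powr_realpow)
    finally show ?thesis by simp
  qed
  have "sum f F \<le> (\<Sum>x\<in>F. \<Sum>i\<le>n. C * e i * k ^ d x (w i))"
  proof (intro sum_mono)
    fix x assume "x \<in> F"
    then obtain i where i: "i \<le> n" "f x \<le> C * (k ^ d x (w i) * e i)" using f unfolding kp by blast
    \<comment> \<open>The index depends on \<open>x\<close>; bounding its term by the sum over all
      indices allows the two sums to be exchanged.\<close>
    have "C * e i * k ^ d x (w i) \<le> (\<Sum>i\<le>n. C * e i * k ^ d x (w i))"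
      using i C e k by (intro member_le_sum) (auto intro!: mult_nonneg_nonneg)
    then show "f x \<le> (\<Sum>i\<le>n. C * e i * k ^ d x (w i))" using i by (simp add: mult_ac)
  qed
  also have "\<dots> = (\<Sum>i\<le>n. C * e i * (\<Sum>x\<in>F. k ^ d x (w i)))" by (subst sum.swap) (simp add: sum_distrib_left)
  also have "\<dots> \<le> (\<Sum>i\<le>n. C * e i * 2)"
    using C e sphere_sum[OF F w k] by (intro sum_mono mult_left_mono) auto
  also have "\<dots> = 2 * C * (\<Sum>i\<le>n. e i)" by (simp add: sum_distrib_left mult_ac)
  finally show ?thesis .
qed

lemma loss_pos: "0 < loss \<delta> N"
  using N_ge_2 rho by (simp add: loss_def)

text \<open>The constant \<open>loss\<close> collects the additive errors in the exponents.\<close>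

lemma sum_near_le:
  assumes "x \<in> V" "0 \<le> c" and "\<And>z. z \<in> near x \<Longrightarrow> f z \<le> c * \<rho> powr (t - real p * (22 * real \<delta> + 1))"
  shows "sum f (near x) \<le> c * loss \<delta> N * \<rho> powr t"
proof -
  have e: "\<rho> powr (t - real p * (22 * real \<delta> + 1)) = \<rho> powr (- real p * (22 * real \<delta> + 1)) * \<rho> powr t"
    by (simp flip: powr_add)
  have "sum f (near x) \<le> real (card (near x)) * (c * \<rho> powr (t - real p * (22 * real \<delta> + 1)))"
    using assms by (intro sum_bounded_above) auto
  also have "\<dots> \<le> real (N ^ (5 * \<delta>)) * (c * \<rho> powr (t - real p * (22 * real \<delta> + 1)))"
    using ball_bound assms by (intro mult_right_mono) (auto simp del: of_nat_power)
  also have "\<dots> = c * loss \<delta> N * \<rho> powr t" unfolding e loss_def by (simp add: mult_ac)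
  finally show ?thesis .
qed

lemma flow_diff_powr:
  assumes "x \<in> V" "a \<in> V" "b \<in> V" "s \<le> real (d x a) + real (d x b) - real (d a b) - 20 * real \<delta>"
  shows "\<bar>fl x a z - fl x b z\<bar> ^ k \<le> \<rho> powr (real k * s)"
proof -
  have "\<bar>fl x a z - fl x b z\<bar> \<le> \<rho> powr s"
    using flow_contract[OF assms(1-3)] rho_mono[OF assms(4)] order_trans by blast
  then have "\<bar>fl x a z - fl x b z\<bar> ^ k \<le> (\<rho> powr s) ^ k" by (intro power_mono) auto
  also have "\<dots> = \<rho> powr (real k * s)" using rho by (simp add: powr_power mult.commute)
  finally show ?thesis .
qed

abbreviation "T \<equiv> flow_term V d \<delta> N"

lemma T_nonneg: "0 \<le> T a b x"
  unfolding flow_term_def using exponent(1) by (intro sum_nonneg zero_le_even_power)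

lemma T_commute: "T a b x = T b a x"
proof -
  have "(fl x a z - fl x b z) ^ p = (fl x b z - fl x a z) ^ p" for z
    using exponent(1) by (metis minus_diff_eq power_minus_even)
  then show ?thesis by (simp add: flow_term_def)
qed

text \<open>All weights \<open>e i\<close> are 1 here. The bound does not depend on
  \<open>F\<close>, so it gives the summability of the cost as well as its linear growth.\<close>

lemma T_finite_sum:
  assumes F: "finite F" "F \<subseteq> V" and V: "a \<in> V" "b \<in> V"
  shows "sum (T a b) F \<le> 2 * loss \<delta> N * (real (d a b) + 1)"
proof -
  obtain w where w: "\<And>i. i \<le> d a b \<Longrightarrow> w i \<in> V \<and> d a (w i) = i \<and> d (w i) b = d a b - i"
    using geo_sequence V by blast
  have "sum (T a b) F \<le> 2 * loss \<delta> N * (\<Sum>i\<le>d a b. 1)"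
  proof (rule sum_along_sequence[OF F])
    fix x assume "x \<in> F"
    then have x: "x \<in> V" using F by blast
    obtain i where i: "i \<le> d a b" "2 * d x (w i) + d a b \<le> d x a + d x b + 2 * \<delta> + 1"
      using geodesic_near_point[OF x V w] by blast
    define h where "h = d x (w i)"
    have s: "2 * real h - (22 * real \<delta> + 1) \<le> real (d x a) + real (d x b) - real (d a b) - 20 * real \<delta>"
      using i(2) unfolding h_def by linarith
    have "T a b x \<le> 1 * loss \<delta> N * \<rho> powr (2 * real q * real h)"
      unfolding flow_term_def
    proof (rule sum_near_le[OF x])
      fix z
      have "(fl x a z - fl x b z) ^ p \<le> \<bar>fl x a z - fl x b z\<bar> ^ p" by (simp add: power_even_abs exponent)
      also have "\<dots> \<le> \<rho> powr (real p * (2 * real h - (22 * real \<delta> + 1)))" by (rule flow_diff_powr[OF x V s])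
      also have "\<dots> \<le> \<rho> powr (2 * real q * real h - real p * (22 * real \<delta> + 1))"
      proof (rule rho_mono)
        have "real q * real h \<le> real p * real h" by (intro mult_right_mono) auto
        then show "2 * real q * real h - real p * (22 * real \<delta> + 1) \<le> real p * (2 * real h - (22 * real \<delta> + 1))"
          by (simp add: algebra_simps)
      qed
      finally show "(fl x a z - fl x b z) ^ p \<le> 1 * \<rho> powr (2 * real q * real h - real p * (22 * real \<delta> + 1))" by simp
    qed simp
    then show "\<exists>i\<le>d a b. T a b x \<le> loss \<delta> N * (\<rho> powr (2 * real q * real (d x (w i))) * 1)"
      using i unfolding h_def by auto
  qed (use w loss_pos in auto)
  then show ?thesis by (simp add: add.commute)
qed

lemma T_summable:
  assumes V: "a \<in> V" "b \<in> V" shows "T a b summable_on V"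
  using T_nonneg T_finite_sum[OF _ _ V]
  by (intro nonneg_bdd_above_summable_on) (auto intro!: bdd_aboveI2)

lemma cost_upper:
  assumes V: "a \<in> V" "b \<in> V" shows "flow_cost V d \<delta> N a b \<le> 2 * loss \<delta> N * (real (d a b) + 1)"
  unfolding flow_cost_def
proof (rule infsum_le_finite_sums[OF T_summable[OF V]])
  fix F :: "'a set" assume "finite F" "F \<subseteq> V"
  then show "sum (T a b) F \<le> 2 * loss \<delta> N * (real (d a b) + 1)" using T_finite_sum V by blast
qed

lemma cost_nonneg: "0 \<le> flow_cost V d \<delta> N a b"
  unfolding flow_cost_def using T_nonneg by (intro infsum_nonneg)

abbreviation "geo_sum \<equiv> 2 / (1 - \<rho> powr (1 / 2))"

text \<open>Half of \<open>\<bar>2 * i - c\<bar>\<close> is what remains for the double difference;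
  the triangle defect uses the same sum.\<close>

lemma half_rate_sum:
  "(\<Sum>i\<le>n. \<rho> powr (\<bar>2 * real i - real_of_int c\<bar> / 2)) \<le> geo_sum"
proof -
  have "\<rho> powr (1 / 2) < 1 powr (1 / 2)" using rho by (intro powr_less_mono2) auto
  then have "(\<Sum>i\<le>n. (\<rho> powr (1 / 2)) powr \<bar>2 * real i - real_of_int c\<bar>) \<le> geo_sum"
    using rho by (intro two_sided_geometric) auto
  then show ?thesis by (simp add: powr_powr)
qed

lemma geo_sum_pos: "0 < geo_sum"
proof -
  have "\<rho> powr (1 / 2) < 1 powr (1 / 2)" using rho by (intro powr_less_mono2) auto
  then show ?thesis by simp
qed

end

context fine_graph
begin

section \<open>The triangle defect\<close>

text \<open>The power \<open>t ^ (p - 1)\<close> decays away from the geodesic from \<open>a\<close>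
  to \<open>c\<close>. Along it, the centre of the triangle is at
  \<open>m / 2 = (b|c)\<^sub>a\<close>: beyond the centre \<open>a\<close> and \<open>b\<close> look
  alike, before it \<open>b\<close> and \<open>c\<close> do. So \<open>min u v\<close> decays in
  both directions.\<close>

lemma T_triangle_finite_sum:
  assumes F: "finite F" "F \<subseteq> V" and V: "a \<in> V" "b \<in> V" "c \<in> V"
  shows "(\<Sum>x\<in>F. T a c x - T a b x - T b c x) \<le> offset \<delta> N"
proof -
  obtain w where w: "\<And>i. i \<le> d a c \<Longrightarrow> w i \<in> V \<and> d a (w i) = i \<and> d (w i) c = d a c - i"
    using geo_sequence V by blast
  define m where "m = int (d a c) + int (d a b) - int (d b c)"
  have "(\<Sum>x\<in>F. T a c x - T a b x - T b c x)
      \<le> 2 * (real p * loss \<delta> N) * (\<Sum>i\<le>d a c. \<rho> powr (\<bar>2 * real i - real_of_int m\<bar> / 2))"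
  proof (rule sum_along_sequence[OF F])
    fix x assume "x \<in> F"
    then have x: "x \<in> V" using F by blast
    obtain i where i: "i \<le> d a c" "2 * d x (w i) + d a c \<le> d x a + d x c + 2 * \<delta> + 1"
      using geodesic_near_point[OF x V(1,3) w] by blast
    define h where "h = d x (w i)"
    have wV: "w i \<in> V" and wa: "d (w i) a = i" and wc: "d (w i) c = d a c - i" using w[OF i(1)] d_sym V by auto
    have s: "2 * real h - (22 * real \<delta> + 1) \<le> real (d x a) + real (d x c) - real (d a c) - 20 * real \<delta>"
      using i(2) unfolding h_def by linarith
    have t: "d (w i) a \<le> h + d x a" "d (w i) b \<le> h + d x b" "d (w i) c \<le> h + d x c"
      "d b c \<le> d (w i) b + d (w i) c" "d a b \<le> d (w i) a + d (w i) b"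
      using d_tri[of "w i" x] d_tri[of b "w i" c] d_tri[of a "w i" b] d_sym x wV V unfolding h_def by metis+
    \<comment> \<open>Seen from \<open>w i\<close>, twice the Gromov product of \<open>a\<close> and
      \<open>b\<close> is at least \<open>2 * i - m\<close>; passing to \<open>x\<close> changes it
      by at most \<open>2 * h\<close>.\<close>
    have sab: "2 * real i - real_of_int m - 2 * real h - 20 * real \<delta> \<le> real (d x a) + real (d x b) - real (d a b) - 20 * real \<delta>"
      using t wa wc i(1) unfolding m_def by linarith
    have sbc: "real_of_int m - 2 * real i - 2 * real h - 20 * real \<delta> \<le> real (d x b) + real (d x c) - real (d b c) - 20 * real \<delta>"
      using t wa wc i(1) unfolding m_def by linarith
    have "T a c x - T a b x - T b c x \<le> real p * loss \<delta> N * \<rho> powr (2 * real q * real h + \<bar>2 * real i - real_of_int m\<bar> / 2)"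
      unfolding flow_term_def sum_subtractf[symmetric]
    proof (rule sum_near_le[OF x])
      fix z
      define t where "t = \<bar>fl x a z - fl x c z\<bar>"
      define u where "u = \<bar>fl x a z - fl x b z\<bar>"
      define v where "v = \<bar>fl x b z - fl x c z\<bar>"
      have tuv: "0 \<le> t" "0 \<le> u" "0 \<le> v" by (auto simp: t_def u_def v_def)
      have "(fl x a z - fl x c z) ^ p - (fl x a z - fl x b z) ^ p - (fl x b z - fl x c z) ^ p = t ^ p - u ^ p - v ^ p"
        unfolding t_def u_def v_def using exponent(1) by (simp add: power_even_abs)
      also have "\<dots> \<le> real p * t ^ (p - 1) * min u v"
        by (rule power_sum_defect) (auto simp: t_def u_def v_def)
      also have "\<dots> \<le> real p * \<rho> powr (real (p - 1) * (2 * real h - (22 * real \<delta> + 1)))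
          * \<rho> powr (\<bar>2 * real i - real_of_int m\<bar> - 2 * real h - 20 * real \<delta>)"
      proof (intro mult_mono mult_left_mono)
        show "t ^ (p - 1) \<le> \<rho> powr (real (p - 1) * (2 * real h - (22 * real \<delta> + 1)))"
          unfolding t_def by (rule flow_diff_powr[OF x V(1,3) s])
        have "u \<le> \<rho> powr (2 * real i - real_of_int m - 2 * real h - 20 * real \<delta>)"
          using flow_diff_powr[OF x V(1,2) sab, of z 1] by (simp add: u_def)
        moreover have "v \<le> \<rho> powr (real_of_int m - 2 * real i - 2 * real h - 20 * real \<delta>)"
          using flow_diff_powr[OF x V(2,3) sbc, of z 1] by (simp add: v_def)
        ultimately show "min u v \<le> \<rho> powr (\<bar>2 * real i - real_of_int m\<bar> - 2 * real h - 20 * real \<delta>)"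
          by (cases "2 * real i \<ge> real_of_int m") (auto simp: abs_if min_le_iff_disj)
      qed (use tuv in auto)
      also have "\<dots> = real p * \<rho> powr (real (p - 1) * (2 * real h - (22 * real \<delta> + 1)) + (\<bar>2 * real i - real_of_int m\<bar> - 2 * real h - 20 * real \<delta>))"
        by (simp only: powr_add mult.assoc)
      also have "\<dots> \<le> real p * \<rho> powr (2 * real q * real h + \<bar>2 * real i - real_of_int m\<bar> / 2 - real p * (22 * real \<delta> + 1))"
      proof (intro mult_left_mono rho_mono)
        \<comment> \<open>Three powers more than \<open>q\<close> are at hand; they cover the
          \<open>2 * h\<close> lost in \<open>min u v\<close>.\<close>
        have pq: "real (p - 1) = real q + 3" "real p = real q + 4" using exponent(2) by (auto simp: of_nat_diff)
        show "2 * real q * real h + \<bar>2 * real i - real_of_int m\<bar> / 2 - real p * (22 * real \<delta> + 1)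
          \<le> real (p - 1) * (2 * real h - (22 * real \<delta> + 1)) + (\<bar>2 * real i - real_of_int m\<bar> - 2 * real h - 20 * real \<delta>)"
          unfolding pq by (simp add: algebra_simps)
      qed simp
      finally show "(fl x a z - fl x c z) ^ p - (fl x a z - fl x b z) ^ p - (fl x b z - fl x c z) ^ p
          \<le> real p * \<rho> powr (2 * real q * real h + \<bar>2 * real i - real_of_int m\<bar> / 2 - real p * (22 * real \<delta> + 1))" .
    qed simp
    then show "\<exists>i\<le>d a c. T a c x - T a b x - T b c x
        \<le> real p * loss \<delta> N * (\<rho> powr (2 * real q * real (d x (w i))) * \<rho> powr (\<bar>2 * real i - real_of_int m\<bar> / 2))"
      using i unfolding h_def powr_add by auto
  qed (use w loss_pos in auto)
  also have "\<dots> \<le> 2 * (real p * loss \<delta> N) * geo_sum"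
    using loss_pos by (intro mult_left_mono half_rate_sum) auto
  also have "\<dots> = offset \<delta> N" by (simp add: offset_def)
  finally show ?thesis .
qed

lemma cost_triangle:
  assumes V: "a \<in> V" "b \<in> V" "c \<in> V"
  shows "flow_cost V d \<delta> N a c \<le> flow_cost V d \<delta> N a b + flow_cost V d \<delta> N b c + offset \<delta> N"
proof -
  have "flow_cost V d \<delta> N a c \<le> infsum (\<lambda>x. T a b x + T b c x) V + offset \<delta> N"
    unfolding flow_cost_def
  proof (rule infsum_le_finite_sums[OF T_summable[OF V(1,3)]])
    fix F :: "'a set" assume F: "finite F" "F \<subseteq> V"
    have "sum (\<lambda>x. T a b x + T b c x) F \<le> infsum (\<lambda>x. T a b x + T b c x) V"
      using T_nonneg F T_summable V by (intro finite_sum_le_infsum summable_on_add) (auto intro: add_nonneg_nonneg)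
    then show "sum (T a c) F \<le> infsum (\<lambda>x. T a b x + T b c x) V + offset \<delta> N"
      using T_triangle_finite_sum[OF F V] by (simp add: sum_subtractf sum.distrib)
  qed
  also have "infsum (\<lambda>x. T a b x + T b c x) V = flow_cost V d \<delta> N a b + flow_cost V d \<delta> N b c"
    unfolding flow_cost_def using T_summable V by (intro infsum_add) auto
  finally show ?thesis by simp
qed

section \<open>The double difference of the flow cost\<close>

text \<open>\<open>e\<close> and \<open>f\<close> are twice the Gromov products of \<open>a\<close>,
  \<open>a'\<close> and of \<open>b\<close>, \<open>b'\<close> seen from \<open>w i\<close>. The
  separation by \<open>D\<close> forces \<open>e + f\<close> to be large, since a point of the
  geodesic from \<open>a\<close> to \<open>b\<close> cannot be near both bounding geodesics; it also
  grows with the distance from \<open>m / 2 = (a'|b)\<^sub>a\<close>, which makes the sum along the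
  geodesic converge.\<close>

lemma product_sum_along_geodesic:
  assumes F: "finite F" "F \<subseteq> V" and V: "a \<in> V" "a' \<in> V" "b \<in> V" "b' \<in> V"
    and M: "0 \<le> M" and D: "0 \<le> D" "real (d a a') + real (d b b') + 2 * D \<le> real (d a' b) + real (d a b') + M"
  shows "(\<Sum>x\<in>F. \<Sum>z\<in>near x. \<bar>fl x a z - fl x a' z\<bar> * \<bar>fl x b z - fl x b' z\<bar> * \<bar>fl x a z - fl x b z\<bar> ^ (p - 2))
    \<le> 2 * loss \<delta> N * geo_sum * \<rho> powr (D - M)"
proof -
  obtain w where w: "\<And>i. i \<le> d a b \<Longrightarrow> w i \<in> V \<and> d a (w i) = i \<and> d (w i) b = d a b - i"
    using geo_sequence V by blast
  define m where "m = int (d a b) + int (d a a') - int (d a' b)"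
  have "(\<Sum>x\<in>F. \<Sum>z\<in>near x. \<bar>fl x a z - fl x a' z\<bar> * \<bar>fl x b z - fl x b' z\<bar> * \<bar>fl x a z - fl x b z\<bar> ^ (p - 2))
      \<le> 2 * (loss \<delta> N * \<rho> powr (D - M)) * (\<Sum>i\<le>d a b. \<rho> powr (\<bar>2 * real i - real_of_int m\<bar> / 2))"
  proof (rule sum_along_sequence[OF F])
    fix x assume "x \<in> F"
    then have x: "x \<in> V" using F by blast
    obtain i where i: "i \<le> d a b" "2 * d x (w i) + d a b \<le> d x a + d x b + 2 * \<delta> + 1"
      using geodesic_near_point[OF x V(1,3) w] by blast
    define h where "h = d x (w i)"
    have wV: "w i \<in> V" and wa: "d (w i) a = i" and wb: "d (w i) b = d a b - i" using w[OF i(1)] d_sym V by auto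
    have s: "2 * real h - (22 * real \<delta> + 1) \<le> real (d x a) + real (d x b) - real (d a b) - 20 * real \<delta>"
      using i(2) unfolding h_def by linarith
    have t: "d (w i) a \<le> h + d x a" "d (w i) b \<le> h + d x b" "d (w i) a' \<le> h + d x a'" "d (w i) b' \<le> h + d x b'"
      "d a' b \<le> d (w i) a' + d (w i) b" "d a b' \<le> d (w i) a + d (w i) b'"
      "d a a' \<le> d (w i) a + d (w i) a'" "d b b' \<le> d (w i) b + d (w i) b'"
      using d_tri[of "w i" x] d_tri[of _ "w i"] d_sym x wV V unfolding h_def by metis+
    define e where "e = real (d (w i) a) + real (d (w i) a') - real (d a a')"
    define f where "f = real (d (w i) b) + real (d (w i) b') - real (d b b')"
    have sa: "e - 2 * real h - 20 * real \<delta> \<le> real (d x a) + real (d x a') - real (d a a') - 20 * real \<delta>"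
      using t unfolding e_def by linarith
    have sb: "f - 2 * real h - 20 * real \<delta> \<le> real (d x b) + real (d x b') - real (d b b') - 20 * real \<delta>"
      using t unfolding f_def by linarith
    have e: "0 \<le> e" "2 * real i - real_of_int m \<le> e" using t wa wb i(1) unfolding e_def m_def by linarith+
    have f: "0 \<le> f" "2 * D - M - (2 * real i - real_of_int m) \<le> f" using t wa wb i(1) D unfolding f_def m_def by linarith+
    \<comment> \<open>The bounds on \<open>e\<close> and \<open>f\<close> add up to
      \<open>2 * D - M\<close>, in which the position \<open>i\<close> cancels. Half of
      \<open>e + f\<close> provides the term \<open>D\<close>, the other half the decay along the
      geodesic.\<close>
    have "D - M + s / 2 \<le> e + f" if "s \<le> e + f + M" for s using that e f by linarith
    moreover have "\<bar>2 * real i - real_of_int m\<bar> \<le> e + f + M"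
      using e f M D(1) by (cases "real_of_int m \<le> 2 * real i") auto
    ultimately have ef: "D - M + \<bar>2 * real i - real_of_int m\<bar> / 2 \<le> e + f" by blast
    have "(\<Sum>z\<in>near x. \<bar>fl x a z - fl x a' z\<bar> * \<bar>fl x b z - fl x b' z\<bar> * \<bar>fl x a z - fl x b z\<bar> ^ (p - 2))
        \<le> 1 * loss \<delta> N * \<rho> powr (2 * real q * real h + (D - M + \<bar>2 * real i - real_of_int m\<bar> / 2))"
    proof (rule sum_near_le[OF x])
      fix z
      have "\<bar>fl x a z - fl x a' z\<bar> * \<bar>fl x b z - fl x b' z\<bar> * \<bar>fl x a z - fl x b z\<bar> ^ (p - 2)
          \<le> \<rho> powr (e - 2 * real h - 20 * real \<delta>) * \<rho> powr (f - 2 * real h - 20 * real \<delta>)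
            * \<rho> powr (real (p - 2) * (2 * real h - (22 * real \<delta> + 1)))"
        using flow_diff_powr[OF x V(1,2) sa, of z 1] flow_diff_powr[OF x V(3,4) sb, of z 1]
          flow_diff_powr[OF x V(1,3) s, of z "p - 2"] by (intro mult_mono) auto
      also have "\<dots> = \<rho> powr (e - 2 * real h - 20 * real \<delta> + (f - 2 * real h - 20 * real \<delta>)
            + real (p - 2) * (2 * real h - (22 * real \<delta> + 1)))"
        by (simp only: powr_add)
      also have "\<dots> \<le> \<rho> powr (2 * real q * real h + (D - M + \<bar>2 * real i - real_of_int m\<bar> / 2) - real p * (22 * real \<delta> + 1))"
      proof (intro rho_mono)
        have pq: "real (p - 2) = real q + 2" "real p = real q + 4" using exponent(2) by (auto simp: of_nat_diff)
        show "2 * real q * real h + (D - M + \<bar>2 * real i - real_of_int m\<bar> / 2) - real p * (22 * real \<delta> + 1)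
          \<le> e - 2 * real h - 20 * real \<delta> + (f - 2 * real h - 20 * real \<delta>) + real (p - 2) * (2 * real h - (22 * real \<delta> + 1))"
          unfolding pq using ef by (simp add: algebra_simps)
      qed
      finally show "\<bar>fl x a z - fl x a' z\<bar> * \<bar>fl x b z - fl x b' z\<bar> * \<bar>fl x a z - fl x b z\<bar> ^ (p - 2)
        \<le> 1 * \<rho> powr (2 * real q * real h + (D - M + \<bar>2 * real i - real_of_int m\<bar> / 2) - real p * (22 * real \<delta> + 1))" by simp
    qed simp
    then show "\<exists>i\<le>d a b. (\<Sum>z\<in>near x. \<bar>fl x a z - fl x a' z\<bar> * \<bar>fl x b z - fl x b' z\<bar> * \<bar>fl x a z - fl x b z\<bar> ^ (p - 2))
        \<le> loss \<delta> N * \<rho> powr (D - M) * (\<rho> powr (2 * real q * real (d x (w i))) * \<rho> powr (\<bar>2 * real i - real_of_int m\<bar> / 2))"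
      using i unfolding h_def powr_add by (intro exI[of _ i]) (simp add: mult_ac)
  qed (use w loss_pos in auto)
  also have "\<dots> \<le> 2 * (loss \<delta> N * \<rho> powr (D - M)) * geo_sum"
    using loss_pos by (intro mult_left_mono half_rate_sum) auto
  finally show ?thesis by (simp add: mult_ac)
qed

lemma cost_double_difference:
  assumes V: "a \<in> V" "a' \<in> V" "b \<in> V" "b' \<in> V" and M: "0 \<le> M" and D: "0 \<le> D"
    "real (d a a') + real (d b b') + 2 * D \<le> real (d a' b) + real (d a b') + M"
    "real (d a a') + real (d b b') + 2 * D \<le> real (d a b) + real (d a' b') + M"
  shows "\<bar>flow_cost V d \<delta> N a b - flow_cost V d \<delta> N a' b - flow_cost V d \<delta> N a b' + flow_cost V d \<delta> N a' b'\<bar>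
    \<le> 8 * real p ^ 2 * loss \<delta> N * geo_sum * \<rho> powr (D - M)"
proof -
  define t where "t = (\<lambda>x. T a b x - T a' b x - T a b' x + T a' b' x)"
  define E where "E = 8 * real p ^ 2 * loss \<delta> N * geo_sum * \<rho> powr (D - M)"
  define g where "g = (\<lambda>a a' b b' x. \<Sum>z\<in>near x. \<bar>fl x a z - fl x a' z\<bar> * \<bar>fl x b z - fl x b' z\<bar> * \<bar>fl x a z - fl x b z\<bar> ^ (p - 2))"
  have tg: "\<bar>t x\<bar> \<le> real p ^ 2 * (g a a' b b' x + g a' a b b' x + g a a' b' b x + g a' a b' b x)" if "x \<in> V" for x
  proof -
    have "\<bar>t x\<bar> \<le> (\<Sum>z\<in>near x. real p ^ 2 * (\<bar>fl x a z - fl x a' z\<bar> * \<bar>fl x b z - fl x b' z\<bar> *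
      (\<bar>fl x a z - fl x b z\<bar> ^ (p - 2) + \<bar>fl x a' z - fl x b z\<bar> ^ (p - 2) + \<bar>fl x a z - fl x b' z\<bar> ^ (p - 2) + \<bar>fl x a' z - fl x b' z\<bar> ^ (p - 2))))"
      unfolding t_def flow_term_def sum_subtractf[symmetric] sum.distrib[symmetric]
      using exponent(2) by (intro order_trans[OF sum_abs] sum_mono power_second_difference) auto
    also have "\<dots> = real p ^ 2 * (g a a' b b' x + g a' a b b' x + g a a' b' b x + g a' a b' b x)"
      unfolding g_def sum_distrib_left sum.distrib[symmetric]
      by (intro sum.cong) (auto simp: algebra_simps abs_minus_commute)
    finally show ?thesis .
  qed
  have fin: "(\<Sum>x\<in>F. \<bar>t x\<bar>) \<le> E" if F: "finite F" "F \<subseteq> V" for F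
  proof -
    \<comment> \<open>One estimate for each of the four geodesics joining \<open>a\<close> or
      \<open>a'\<close> to \<open>b\<close> or \<open>b'\<close>; exchanging end points turns one of
      the two bridge inequalities into the other.\<close>
    have G: "(\<Sum>x\<in>F. g a a' b b' x) \<le> 2 * loss \<delta> N * geo_sum * \<rho> powr (D - M)"
      "(\<Sum>x\<in>F. g a' a b b' x) \<le> 2 * loss \<delta> N * geo_sum * \<rho> powr (D - M)"
      "(\<Sum>x\<in>F. g a a' b' b x) \<le> 2 * loss \<delta> N * geo_sum * \<rho> powr (D - M)"
      "(\<Sum>x\<in>F. g a' a b' b x) \<le> 2 * loss \<delta> N * geo_sum * \<rho> powr (D - M)"
      unfolding g_def using D(2,3) d_sym[OF V(1,2)] d_sym[OF V(3,4)]
      by (intro product_sum_along_geodesic F V M D(1); linarith)+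
    have "(\<Sum>x\<in>F. \<bar>t x\<bar>) \<le> (\<Sum>x\<in>F. real p ^ 2 * (g a a' b b' x + g a' a b b' x + g a a' b' b x + g a' a b' b x))"
      using tg F by (intro sum_mono) auto
    also have "\<dots> = real p ^ 2 * ((\<Sum>x\<in>F. g a a' b b' x) + (\<Sum>x\<in>F. g a' a b b' x) + (\<Sum>x\<in>F. g a a' b' b x) + (\<Sum>x\<in>F. g a' a b' b x))"
      by (simp only: sum.distrib flip: sum_distrib_left)
    also have "\<dots> \<le> real p ^ 2 * (4 * (2 * loss \<delta> N * geo_sum * \<rho> powr (D - M)))"
      using G by (intro mult_left_mono) auto
    also have "\<dots> = E" by (simp add: E_def)
    finally show ?thesis .
  qed
  have sm: "(\<lambda>x. \<bar>t x\<bar>) summable_on V"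
    using fin by (intro nonneg_bdd_above_summable_on) (auto intro!: bdd_aboveI2)
  have h: "(T y z has_sum flow_cost V d \<delta> N y z) V" if "y \<in> V" "z \<in> V" for y z
    unfolding flow_cost_def using T_summable[OF that] by (rule has_sum_infsum)
  have "((\<lambda>x. T a b x + - T a' b x + - T a b' x + T a' b' x) has_sum
      (flow_cost V d \<delta> N a b + - flow_cost V d \<delta> N a' b + - flow_cost V d \<delta> N a b' + flow_cost V d \<delta> N a' b')) V"
    using V by (intro has_sum_add has_sum_uminusI h) auto
  then have "flow_cost V d \<delta> N a b - flow_cost V d \<delta> N a' b - flow_cost V d \<delta> N a b' + flow_cost V d \<delta> N a' b' = infsum t V"
    unfolding t_def by (metis (no_types, lifting) diff_conv_add_uminus infsumI infsum_cong)
  also have "\<bar>\<dots>\<bar> \<le> infsum (\<lambda>x. \<bar>t x\<bar>) V" using norm_infsum_bound[of t V] sm by simp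
  also have "\<dots> \<le> E" using sm fin by (intro infsum_le_finite_sums) auto
  finally show ?thesis unfolding E_def .
qed

section \<open>Linear growth of the flow cost\<close>

text \<open>A common stopping vertex \<open>z\<close> of both flows would have distance
  \<open>5 * \<delta>\<close> from \<open>x\<close> and excess at most \<open>4 * \<delta>\<close>
  on both sides, hence give a path from \<open>a\<close> to \<open>b\<close> that is
  \<open>2 * \<delta>\<close> too short. So the supports are disjoint, and by pigeonhole some
  \<open>z\<close> carries a fixed share of the first distribution.\<close>

lemma T_lower:
  assumes V: "x \<in> V" "a \<in> V" "b \<in> V" and far: "5 * \<delta> \<le> d x a" "5 * \<delta> \<le> d x b" and on: "d x a + d x b = d a b"
  shows "(1 / real (N ^ (5 * \<delta>))) ^ p \<le> T a b x"
proof -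
  have fin: "finite (near x)" "card (near x) \<le> N ^ (5 * \<delta>)" using ball_bound V by auto
  have ex: "\<exists>z\<in>near x. 1 / real (N ^ (5 * \<delta>)) \<le> fl x a z"
  proof (rule ccontr)
    assume "\<not> ?thesis"
    then have "\<And>z. z \<in> near x \<Longrightarrow> fl x a z < 1 / real (N ^ (5 * \<delta>))" by force
    moreover have "near x \<noteq> {}" using V by (auto intro: exI[of _ x])
    ultimately have "(\<Sum>z\<in>near x. fl x a z) < (\<Sum>z\<in>near x. 1 / real (N ^ (5 * \<delta>)))" using fin by (intro sum_strict_mono) auto
    also have "\<dots> \<le> 1" using fin N_ge_2 by (simp add: divide_le_eq flip: of_nat_power)
    finally show False using flow_sum V by simp
  qed
  then obtain z where z: "z \<in> near x" "1 / real (N ^ (5 * \<delta>)) \<le> fl x a z" by blast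
  have "0 < 1 / real (N ^ (5 * \<delta>))" using N_ge_2 by simp
  then have nz: "fl x a z \<noteq> 0" using z by linarith
  have "fl x b z = 0"
  proof (rule ccontr)
    assume nb: "fl x b z \<noteq> 0"
    have "d a b \<le> d z a + d z b" using d_tri[of a z b] d_sym[of a z] flow_excess(1)[OF V(1,2) far(1) nz] V by simp
    then show False
      using flow_excess(2,3)[OF V(1,2) far(1) nz] flow_excess(3)[OF V(1,3) far(2) nb] on delta_pos by linarith
  qed
  then have "(1 / real (N ^ (5 * \<delta>))) ^ p \<le> (fl x a z - fl x b z) ^ p" using z by (intro power_mono) auto
  also have "\<dots> \<le> T a b x" unfolding flow_term_def using fin z exponent(1) by (intro member_le_sum) auto
  finally show ?thesis .
qed

text \<open>\<open>T_lower\<close> is applied to the points of a geodesic that are at least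
  \<open>5 * \<delta>\<close> from both ends; they are distinct because their distances from
  \<open>a\<close> are.\<close>

lemma cost_lower:
  assumes V: "a \<in> V" "b \<in> V"
  shows "(real (d a b) - 10 * real \<delta>) * (1 / real (N ^ (5 * \<delta>))) ^ p \<le> flow_cost V d \<delta> N a b"
proof -
  define c where "c = (1 / real (N ^ (5 * \<delta>))) ^ p"
  have c: "0 \<le> c" by (simp add: c_def)
  obtain w where w: "\<And>i. i \<le> d a b \<Longrightarrow> w i \<in> V \<and> d a (w i) = i \<and> d (w i) b = d a b - i"
    using geo_sequence V by blast
  define I where "I = {i. 5 * \<delta> \<le> i \<and> i + 5 * \<delta> \<le> d a b}"
  have "I \<subseteq> {..d a b}" by (auto simp: I_def)
  have inj: "inj_on w I"
    by (rule inj_on_inverseI[where g = "d a"]) (use w in \<open>auto simp: I_def\<close>)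
  have I: "I = {5 * \<delta>..<d a b + 1 - 5 * \<delta>}" by (auto simp: I_def)
  have "(real (d a b) - 10 * real \<delta>) * c \<le> real (card I) * c"
    using c unfolding I by (intro mult_right_mono) auto
  also have "\<dots> \<le> (\<Sum>i\<in>I. T a b (w i))"
  proof (rule sum_bounded_below)
    fix i assume i: "i \<in> I"
    then have i': "i \<le> d a b" by (auto simp: I_def)
    show "c \<le> T a b (w i)" unfolding c_def
      using w[OF i'] d_sym[of a "w i"] V i by (intro T_lower) (auto simp: I_def)
  qed
  also have "\<dots> = sum (T a b) (w ` I)" by (simp add: sum.reindex[OF inj])
  also have "\<dots> \<le> flow_cost V d \<delta> N a b"
    unfolding flow_cost_def
  proof (rule finite_sum_le_infsum[OF T_summable[OF V]])
    show "finite (w ` I)" unfolding I by simp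
    show "w ` I \<subseteq> V" using w \<open>I \<subseteq> {..d a b}\<close> by auto
  qed (use T_nonneg in auto)
  finally show ?thesis unfolding c_def .
qed

section \<open>The vertex metric\<close>

lemma offset_pos: "0 < offset \<delta> N"
proof -
  have "offset \<delta> N = 2 * (real p * loss \<delta> N) * geo_sum" by (simp add: offset_def)
  also have "\<dots> > 0" using loss_pos geo_sum_pos exponent(2) by (intro mult_pos_pos) auto
  finally show ?thesis .
qed

abbreviation "\<Delta> \<equiv> vertex_metric V d \<delta> N"

lemma vertex_metric_self [simp]: "\<Delta> a a = 0"
  by (simp add: vertex_metric_def)

lemma vertex_metric_pos: "a \<noteq> b \<Longrightarrow> 0 < \<Delta> a b"
  using offset_pos cost_nonneg[of a b] by (simp add: vertex_metric_def)

lemma vertex_metric_commute: "\<Delta> a b = \<Delta> b a"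
proof -
  have "T a b = T b a" using T_commute by blast
  then show ?thesis by (auto simp: vertex_metric_def flow_cost_def)
qed

text \<open>For distinct vertices the right-hand side contains \<open>offset\<close> twice and the
  left-hand side once; the surplus absorbs the defect in \<open>cost_triangle\<close>.\<close>

lemma vertex_metric_triangle:
  assumes "a \<in> V" "b \<in> V" "c \<in> V" shows "\<Delta> a c \<le> \<Delta> a b + \<Delta> b c"
  using cost_triangle[OF assms] offset_pos cost_nonneg[of a b] cost_nonneg[of b c]
  by (cases "a = c") (simp_all add: vertex_metric_def)

lemma vertex_metric_quasi_isometric:
  obtains A B where "1 \<le> A" "0 \<le> B"
    "\<And>a b. a \<in> V \<Longrightarrow> b \<in> V \<Longrightarrow> real (d a b) / A - B \<le> \<Delta> a b \<and> \<Delta> a b \<le> A * real (d a b) + B"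
proof -
  define c where "c = (1 / real (N ^ (5 * \<delta>))) ^ p"
  define l where "l = loss \<delta> N"
  have c: "0 < c" using N_ge_2 by (simp add: c_def)
  have l: "0 < l" using loss_pos by (simp add: l_def)
  define A where "A = 1 + 2 * l + 1 / c"
  define B where "B = offset \<delta> N + 2 * l + 10 * real \<delta> * c"
  have A: "1 \<le> A" "2 * l \<le> A" "1 / c \<le> A" using c l by (auto simp: A_def)
  have B: "0 \<le> B" "offset \<delta> N + 2 * l \<le> B" "10 * real \<delta> * c \<le> B" using c l offset_pos by (auto simp: B_def)
  have "real (d a b) / A - B \<le> \<Delta> a b \<and> \<Delta> a b \<le> A * real (d a b) + B" if V: "a \<in> V" "b \<in> V" for a b
  proof (cases "a = b")
    case True
    then show ?thesis using A B V by simp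
  next
    case False
    have "1 / A \<le> c" using A c by (simp add: field_simps)
    then have "real (d a b) / A \<le> real (d a b) * c" by (metis mult_left_mono of_nat_0_le_iff times_divide_eq_right mult.right_neutral)
    moreover have "(real (d a b) - 10 * real \<delta>) * c \<le> \<Delta> a b"
      using cost_lower[OF V] offset_pos False by (simp add: vertex_metric_def c_def)
    ultimately have "real (d a b) / A - B \<le> \<Delta> a b" using B by (simp add: algebra_simps)
    moreover have "\<Delta> a b \<le> A * real (d a b) + B"
    proof -
      have "\<Delta> a b \<le> offset \<delta> N + 2 * l * (real (d a b) + 1)"
        using cost_upper[OF V] False by (simp add: vertex_metric_def l_def)
      also have "\<dots> = 2 * l * real (d a b) + (offset \<delta> N + 2 * l)" by (simp add: algebra_simps)
      also have "\<dots> \<le> A * real (d a b) + B" using A B by (intro add_mono mult_right_mono) auto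
      finally show ?thesis .
    qed
    ultimately show ?thesis by simp
  qed
  then show ?thesis using that A B by blast
qed

text \<open>As \<open>D\<close> is positive, all four pairs consist of distinct vertices, so the
  four offsets cancel and the double difference is that of the flow cost.\<close>

lemma vertex_metric_double_difference:
  obtains L where "0 \<le> L"
    "\<And>a a' b b' D. a \<in> V \<Longrightarrow> a' \<in> V \<Longrightarrow> b \<in> V \<Longrightarrow> b' \<in> V \<Longrightarrow> 0 < D \<Longrightarrow>
      D \<le> d a b \<Longrightarrow> D \<le> d a' b \<Longrightarrow> D \<le> d a b' \<Longrightarrow> D \<le> d a' b' \<Longrightarrow>
      d a a' + d b b' + 2 * D \<le> d a' b + d a b' + (2 * overlap_bound (4 * \<delta> + 1) + 4 * \<delta> + 2) \<Longrightarrow>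
      d a a' + d b b' + 2 * D \<le> d a b + d a' b' + (2 * overlap_bound (4 * \<delta> + 1) + 4 * \<delta> + 2) \<Longrightarrow>
      \<bar>\<Delta> a b - \<Delta> a' b - \<Delta> a b' + \<Delta> a' b'\<bar> \<le> L * \<rho> powr real D"
proof -
  define M where "M = 2 * overlap_bound (4 * \<delta> + 1) + 4 * \<delta> + 2"
  define L where "L = 8 * real p ^ 2 * loss \<delta> N * geo_sum * \<rho> powr (- real M)"
  have L: "0 \<le> L" using loss_pos geo_sum_pos unfolding L_def by (intro mult_nonneg_nonneg) auto
  show ?thesis
  proof (rule that[OF L])
    fix a a' b b' D
    assume V: "a \<in> V" "a' \<in> V" "b \<in> V" "b' \<in> V" and D: "0 < D" "D \<le> d a b" "D \<le> d a' b" "D \<le> d a b'" "D \<le> d a' b'"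
      and br: "d a a' + d b b' + 2 * D \<le> d a' b + d a b' + (2 * overlap_bound (4 * \<delta> + 1) + 4 * \<delta> + 2)"
      "d a a' + d b b' + 2 * D \<le> d a b + d a' b' + (2 * overlap_bound (4 * \<delta> + 1) + 4 * \<delta> + 2)"
    have ne: "a \<noteq> b" "a' \<noteq> b" "a \<noteq> b'" "a' \<noteq> b'" using D V by auto
    have "\<bar>\<Delta> a b - \<Delta> a' b - \<Delta> a b' + \<Delta> a' b'\<bar> \<le> 8 * real p ^ 2 * loss \<delta> N * geo_sum * \<rho> powr (real D - real M)"
      using cost_double_difference[OF V, of "real M" "real D"] br ne unfolding M_def[symmetric]
      by (simp add: vertex_metric_def)
    also have "\<dots> = L * \<rho> powr real D" unfolding L_def by (simp add: diff_conv_add_uminus powr_add mult_ac del: add_uminus_conv_diff)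
    finally show "\<bar>\<Delta> a b - \<Delta> a' b - \<Delta> a b' + \<Delta> a' b'\<bar> \<le> L * \<rho> powr real D" .
  qed
qed

end

section \<open>The path metric at vertices\<close>

definition gdist :: "'a set set \<Rightarrow> 'a \<Rightarrow> 'a \<Rightarrow> nat" where
  "gdist X u v = (LEAST n. (u, v) \<in> {(x, y). {x, y} \<in> X} ^^ n)"

definition lin :: "'a \<Rightarrow> 'a \<Rightarrow> real \<Rightarrow> 'a \<Rightarrow> real" where
  "lin u v t = (\<lambda>w. (1 - t) * vpt u w + t * vpt v w)"

definition polygon :: "(nat \<Rightarrow> 'a) \<Rightarrow> real \<Rightarrow> 'a \<Rightarrow> real" where
  "polygon f t = lin (f (nat \<lfloor>t\<rfloor>)) (f (Suc (nat \<lfloor>t\<rfloor>))) (t - real (nat \<lfloor>t\<rfloor>))"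

lemma supp_vpt [simp]: "supp (vpt v) = {v}"
  by (auto simp: supp_def vpt_def)

lemma vpt_eq_iff [simp]: "vpt u = vpt v \<longleftrightarrow> u = v"
  by (metis singleton_inject supp_vpt)

lemma lin_0 [simp]: "lin u v 0 = vpt u" and lin_1 [simp]: "lin u v 1 = vpt v"
  by (auto simp: lin_def)

lemma supp_lin: "u \<noteq> v \<Longrightarrow> supp (lin u v t) = (if t = 1 then {} else {u}) \<union> (if t = 0 then {} else {v})"
  by (auto simp: supp_def lin_def vpt_def split: if_splits)

lemma polygon_edge:
  assumes "real i \<le> t" "t \<le> real i + 1"
  shows "polygon f t = lin (f i) (f (Suc i)) (t - real i)"
proof (cases "t = real i + 1")
  case True
  have "\<lfloor>real i + 1\<rfloor> = int i + 1" by linarith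
  then show ?thesis using True by (simp add: polygon_def nat_add_distrib)
next
  case False
  then have "\<lfloor>t\<rfloor> = int i" using assms by (intro floor_unique) auto
  then show ?thesis by (simp add: polygon_def)
qed

lemma polygon_nat [simp]: "polygon f (real i) = vpt (f i)"
  using polygon_edge[of i "real i" f] by simp

section \<open>Lengths of segments and paths\<close>

lemma seg_length_superset:
  assumes "finite S" "supp p \<union> supp q \<subseteq> S"
  shows "seg_length p q = (\<Sum>v\<in>S. \<bar>p v - q v\<bar>) / 2"
  unfolding seg_length_def using assms by (auto intro!: sum.mono_neutral_left simp: supp_def)

lemma seg_length_commute: "seg_length p q = seg_length q p"
  by (simp add: seg_length_def Un_commute abs_minus_commute)

lemma seg_length_nonneg: "0 \<le> seg_length p q"
  by (simp add: seg_length_def sum_nonneg)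

lemma pointsD:
  assumes "p \<in> points X"
  shows "0 \<le> p v" "supp p \<in> X" "(\<Sum>v\<in>supp p. p v) = 1" "finite (supp p)" "supp p \<noteq> {}"
proof -
  show "0 \<le> p v" "supp p \<in> X" and s: "(\<Sum>v\<in>supp p. p v) = 1" using assms by (auto simp: points_def)
  show "finite (supp p)" by (rule ccontr) (use s in simp)
  show "supp p \<noteq> {}" using s by auto
qed

lemma point_eq_vpt:
  assumes p: "p \<in> points X" and u: "p u = 1" shows "p = vpt u"
proof
  fix v
  have uS: "u \<in> supp p" using u by (simp add: supp_def)
  have "(\<Sum>v\<in>supp p - {u}. p v) = 0" using pointsD[OF p] u uS by (simp add: sum_diff1)
  then have "p v = 0" if "v \<in> supp p" "v \<noteq> u"
    using that pointsD(1,4)[OF p] by (subst (asm) sum_nonneg_eq_0_iff) auto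
  then show "p v = vpt u v" using u by (cases "v \<in> supp p") (auto simp: vpt_def supp_def)
qed

text \<open>Coordinates sum to 1, so a change of one coordinate is compensated by the others and
  accounts for at most half of the l1-distance.\<close>

lemma coordinate_le_seg_length:
  assumes p: "p \<in> points X" and q: "q \<in> points X"
  shows "\<bar>p u - q u\<bar> \<le> seg_length p q"
proof -
  define S where "S = insert u (supp p \<union> supp q)"
  have S: "finite S" "u \<in> S" using pointsD(4)[OF p] pointsD(4)[OF q] by (auto simp: S_def)
  have sp: "sum p S = 1" using pointsD(3)[OF p] S by (subst sum.mono_neutral_right[of S "supp p"]) (auto simp: S_def supp_def)
  have sq: "sum q S = 1" using pointsD(3)[OF q] S by (subst sum.mono_neutral_right[of S "supp q"]) (auto simp: S_def supp_def)
  have "(\<Sum>v\<in>S. p v - q v) = 0" using sp sq by (simp add: sum_subtractf)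
  then have "p u - q u = - (\<Sum>v\<in>S - {u}. p v - q v)" using S by (simp add: sum.remove[of S u])
  then have "\<bar>p u - q u\<bar> \<le> (\<Sum>v\<in>S - {u}. \<bar>p v - q v\<bar>)" by (metis abs_minus_cancel sum_abs)
  moreover have "(\<Sum>v\<in>S. \<bar>p v - q v\<bar>) = \<bar>p u - q u\<bar> + (\<Sum>v\<in>S - {u}. \<bar>p v - q v\<bar>)"
    using S by (simp add: sum.remove[of S u])
  moreover have "seg_length p q = (\<Sum>v\<in>S. \<bar>p v - q v\<bar>) / 2" using S by (intro seg_length_superset) (auto simp: S_def)
  ultimately show ?thesis by simp
qed

lemma seg_length_vpt:
  assumes p: "p \<in> points X" and u: "u \<in> supp p"
  shows "seg_length (vpt u) p = 1 - p u"
proof -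
  have "seg_length (vpt u) p = (\<Sum>v\<in>supp p. \<bar>vpt u v - p v\<bar>) / 2"
    using pointsD(4)[OF p] u by (intro seg_length_superset) auto
  also have "(\<Sum>v\<in>supp p. \<bar>vpt u v - p v\<bar>) = \<bar>1 - p u\<bar> + (\<Sum>v\<in>supp p - {u}. \<bar>vpt u v - p v\<bar>)"
    using pointsD(4)[OF p] u by (simp add: sum.remove vpt_def)
  also have "(\<Sum>v\<in>supp p - {u}. \<bar>vpt u v - p v\<bar>) = (\<Sum>v\<in>supp p - {u}. p v)"
    using pointsD(1)[OF p] by (intro sum.cong) (auto simp: vpt_def)
  also have s: "(\<Sum>v\<in>supp p - {u}. p v) = 1 - p u" using pointsD[OF p] u by (simp add: sum_diff1)
  also have "\<bar>1 - p u\<bar> = 1 - p u" using s pointsD(1)[OF p] by (metis abs_of_nonneg sum_nonneg)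
  finally show ?thesis by simp
qed

lemma seg_length_lin: "u \<noteq> v \<Longrightarrow> seg_length (lin u v s) (lin u v t) = \<bar>s - t\<bar>"
  by (subst seg_length_superset[where S = "{u, v}"]) (auto simp: supp_lin, auto simp: lin_def vpt_def abs_minus_commute)

lemma pl_length_Cons: "ps \<noteq> [] \<Longrightarrow> pl_length (p # ps) = seg_length p (hd ps) + pl_length ps"
  by (cases ps) (auto simp: pl_length_def sum.lessThan_Suc_shift simp del: sum.lessThan_Suc)

lemma pl_length_nonneg: "0 \<le> pl_length ps"
  by (simp add: pl_length_def sum_nonneg seg_length_nonneg)

definition joined :: "'a set set \<Rightarrow> ('a \<Rightarrow> real) \<Rightarrow> ('a \<Rightarrow> real) \<Rightarrow> real \<Rightarrow> bool" where
  "joined X p q c \<longleftrightarrow> (\<exists>ps. pl_path X ps \<and> hd ps = p \<and> last ps = q \<and> pl_length ps \<le> c)"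

lemma joined_refl: "p \<in> points (skel1 X) \<Longrightarrow> joined X p p 0"
  unfolding joined_def by (intro exI[of _ "[p]"]) (simp add: pl_path_def pl_length_def)

lemma joined_step:
  assumes "joined X q r c" "p \<in> points (skel1 X)" "supp p \<union> supp q \<in> skel1 X"
  shows "joined X p r (seg_length p q + c)"
proof -
  obtain ps where ps: "pl_path X ps" "hd ps = q" "last ps = r" "pl_length ps \<le> c" using assms by (auto simp: joined_def)
  then have ne: "ps \<noteq> []" by (simp add: pl_path_def)
  have "pl_path X (p # ps)" using ps ne assms by (cases ps) (auto simp: pl_path_def)
  moreover have "pl_length (p # ps) \<le> seg_length p q + c" using ps ne by (simp add: pl_length_Cons)
  ultimately show ?thesis unfolding joined_def using ps ne by (intro exI[of _ "p # ps"]) auto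
qed

lemma path_dist_le:
  assumes "joined X p q c" shows "path_dist X p q \<le> c"
proof -
  obtain ps where ps: "pl_path X ps" "hd ps = p" "last ps = q" "pl_length ps \<le> c" using assms by (auto simp: joined_def)
  have "path_dist X p q \<le> pl_length ps" unfolding path_dist_def
    using ps pl_length_nonneg by (intro cInf_lower) (auto intro!: bdd_belowI2)
  then show ?thesis using ps by simp
qed

text \<open>The first premise provides a path, so that the infimum is taken over a nonempty
  set.\<close>

lemma path_dist_ge:
  assumes "joined X p q c'" and "\<And>ps. pl_path X ps \<Longrightarrow> hd ps = p \<Longrightarrow> last ps = q \<Longrightarrow> c \<le> pl_length ps"
  shows "c \<le> path_dist X p q"
  unfolding path_dist_def using assms by (intro cInf_greatest) (auto simp: joined_def)

text \<open>Lower bounds for path lengths come from functions that are 1-Lipschitz on every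
  edge.\<close>

lemma pl_path_lipschitz:
  assumes lip: "\<And>p q. p \<in> points (skel1 X) \<Longrightarrow> q \<in> points (skel1 X) \<Longrightarrow> supp p \<union> supp q \<in> skel1 X \<Longrightarrow> f q \<le> f p + seg_length p q"
  shows "pl_path X ps \<Longrightarrow> f (last ps) \<le> f (hd ps) + pl_length ps"
proof (induction ps)
  case (Cons p ps)
  show ?case
  proof (cases "ps = []")
    case False
    then have "pl_path X ps" "f (hd ps) \<le> f p + seg_length p (hd ps)"
      using Cons.prems lip[of p "hd ps"] by (cases ps; auto simp: pl_path_def)+
    then show ?thesis using Cons.IH False by (simp add: pl_length_Cons)
  qed (simp add: pl_length_nonneg)
qed (simp add: pl_path_def)

section \<open>The edge distance in a connected complex\<close>

locale connected_complex =
  fixes X :: "'a set set"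
  assumes cpx: "is_complex X" and conn: "complex_connected X"
begin

abbreviation "V \<equiv> verts X"
abbreviation "E \<equiv> {(x, y). {x, y} \<in> X}"
abbreviation "d \<equiv> gdist X"
abbreviation "P \<equiv> points (skel1 X)"

lemma simplex_face: "s \<in> X \<Longrightarrow> t \<noteq> {} \<Longrightarrow> t \<subseteq> s \<Longrightarrow> t \<in> X"
  using cpx unfolding is_complex_def by blast

lemma simplex_vertex: "s \<in> X \<Longrightarrow> v \<in> s \<Longrightarrow> v \<in> V"
  by (auto simp: verts_def)

lemma vertex_simplex: "v \<in> V \<Longrightarrow> {v} \<in> X"
  unfolding verts_def using simplex_face by blast

lemma edge_skel1: "{u, v} \<in> X \<Longrightarrow> {u, v} \<in> skel1 X"
  by (simp add: skel1_def card_insert_if)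

lemma skel1_face: "s \<in> skel1 X \<Longrightarrow> t \<noteq> {} \<Longrightarrow> t \<subseteq> s \<Longrightarrow> t \<in> skel1 X"
proof -
  assume s: "s \<in> skel1 X" and t: "t \<noteq> {}" "t \<subseteq> s"
  then have "finite s" using cpx by (auto simp: skel1_def is_complex_def)
  then have "card t \<le> card s" using t by (intro card_mono)
  then show "t \<in> skel1 X" using s t simplex_face[of s t] by (auto simp: skel1_def)
qed

lemma gdist_le: "(u, v) \<in> E ^^ n \<Longrightarrow> d u v \<le> n"
  unfolding gdist_def by (rule Least_le)

lemma gdist_path:
  assumes "u \<in> V" "v \<in> V" shows "(u, v) \<in> E ^^ d u v"
proof -
  have "(u, v) \<in> E\<^sup>*" using conn assms by (auto simp: complex_connected_def)
  then obtain n where "(u, v) \<in> E ^^ n" using rtrancl_imp_relpow by blast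
  then show ?thesis unfolding gdist_def by (rule LeastI)
qed

lemma path_verts: "(u, v) \<in> E ^^ n \<Longrightarrow> u \<in> V \<Longrightarrow> v \<in> V"
  by (cases n) (auto simp: verts_def)

lemma gdist_eq_0: "u \<in> V \<Longrightarrow> v \<in> V \<Longrightarrow> d u v = 0 \<longleftrightarrow> u = v"
  using gdist_path[of u v] gdist_le[of u u 0] by auto

lemma gdist_tri: "u \<in> V \<Longrightarrow> v \<in> V \<Longrightarrow> w \<in> V \<Longrightarrow> d u w \<le> d u v + d v w"
  using gdist_path[of u v] gdist_path[of v w] by (intro gdist_le) (auto simp: relpow_add)

lemma path_sym: "(u, v) \<in> E ^^ n \<Longrightarrow> (v, u) \<in> E ^^ n"
proof (induction n arbitrary: u)
  case (Suc n)
  then obtain w where "(u, w) \<in> E" "(w, v) \<in> E ^^ n" by (meson relpow_Suc_D2)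
  then have "(v, w) \<in> E ^^ n" "(w, u) \<in> E" using Suc.IH by (auto simp: insert_commute)
  then show ?case by (rule relpow_Suc_I)
qed simp

lemma gdist_sym: "u \<in> V \<Longrightarrow> v \<in> V \<Longrightarrow> d u v = d v u"
  using gdist_path path_sym gdist_le by (metis le_antisym)

lemma gdist_geo:
  assumes V: "u \<in> V" "v \<in> V" and k: "k \<le> d u v"
  shows "\<exists>w\<in>V. d u w = k \<and> d w v = d u v - k"
proof -
  have "(u, v) \<in> E ^^ (k + (d u v - k))" using gdist_path[OF V] k by simp
  then obtain w where w: "(u, w) \<in> E ^^ k" "(w, v) \<in> E ^^ (d u v - k)" unfolding relpow_add by blast
  then have wV: "w \<in> V" using path_verts V by blast
  have "d u w \<le> k" "d w v \<le> d u v - k" using w gdist_le by blast+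
  moreover have "d u v \<le> d u w + d w v" using gdist_tri V wV by blast
  ultimately show ?thesis using k wV by (intro bexI[of _ w]) auto
qed

lemma gdist_edge: "{u, v} \<in> X \<Longrightarrow> d u v \<le> 1"
  by (rule gdist_le) simp

lemma gdist_1_edge: "u \<in> V \<Longrightarrow> v \<in> V \<Longrightarrow> d u v \<le> 1 \<Longrightarrow> {u, v} \<in> X"
  using gdist_path[of u v] vertex_simplex by (cases "d u v") auto

lemma gdist_edge_diff:
  assumes "{u, v} \<in> X" "a \<in> V" shows "d a u \<le> d a v + 1"
proof -
  have V: "u \<in> V" "v \<in> V" using assms simplex_vertex by blast+
  have "d v u \<le> 1" using gdist_edge assms by (simp add: insert_commute)
  then show ?thesis using gdist_tri[OF assms(2) V(2,1)] by linarith
qed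

lemma vpt_point: "v \<in> V \<Longrightarrow> vpt v \<in> P"
  using edge_skel1[of v v] vertex_simplex by (auto simp: points_def vpt_def[abs_def] supp_vpt[unfolded vpt_def[abs_def]])

lemma point_skel1_points: "p \<in> P \<Longrightarrow> supp p \<in> X"
  using pointsD(2) by (auto simp: skel1_def)

section \<open>The distance from a vertex to a point\<close>

text \<open>For a point \<open>p\<close> of an edge, \<open>1 - p u\<close> is its distance from the
  end \<open>u\<close>. So this is the length of a shortest way from \<open>a\<close> to
  \<open>p\<close> through an end of the edge of \<open>p\<close>, the candidate for the path
  distance.\<close>

definition ell :: "'a \<Rightarrow> ('a \<Rightarrow> real) \<Rightarrow> real" where
  "ell a p = Min ((\<lambda>u. real (d a u) + 1 - p u) ` supp p)"

lemma ell_attained: "p \<in> P \<Longrightarrow> \<exists>u\<in>supp p. ell a p = real (d a u) + 1 - p u"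
  using Min_in[of "(\<lambda>u. real (d a u) + 1 - p u) ` supp p"] pointsD(4,5) unfolding ell_def by blast

lemma ell_le: "p \<in> P \<Longrightarrow> u \<in> supp p \<Longrightarrow> ell a p \<le> real (d a u) + 1 - p u"
  unfolding ell_def using pointsD(4) by (intro Min_le) auto

lemma ell_vpt [simp]: "ell a (vpt v) = real (d a v)"
  by (simp add: ell_def) (simp add: vpt_def)

lemma ell_lipschitz:
  assumes a: "a \<in> V" and p: "p \<in> P" and q: "q \<in> P" and S: "supp p \<union> supp q \<in> skel1 X"
  shows "ell a q \<le> ell a p + seg_length p q"
proof -
  obtain u where u: "u \<in> supp p" "ell a p = real (d a u) + 1 - p u" using ell_attained p by blast
  have c: "\<bar>p u - q u\<bar> \<le> seg_length p q" by (rule coordinate_le_seg_length[OF p q])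
  show ?thesis
  proof (cases "u \<in> supp q")
    case True
    then show ?thesis using ell_le[OF q True, of a] u c by linarith
  next
    case False
    then have qu: "q u = 0" by (simp add: supp_def)
    obtain v where v: "v \<in> supp q" using pointsD(5)[OF q] by blast
    have fin: "finite (supp p \<union> supp q)" using pointsD(4) p q by blast
    have uv: "u \<noteq> v" using v False by blast
    \<comment> \<open>An edge has only two vertices, so \<open>q\<close> must be its other end
      \<open>v\<close>, and moving from \<open>p\<close> to \<open>q\<close> changes the coordinate
      of \<open>u\<close> by all of \<open>p u\<close>.\<close>
    have eq: "{u, v} = supp p \<union> supp q"
      using S u v uv fin by (intro card_seteq) (auto simp: skel1_def)
    then have "supp q \<subseteq> {u, v}" by simp
    then have "supp q = {v}" using False v by blast
    then have "q v = 1" using pointsD(3)[OF q] by simp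
    then have "ell a q \<le> real (d a v)" using ell_le[OF q v, of a] by simp
    moreover have "{v, u} \<in> X" using eq S by (simp add: skel1_def insert_commute)
    then have "d a v \<le> d a u + 1" using gdist_edge_diff a by blast
    ultimately show ?thesis using u c qu by linarith
  qed
qed

lemma joined_vpt_point:
  assumes p: "p \<in> P" and u: "u \<in> supp p"
  shows "a \<in> V \<Longrightarrow> (a, u) \<in> E ^^ n \<Longrightarrow> joined X (vpt a) p (real n + 1 - p u)"
proof (induction n arbitrary: a)
  case 0
  then have au: "a = u" "u \<in> V" by auto
  have "joined X (vpt u) p (seg_length (vpt u) p + 0)"
    using joined_refl[OF p] vpt_point[OF au(2)] pointsD(2)[OF p] u by (intro joined_step) (auto simp: insert_absorb)
  then show ?case using seg_length_vpt[OF p u] au by simp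
next
  case (Suc n)
  then obtain w where w: "(a, w) \<in> E" "(w, u) \<in> E ^^ n" by (meson relpow_Suc_D2)
  then have wV: "w \<in> V" "{a, w} \<in> X" by (auto simp: verts_def)
  have st: "joined X (vpt a) p (seg_length (vpt a) (vpt w) + (real n + 1 - p u))"
    using Suc.IH[OF wV(1) w(2)] vpt_point[OF Suc.prems(1)] edge_skel1[OF wV(2)]
    by (intro joined_step) (auto simp: insert_commute)
  have "seg_length (vpt a) (vpt w) \<le> 1"
    using seg_length_lin[of a w 0 1] by (cases "a = w") (auto simp: seg_length_def)
  then show ?case using st unfolding joined_def by force
qed

text \<open>An edge path to the best end of the edge gives the upper bound, the Lipschitz function
  \<open>ell a\<close> the lower one.\<close>

lemma path_dist_vpt:
  assumes a: "a \<in> V" and p: "p \<in> P"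
  shows "path_dist X (vpt a) p = ell a p"
proof -
  obtain u where u: "u \<in> supp p" "ell a p = real (d a u) + 1 - p u" using ell_attained p by blast
  have "u \<in> V" using u point_skel1_points[OF p] simplex_vertex by blast
  then have J: "joined X (vpt a) p (ell a p)" using joined_vpt_point[OF p u(1) a gdist_path[OF a]] u by simp
  have "ell a p \<le> path_dist X (vpt a) p"
  proof (rule path_dist_ge[OF J])
    fix ps assume "pl_path X ps" "hd ps = vpt a" "last ps = p"
    then show "ell a p \<le> pl_length ps"
      using pl_path_lipschitz[of X "ell a" ps] ell_lipschitz[OF a] gdist_eq_0[OF a a] by simp
  qed
  then show ?thesis using path_dist_le[OF J] by simp
qed

lemma path_dist_vpt_vpt: "a \<in> V \<Longrightarrow> b \<in> V \<Longrightarrow> path_dist X (vpt a) (vpt b) = real (d a b)"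
  using path_dist_vpt vpt_point by simp

lemma points_joined:
  assumes p: "p \<in> P" and q: "q \<in> P" shows "\<exists>c. joined X p q c"
proof -
  obtain u where u: "u \<in> supp p" using pointsD(5)[OF p] by blast
  obtain v where v: "v \<in> supp q" using pointsD(5)[OF q] by blast
  have V: "u \<in> V" "v \<in> V" using u v point_skel1_points p q simplex_vertex by blast+
  have "joined X p q (seg_length p (vpt u) + (real (d u v) + 1 - q v))"
    using joined_vpt_point[OF q v V(1) gdist_path[OF V]] p u pointsD(2)[OF p]
    by (intro joined_step) (auto simp: insert_absorb Un_commute)
  then show ?thesis by blast
qed

lemma path_dist_nonneg: "p \<in> P \<Longrightarrow> q \<in> P \<Longrightarrow> 0 \<le> path_dist X p q"
  using points_joined path_dist_ge pl_length_nonneg by metis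

lemma ell_le_path_dist:
  assumes "a \<in> V" "p \<in> P" "q \<in> P" shows "ell a q - ell a p \<le> path_dist X p q"
proof -
  obtain c where "joined X p q c" using points_joined assms by blast
  then show ?thesis
  proof (rule path_dist_ge)
    fix ps assume "pl_path X ps" "hd ps = p" "last ps = q"
    then show "ell a q - ell a p \<le> pl_length ps"
      using pl_path_lipschitz[of X "ell a" ps] ell_lipschitz[OF assms(1)] by simp
  qed
qed

lemma lin_point:
  assumes "{u, v} \<in> X" "u \<noteq> v" "0 \<le> t" "t \<le> 1" shows "lin u v t \<in> P"
proof -
  have "supp (lin u v t) \<in> skel1 X"
    using skel1_face[OF edge_skel1[OF assms(1)]] supp_lin[OF assms(2), of t] by auto
  moreover have "0 \<le> lin u v t w" for w using assms by (simp add: lin_def vpt_def)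
  moreover have "(\<Sum>w\<in>supp (lin u v t). lin u v t w) = (\<Sum>w\<in>{u, v}. lin u v t w)"
    using assms by (intro sum.mono_neutral_left) (auto simp: supp_def lin_def vpt_def)
  moreover have "(\<Sum>w\<in>{u, v}. lin u v t w) = 1" using assms by (simp add: lin_def vpt_def)
  ultimately show ?thesis by (simp add: points_def)
qed

lemma ell_lin:
  assumes e: "{u, v} \<in> X" "u \<noteq> v" and t: "0 \<le> t" "t \<le> 1" and a: "a \<in> V"
  shows "ell a (lin u v t) = min (real (d a u) + t) (real (d a v) + 1 - t)"
proof -
  have "d a u \<le> d a v + 1" "d a v \<le> d a u + 1" using gdist_edge_diff[of u v a] gdist_edge_diff[of v u a] e a by (auto simp: insert_commute)
  moreover have "lin u v t u = 1 - t" "lin u v t v = t" using e by (auto simp: lin_def vpt_def)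
  ultimately show ?thesis using e t by (auto simp: ell_def supp_lin min_def)
qed

end

section \<open>Polygons along edge geodesics\<close>

locale edge_geodesic = connected_complex +
  fixes f n
  assumes fV: "i \<le> n \<Longrightarrow> f i \<in> V" and step: "i < n \<Longrightarrow> {f i, f (Suc i)} \<in> X" and len: "d (f 0) (f n) = n"
begin

text \<open>Each part of the edge path has length at most its number of edges, and the total
  distance \<open>n\<close> leaves no slack.\<close>

lemma f_dist: assumes "i \<le> j" "j \<le> n" shows "d (f i) (f j) = j - i"
proof -
  have up: "j \<le> n \<Longrightarrow> d (f i) (f j) \<le> j - i" if "i \<le> j" for i j
    using that
  proof (induction j rule: dec_induct)
    case base then show ?case using gdist_eq_0 fV by simp
  next
    case (step k)
    have "d (f k) (f (Suc k)) \<le> 1" using gdist_edge edge_geodesic.step[OF edge_geodesic_axioms, of k] step by simp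
    then show ?case using gdist_tri[of "f i" "f k" "f (Suc k)"] fV step by (simp add: Suc_diff_le)
  qed
  have "n \<le> d (f 0) (f i) + (d (f i) (f j) + d (f j) (f n))"
    using gdist_tri[of "f 0" "f i" "f n"] gdist_tri[of "f i" "f j" "f n"] fV[of 0] fV[of i] fV[of j] fV[of n] assms len by simp
  then show ?thesis using up[of 0 i] up[of i j] up[of j n] assms by simp
qed

lemma f_neq: "i < n \<Longrightarrow> f i \<noteq> f (Suc i)"
  using f_dist[of i "Suc i"] gdist_eq_0[of "f i" "f (Suc i)"] fV[of i] fV[of "Suc i"] by auto

lemma edge_cases:
  assumes "0 \<le> t" "t \<le> real n" "0 < n"
  obtains i where "i < n" "real i \<le> t" "t \<le> real i + 1"
proof (cases "t = real n")
  case True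
  then show ?thesis using that[of "n - 1"] assms by simp
next
  case False
  have "real (nat \<lfloor>t\<rfloor>) \<le> t" "t \<le> real (nat \<lfloor>t\<rfloor>) + 1" using assms by linarith+
  then show ?thesis using that[of "nat \<lfloor>t\<rfloor>"] assms False by linarith
qed

lemma polygon_point:
  assumes t: "0 \<le> t" "t \<le> real n" shows "polygon f t \<in> P"
proof (cases "n = 0")
  case True
  then show ?thesis using t polygon_nat[of f 0] vpt_point fV by simp
next
  case False
  then obtain i where i: "i < n" "real i \<le> t" "t \<le> real i + 1" using edge_cases t by blast
  then show ?thesis unfolding polygon_edge[OF i(2,3)] using step f_neq by (intro lin_point) auto
qed

lemma ell_polygon:
  assumes t: "0 \<le> t" "t \<le> real n" shows "ell (f 0) (polygon f t) = t" "ell (f n) (polygon f t) = real n - t"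
proof -
  have "ell (f 0) (polygon f t) = t \<and> ell (f n) (polygon f t) = real n - t"
  proof (cases "n = 0")
    case True
    then show ?thesis using t polygon_nat[of f 0] fV gdist_eq_0 by simp
  next
    case False
    then obtain i where i: "i < n" "real i \<le> t" "t \<le> real i + 1" using edge_cases t by blast
    have "d (f 0) (f i) = i" "d (f 0) (f (Suc i)) = Suc i" using f_dist[of 0 i] f_dist[of 0 "Suc i"] i by auto
    moreover have "d (f n) (f i) = n - i" "d (f n) (f (Suc i)) = n - Suc i"
      using f_dist[of i n] f_dist[of "Suc i" n] i gdist_sym fV by auto
    ultimately show ?thesis unfolding polygon_edge[OF i(2,3)]
      using ell_lin[OF step[OF i(1)] f_neq[OF i(1)], of "t - real i"] fV i by (auto simp: min_def of_nat_diff)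
  qed
  then show "ell (f 0) (polygon f t) = t" "ell (f n) (polygon f t) = real n - t" by auto
qed

lemma polygon_joined:
  assumes s: "0 \<le> s" "s \<le> t" "t \<le> real n" shows "joined X (polygon f s) (polygon f t) (t - s)"
  using s
proof (induction "n - nat \<lfloor>s\<rfloor>" arbitrary: s rule: less_induct)
  case less
  show ?case
  proof (cases "s = t")
    case True
    then show ?thesis using joined_refl[OF polygon_point[of t]] less.prems by simp
  next
    case False
    define i where "i = nat \<lfloor>s\<rfloor>"
    \<comment> \<open>The next stop: the end of the current edge, or \<open>t\<close> if that comes
      first.\<close>
    define r where "r = min t (real i + 1)"
    have i: "real i \<le> s" "s < real i + 1" "i < n" using less.prems False unfolding i_def by linarith+
    have r: "real i \<le> r" "r \<le> real i + 1" "s < r" "r \<le> t" using i less.prems False by (auto simp: r_def)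
    have J: "joined X (polygon f r) (polygon f t) (t - r)"
    proof (cases "r = t")
      case True
      then show ?thesis using joined_refl[OF polygon_point[of t]] less.prems by simp
    next
      case False
      then have "r = real i + 1" by (auto simp: r_def min_def split: if_splits)
      then have "nat \<lfloor>r\<rfloor> = i + 1" by linarith
      then show ?thesis using less.hyps[of r] i r less.prems by (simp add: i_def)
    qed
    have ps: "polygon f s = lin (f i) (f (Suc i)) (s - real i)" "polygon f r = lin (f i) (f (Suc i)) (r - real i)"
      using i r by (intro polygon_edge; linarith)+
    have sub: "supp (polygon f s) \<union> supp (polygon f r) \<subseteq> {f i, f (Suc i)}"
      unfolding ps supp_lin[OF f_neq[OF i(3)]] by auto
    have P: "polygon f s \<in> P" using polygon_point less.prems by simp
    then have "supp (polygon f s) \<union> supp (polygon f r) \<in> skel1 X"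
      using pointsD(5)[OF P] by (intro skel1_face[OF edge_skel1[OF step[OF i(3)]] _ sub]) auto
    then have "joined X (polygon f s) (polygon f t) (seg_length (polygon f s) (polygon f r) + (t - r))"
      using J P by (intro joined_step) auto
    then show ?thesis unfolding ps seg_length_lin[OF f_neq[OF i(3)]] using r by simp
  qed
qed

text \<open>The polygon itself bounds the distance from above. From below, \<open>ell\<close> is
  used at \<open>f 0\<close> for increasing and at \<open>f n\<close> for decreasing parameters; in
  the latter case the path is reversed.\<close>

lemma polygon_path_dist:
  assumes s: "0 \<le> s" "s \<le> real n" and t: "0 \<le> t" "t \<le> real n"
  shows "path_dist X (polygon f s) (polygon f t) = \<bar>s - t\<bar>"
proof -
  have P: "polygon f s \<in> P" "polygon f t \<in> P" using polygon_point s t by auto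
  show ?thesis
  proof (cases "s \<le> t")
    case True
    have "path_dist X (polygon f s) (polygon f t) \<le> t - s" using path_dist_le polygon_joined s t True by blast
    moreover have "t - s \<le> path_dist X (polygon f s) (polygon f t)"
      using ell_le_path_dist[OF fV[of 0] P] ell_polygon s t by simp
    ultimately show ?thesis using True by simp
  next
    case False
    have rev: "joined X (polygon f s) (polygon f t) (s - t)"
    proof -
      obtain ps where ps: "pl_path X ps" "hd ps = polygon f t" "last ps = polygon f s" "pl_length ps \<le> s - t"
        using polygon_joined[of t s] s t False by (auto simp: joined_def)
      have "pl_path X (rev ps)" using ps(1) by (auto simp: pl_path_def successively_rev Un_commute elim!: successively_mono)
      moreover have "pl_length (rev ps) = pl_length ps"
        unfolding pl_length_def
        by (rule sum.reindex_bij_witness[of _ "\<lambda>i. length ps - 2 - i" "\<lambda>i. length ps - 2 - i"])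
           (auto simp: rev_nth seg_length_commute Suc_diff_Suc numeral_2_eq_2)
      ultimately show ?thesis using ps unfolding joined_def
        by (intro exI[of _ "rev ps"]) (auto simp: hd_rev last_rev pl_path_def)
    qed
    then have "path_dist X (polygon f s) (polygon f t) \<le> s - t" by (rule path_dist_le)
    moreover have "s - t \<le> path_dist X (polygon f s) (polygon f t)"
      using ell_le_path_dist[OF fV[of n] P] ell_polygon s t by simp
    ultimately show ?thesis using False by simp
  qed
qed

lemma polygon_Geod: "polygon f \<in> Geod X (vpt (f 0)) (vpt (f n))"
proof -
  have "path_dist X (vpt (f 0)) (vpt (f n)) = real n" using path_dist_vpt_vpt fV len by simp
  then show ?thesis using polygon_point polygon_path_dist polygon_nat[of f 0]
    by (auto simp: Geod_def)
qed

lemma polygon_mem_image: "0 \<le> t \<Longrightarrow> t \<le> real n \<Longrightarrow> polygon f t \<in> geod_image X (vpt (f 0)) (vpt (f n)) (polygon f)"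
  using path_dist_vpt_vpt fV len by (simp add: geod_image_def)

end

section \<open>Transfer between the 1-skeleton and the vertices\<close>

context connected_complex
begin

lemma geodesic_through:
  assumes V: "u \<in> V" "v \<in> V" "w \<in> V" and on: "d u w + d w v = d u v"
  obtains f where "edge_geodesic X f (d u v)" "f 0 = u" "f (d u v) = v" "f (d u w) = w"
proof -
  obtain f where f: "f 0 = u" "f (d u w) = w" "\<And>i. i < d u w \<Longrightarrow> {f i, f (Suc i)} \<in> X"
    using gdist_path[OF V(1,3)] unfolding relpow_fun_conv by blast
  obtain g where g: "g 0 = w" "g (d w v) = v" "\<And>i. i < d w v \<Longrightarrow> {g i, g (Suc i)} \<in> X"
    using gdist_path[OF V(3,2)] unfolding relpow_fun_conv by blast
  define h where "h = (\<lambda>i. if i \<le> d u w then f i else g (i - d u w))"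
  have "h (d u v) = v"
  proof (cases "d w v = 0")
    case True
    then have "d u v = d u w" "w = v" using on g(1,2) by auto
    then show ?thesis using f(2) by (simp add: h_def)
  next
    case False
    then have "\<not> d u v \<le> d u w" "d u v - d u w = d w v" using on by linarith+
    then show ?thesis using g(2) by (simp add: h_def)
  qed
  then have h: "h 0 = u" "h (d u v) = v" "h (d u w) = w" using f by (auto simp: h_def)
  have step: "{h i, h (Suc i)} \<in> X" if "i < d u v" for i
  proof -
    consider "i < d u w" | "i = d u w" | "d u w < i" by linarith
    then show ?thesis
    proof cases
      case 1 then show ?thesis using f by (simp add: h_def)
    next
      case 2 then show ?thesis using f g(3)[of 0] g(1) on that by (simp add: h_def)
    next
      case 3 then show ?thesis using g(3)[of "i - d u w"] on that by (simp add: h_def Suc_diff_le)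
    qed
  qed
  have "h i \<in> V" if "i \<le> d u v" for i
  proof (cases "i = d u v")
    case True then show ?thesis using h V by simp
  next
    case False then show ?thesis using step[of i] simplex_vertex that by auto
  qed
  then have "edge_geodesic X h (d u v)"
    using step h by unfold_locales auto
  then show ?thesis using that h by blast
qed

text \<open>The three Gromov products may be half-integers, so the internal points are taken on the
  polygons. The two sides at the corner \<open>x\<close> are chosen through \<open>p\<close> and
  \<open>q\<close>.\<close>

lemma fine_triangles_vertices:
  assumes fine: "fine_triangles X \<epsilon>" and V: "x \<in> V" "y \<in> V" "z \<in> V" "p \<in> V" "q \<in> V"
    and p: "d x p + d p y = d x y" and q: "d x q + d q z = d x z" and pq: "d x p = d x q"
    and le: "2 * d x p + d y z \<le> d x y + d x z"
  shows "real (d p q) \<le> \<epsilon>"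
proof -
  have s: "d z y = d y z" "d y x = d x y" "d z x = d x z" "d p x = d x p" "d y p = d p y" using gdist_sym V by auto
  \<comment> \<open>The side opposite to \<open>x\<close> may be any geodesic; the trivial point
    \<open>z\<close> on it suffices.\<close>
  have "d z z + d z y = d z y" using gdist_eq_0[OF V(3,3)] by simp
  then obtain f where f: "edge_geodesic X f (d z y)" "f 0 = z" "f (d z y) = y"
    using geodesic_through[OF V(3,2,3)] by blast
  have "d y p + d p x = d y x" using p s by simp
  then obtain g where g: "edge_geodesic X g (d y x)" "g 0 = y" "g (d y x) = x" "g (d y p) = p"
    using geodesic_through[OF V(2,1,4)] by blast
  obtain h where h: "edge_geodesic X h (d x z)" "h 0 = x" "h (d x z) = z" "h (d x q) = q"
    using geodesic_through[OF V(1,3,5) q] by blast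
  interpret f: edge_geodesic X f "d z y" by (rule f(1))
  interpret g: edge_geodesic X g "d y x" by (rule g(1))
  interpret h: edge_geodesic X h "d x z" by (rule h(1))
  define gx where "gx = (real (d x y) + real (d x z) - real (d y z)) / 2"
  define gy where "gy = (real (d x y) + real (d y z) - real (d x z)) / 2"
  define gz where "gz = (real (d x z) + real (d y z) - real (d x y)) / 2"
  have t: "d x y \<le> d x z + d y z" "d x z \<le> d x y + d y z" "d y z \<le> d x y + d x z"
    using gdist_tri[of x z y] gdist_tri[of x y z] gdist_tri[of y x z] V s by auto
  have r: "0 \<le> gx" "gx \<le> real (d x z)" "0 \<le> gy" "gy \<le> real (d y x)" "0 \<le> gz" "gz \<le> real (d z y)"
    "real (d y x) - gy = gx" "real (d x z) - gx = gz" "real (d z y) - gz = gy"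
    using t s unfolding gx_def gy_def gz_def by (auto simp: field_simps)
  note pd = path_dist_vpt[OF V(1)] path_dist_vpt[OF V(2)] path_dist_vpt[OF V(3)]
  have F: "polygon f gz \<in> P" "ell z (polygon f gz) = gz" "ell y (polygon f gz) = gy"
    "polygon f gz \<in> geod_image X (vpt z) (vpt y) (polygon f)"
    using f.polygon_point f.ell_polygon f.polygon_mem_image f r by auto
  have G: "polygon g gy \<in> P" "ell y (polygon g gy) = gy" "ell x (polygon g gy) = gx"
    "polygon g gy \<in> geod_image X (vpt y) (vpt x) (polygon g)"
    using g.polygon_point g.ell_polygon g.polygon_mem_image g r by auto
  have H: "polygon h gx \<in> P" "ell x (polygon h gx) = gx" "ell z (polygon h gx) = gz"
    "polygon h gx \<in> geod_image X (vpt x) (vpt z) (polygon h)"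
    using h.polygon_point h.ell_polygon h.polygon_mem_image h r by auto
  have pm: "vpt p \<in> geod_image X (vpt y) (vpt x) (polygon g)"
    using g.polygon_mem_image[of "real (d y p)"] g p s by simp
  have qm: "vpt q \<in> geod_image X (vpt x) (vpt z) (polygon h)"
    using h.polygon_mem_image[of "real (d x q)"] h q by simp
  have geod: "polygon f \<in> Geod X (vpt z) (vpt y)" "polygon g \<in> Geod X (vpt y) (vpt x)" "polygon h \<in> Geod X (vpt x) (vpt z)"
    using f.polygon_Geod g.polygon_Geod h.polygon_Geod f g h by auto
  have "path_dist X (vpt x) (polygon g gy) = path_dist X (vpt x) (polygon h gx) \<and>
      path_dist X (vpt z) (polygon f gz) = path_dist X (vpt z) (polygon h gx) \<and>
      path_dist X (vpt y) (polygon f gz) = path_dist X (vpt y) (polygon g gy)"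
    using F G H by (simp add: pd)
  moreover have "path_dist X (vpt x) (vpt p) = path_dist X (vpt x) (vpt q) \<and>
      path_dist X (vpt x) (vpt q) \<le> path_dist X (vpt x) (polygon g gy)"
    using G pq le V by (simp add: pd vpt_point gx_def)
  ultimately have "path_dist X (vpt p) (vpt q) \<le> \<epsilon>"
    using fine[unfolded fine_triangles_def, rule_format, OF vpt_point[OF V(1)] vpt_point[OF V(3)] vpt_point[OF V(2)]
      geod F(4) G(4) H(4) _ pm qm] by blast
  then show ?thesis using path_dist_vpt_vpt V by simp
qed

text \<open>At an integer time \<open>i\<close> the distance \<open>d a u + 1 - p u\<close> to the
  point \<open>p\<close> reached is an integer. So the coordinate \<open>p u\<close> is an integer
  in the interval (0, 1], hence 1, and the geodesic is at a vertex.\<close>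

lemma Geod_vertices:
  assumes V: "a \<in> V" "b \<in> V" and \<alpha>: "\<alpha> \<in> Geod X (vpt a) (vpt b)"
  obtains f where "\<And>i. i \<le> d a b \<Longrightarrow> f i \<in> V \<and> d a (f i) = i \<and> d (f i) b = d a b - i"
    "\<And>i j. i \<le> j \<Longrightarrow> j \<le> d a b \<Longrightarrow> d (f i) (f j) = j - i"
    "\<And>i. i \<le> d a b \<Longrightarrow> vpt (f i) \<in> geod_image X (vpt a) (vpt b) \<alpha>"
    "f 0 = a" "f (d a b) = b"
proof -
  have n: "path_dist X (vpt a) (vpt b) = real (d a b)" using path_dist_vpt_vpt V by simp
  have pt: "\<alpha> t \<in> P" if "0 \<le> t" "t \<le> real (d a b)" for t using \<alpha> that by (auto simp: Geod_def n)
  have dist: "path_dist X (\<alpha> s) (\<alpha> t) = \<bar>s - t\<bar>" if "0 \<le> s" "s \<le> real (d a b)" "0 \<le> t" "t \<le> real (d a b)" for s t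
    using \<alpha> that by (auto simp: Geod_def n)
  have ends: "\<alpha> 0 = vpt a" "\<alpha> (real (d a b)) = vpt b" using \<alpha> by (auto simp: Geod_def n)
  have "\<exists>v\<in>V. \<alpha> (real i) = vpt v" if i: "i \<le> d a b" for i
  proof -
    have p: "\<alpha> (real i) \<in> P" using pt i by simp
    obtain u where u: "u \<in> supp (\<alpha> (real i))" "ell a (\<alpha> (real i)) = real (d a u) + 1 - \<alpha> (real i) u"
      using ell_attained[OF p] by blast
    have "ell a (\<alpha> (real i)) = real i" using dist[of 0 "real i"] i path_dist_vpt[OF V(1) p] ends by simp
    then have "real_of_int (int (d a u) + 1 - int i) = \<alpha> (real i) u" using u by simp
    then obtain z :: int where e: "real_of_int z = \<alpha> (real i) u" by blast
    have "0 < \<alpha> (real i) u" using u(1) pointsD(1)[OF p, of u] by (auto simp: supp_def less_le)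
    moreover have "\<alpha> (real i) u \<le> (\<Sum>v\<in>supp (\<alpha> (real i)). \<alpha> (real i) v)"
      using u(1) pointsD(1,4)[OF p] by (intro member_le_sum) auto
    then have "\<alpha> (real i) u \<le> 1" using pointsD(3)[OF p] by simp
    ultimately have "z = 1" unfolding e[symmetric] by linarith
    then have "\<alpha> (real i) u = 1" using e by simp
    then show ?thesis using point_eq_vpt[OF p] u(1) point_skel1_points[OF p] simplex_vertex by blast
  qed
  then have "\<exists>f. \<forall>i. i \<le> d a b \<longrightarrow> f i \<in> V \<and> \<alpha> (real i) = vpt (f i)" by (intro choice) blast
  then obtain f where f: "\<And>i. i \<le> d a b \<Longrightarrow> f i \<in> V \<and> \<alpha> (real i) = vpt (f i)" by blast
  have ff: "d (f i) (f j) = j - i" if "i \<le> j" "j \<le> d a b" for i j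
  proof -
    have "real (d (f i) (f j)) = \<bar>real i - real j\<bar>"
      using dist[of "real i" "real j"] f[of i] f[of j] that path_dist_vpt_vpt[of "f i" "f j"] by simp
    then show ?thesis using that by linarith
  qed
  have f0: "f 0 = a" "f (d a b) = b" using f[of 0] f[of "d a b"] ends by auto
  show ?thesis
  proof (rule that)
    fix i assume i: "i \<le> d a b"
    show "f i \<in> V \<and> d a (f i) = i \<and> d (f i) b = d a b - i"
      using f[OF i] ff[of 0 i] ff[of i "d a b"] i f0 by auto
    show "vpt (f i) \<in> geod_image X (vpt a) (vpt b) \<alpha>"
      unfolding geod_image_def n using f[OF i] i by (intro image_eqI[of _ _ "real i"]) auto
  qed (use ff f0 in auto)
qed

lemma set_dist_le:
  assumes S: "S \<subseteq> P" "vpt u \<in> S" "u \<in> V" and T: "T \<subseteq> P" "vpt v \<in> T" "v \<in> V"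
  shows "set_dist X S T \<le> real (d u v)"
proof -
  have "set_dist X S T \<le> path_dist X (vpt u) (vpt v)" unfolding set_dist_def
  proof (rule cInf_lower)
    show "bdd_below {path_dist X p q |p q. p \<in> S \<and> q \<in> T}"
      using S T path_dist_nonneg by (intro bdd_belowI[of _ 0]) blast
  qed (use S T in blast)
  then show ?thesis using path_dist_vpt_vpt S T by simp
qed

lemma Geod_image_points: "\<alpha> \<in> Geod X p q \<Longrightarrow> geod_image X p q \<alpha> \<subseteq> P"
  by (auto simp: Geod_def geod_image_def)

end

section \<open>Barycentric extension\<close>

lemma bary_extend_vpt [simp]: "bary_extend \<sigma> (vpt u) (vpt v) = \<sigma> u v"
  by (simp add: bary_extend_def) (simp add: vpt_def)

lemma supp_sub_verts: "p \<in> points X \<Longrightarrow> supp p \<subseteq> verts X"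
  using pointsD(2) by (auto simp: verts_def)

lemma bary_extend_cong:
  assumes "p \<in> points X" "q \<in> points X" "\<And>u v. u \<in> verts X \<Longrightarrow> v \<in> verts X \<Longrightarrow> \<sigma> u v = \<tau> u v"
  shows "bary_extend \<sigma> p q = bary_extend \<tau> p q"
  unfolding bary_extend_def using supp_sub_verts[OF assms(1)] supp_sub_verts[OF assms(2)] assms(3)
  by (intro sum.cong refl) auto

text \<open>The weights \<open>p u * q v\<close> are nonnegative and sum to 1, so affine
  inequalities between vertices average to points.\<close>

lemma bary_extend_affine_mono:
  assumes p: "p \<in> points X" and q: "q \<in> points X"
    and le: "\<And>u v. u \<in> verts X \<Longrightarrow> v \<in> verts X \<Longrightarrow> \<sigma> u v \<le> c * \<tau> u v + e"
  shows "bary_extend \<sigma> p q \<le> c * bary_extend \<tau> p q + e"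
proof -
  have "bary_extend \<sigma> p q \<le> (\<Sum>u\<in>supp p. \<Sum>v\<in>supp q. p u * q v * (c * \<tau> u v + e))"
    unfolding bary_extend_def
  proof (intro sum_mono mult_left_mono le)
    fix u v assume "u \<in> supp p" "v \<in> supp q"
    then show "u \<in> verts X" "v \<in> verts X" using supp_sub_verts[OF p] supp_sub_verts[OF q] by auto
  qed (simp add: pointsD(1)[OF p] pointsD(1)[OF q])
  also have "\<dots> = c * bary_extend \<tau> p q + (\<Sum>u\<in>supp p. p u * (\<Sum>v\<in>supp q. q v)) * e"
    unfolding bary_extend_def by (simp add: sum.distrib sum_distrib_left sum_distrib_right algebra_simps)
  also have "(\<Sum>u\<in>supp p. p u * (\<Sum>v\<in>supp q. q v)) = 1" using pointsD(3)[OF p] pointsD(3)[OF q] by simp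
  finally show ?thesis by simp
qed

lemma bary_extend_triangle:
  assumes p: "p \<in> points X" and q: "q \<in> points X" and r: "r \<in> points X"
    and tri: "\<And>u v w. u \<in> verts X \<Longrightarrow> v \<in> verts X \<Longrightarrow> w \<in> verts X \<Longrightarrow> \<sigma> u w \<le> \<sigma> u v + \<sigma> v w"
  shows "bary_extend \<sigma> p r \<le> bary_extend \<sigma> p q + bary_extend \<sigma> q r"
proof -
  have s: "(\<Sum>u\<in>supp p. p u) = 1" "(\<Sum>u\<in>supp q. q u) = 1" "(\<Sum>u\<in>supp r. r u) = 1"
    using pointsD(3) p q r by blast+
  have "bary_extend \<sigma> p r = (\<Sum>u\<in>supp p. \<Sum>w\<in>supp r. (\<Sum>v\<in>supp q. q v) * (p u * r w * \<sigma> u w))"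
    by (simp add: s bary_extend_def)
  also have "\<dots> = (\<Sum>u\<in>supp p. \<Sum>w\<in>supp r. \<Sum>v\<in>supp q. p u * q v * r w * \<sigma> u w)"
    by (simp only: sum_distrib_right, simp only: mult_ac)
  also have "\<dots> \<le> (\<Sum>u\<in>supp p. \<Sum>w\<in>supp r. \<Sum>v\<in>supp q. p u * q v * r w * (\<sigma> u v + \<sigma> v w))"
  proof (intro sum_mono mult_left_mono tri)
    fix u w v assume "u \<in> supp p" "w \<in> supp r" "v \<in> supp q"
    then show "u \<in> verts X" "v \<in> verts X" "w \<in> verts X"
      using supp_sub_verts[OF p] supp_sub_verts[OF q] supp_sub_verts[OF r] by auto
  qed (simp add: pointsD(1)[OF p] pointsD(1)[OF q] pointsD(1)[OF r])
  also have "\<dots> = (\<Sum>u\<in>supp p. \<Sum>w\<in>supp r. \<Sum>v\<in>supp q. r w * (p u * q v * \<sigma> u v))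
      + (\<Sum>u\<in>supp p. \<Sum>w\<in>supp r. \<Sum>v\<in>supp q. p u * (q v * r w * \<sigma> v w))"
    by (simp add: sum.distrib distrib_left mult_ac)
  also have "(\<Sum>u\<in>supp p. \<Sum>w\<in>supp r. \<Sum>v\<in>supp q. r w * (p u * q v * \<sigma> u v)) = bary_extend \<sigma> p q"
    by (simp add: bary_extend_def s flip: sum_distrib_left sum_distrib_right)
  also have "(\<Sum>u\<in>supp p. \<Sum>w\<in>supp r. \<Sum>v\<in>supp q. p u * (q v * r w * \<sigma> v w))
      = (\<Sum>u\<in>supp p. p u) * (\<Sum>w\<in>supp r. \<Sum>v\<in>supp q. q v * r w * \<sigma> v w)"
    by (simp only: flip: sum_distrib_left sum_distrib_right)
  also have "\<dots> = bary_extend \<sigma> q r" unfolding s bary_extend_def by (subst sum.swap) simp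
  finally show ?thesis .
qed

lemma bary_extend_complex_metric:
  assumes zero: "\<And>u. \<sigma> u u = 0" and pos: "\<And>u v. u \<noteq> v \<Longrightarrow> 0 < \<sigma> u v" and sym: "\<And>u v. \<sigma> u v = \<sigma> v u"
    and tri: "\<And>u v w. u \<in> verts X \<Longrightarrow> v \<in> verts X \<Longrightarrow> w \<in> verts X \<Longrightarrow> \<sigma> u w \<le> \<sigma> u v + \<sigma> v w"
  shows "complex_metric X (bary_extend \<sigma>)"
proof -
  have nn: "0 \<le> \<sigma> u v" for u v using zero pos by (metis less_le order_refl)
  have term0: "0 \<le> p u * q v * \<sigma> u v" if "p \<in> points X" "q \<in> points X" for p q u v
    using pointsD(1)[OF that(1)] pointsD(1)[OF that(2)] nn by simp
  have nonneg: "0 \<le> bary_extend \<sigma> p q" if "p \<in> points X" "q \<in> points X" for p q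
    unfolding bary_extend_def using term0[OF that] by (intro sum_nonneg)
  have eq: "p = q" if p: "p \<in> points X" and q: "q \<in> points X" and z: "bary_extend \<sigma> p q = 0" for p q
  proof -
    \<comment> \<open>All summands are nonnegative, so a vanishing sum identifies every vertex of
      one support with every vertex of the other; both points are then the same vertex.\<close>
    have *: "u = v" if u: "u \<in> supp p" and v: "v \<in> supp q" for u v
    proof (rule ccontr)
      assume "u \<noteq> v"
      have "(\<Sum>v\<in>supp q. p u * q v * \<sigma> u v) = 0"
        using z u pointsD(4)[OF p] term0[OF p q] unfolding bary_extend_def
        by (subst (asm) sum_nonneg_eq_0_iff) (auto intro: sum_nonneg)
      then have "p u * q v * \<sigma> u v = 0"
        using v pointsD(4)[OF q] term0[OF p q] by (subst (asm) sum_nonneg_eq_0_iff) auto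
      then show False using u v pos[OF \<open>u \<noteq> v\<close>] by (auto simp: supp_def)
    qed
    obtain u where u: "u \<in> supp p" using pointsD(5)[OF p] by blast
    have "supp q = {u}" "supp p = {u}" using * u pointsD(5)[OF q] by blast+
    then have "p u = 1" "q u = 1" using pointsD(3)[OF p] pointsD(3)[OF q] by auto
    then show "p = q" using point_eq_vpt[OF p, of u] point_eq_vpt[OF q, of u] by simp
  qed
  have comm: "bary_extend \<sigma> p q = bary_extend \<sigma> q p" for p q
    unfolding bary_extend_def by (subst sum.swap) (simp add: sym mult.commute mult.left_commute)
  show ?thesis unfolding complex_metric_def
    using nonneg eq comm zero bary_extend_triangle[where \<sigma> = \<sigma> and X = X] tri by auto
qed

section \<open>Isomorphisms\<close>

lemma complex_iso_inverse:
  assumes g: "complex_iso g X Y" shows "complex_iso (inv_into (verts X) g) Y X"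
proof -
  have b: "bij_betw g (verts X) (verts Y)" and Y: "(\<lambda>s. g ` s) ` X = Y" using g by (auto simp: complex_iso_def)
  have "inv_into (verts X) g ` g ` s = s" if "s \<in> X" for s
    using b that by (intro inv_into_image_cancel) (auto simp: bij_betw_def verts_def)
  then have "(\<lambda>s. inv_into (verts X) g ` s) ` Y = X" unfolding Y[symmetric] image_image by simp
  then show ?thesis using bij_betw_inv_into[OF b] by (simp add: complex_iso_def)
qed

lemma complex_iso_gdist_le:
  assumes X: "connected_complex X" and g: "complex_iso g X Y" and V: "u \<in> verts X" "v \<in> verts X"
  shows "gdist Y (g u) (g v) \<le> gdist X u v"
proof -
  interpret connected_complex X by fact
  have "(u, v) \<in> E ^^ n \<Longrightarrow> (g u, g v) \<in> {(x, y). {x, y} \<in> Y} ^^ n" for n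
  proof (induction n arbitrary: v)
    case (Suc n)
    then obtain w where w: "(u, w) \<in> E ^^ n" "{w, v} \<in> X" by auto
    have "g ` {w, v} \<in> Y" using w g unfolding complex_iso_def by blast
    then have "(g w, g v) \<in> {(x, y). {x, y} \<in> Y}" by simp
    then show ?case using Suc.IH[OF w(1)] by (rule relpow_Suc_I[rotated])
  qed simp
  then show ?thesis using gdist_path[OF V] unfolding gdist_def[of Y] by (blast intro: Least_le)
qed

lemma complex_iso_gdist:
  assumes X: "connected_complex X" and Y: "connected_complex Y" and g: "complex_iso g X Y"
    and V: "u \<in> verts X" "v \<in> verts X"
  shows "gdist Y (g u) (g v) = gdist X u v"
proof (rule antisym)
  have b: "bij_betw g (verts X) (verts Y)" using g by (simp add: complex_iso_def)
  have gV: "g u \<in> verts Y" "g v \<in> verts Y" using b V by (auto simp: bij_betw_def)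
  show "gdist X u v \<le> gdist Y (g u) (g v)"
    using complex_iso_gdist_le[OF Y complex_iso_inverse[OF g] gV] b V by (simp add: bij_betw_inv_into_left)
qed (rule complex_iso_gdist_le[OF X g V])

lemma bary_extend_act:
  assumes g: "complex_iso g X Y" and p: "p \<in> points X" and q: "q \<in> points X"
    and \<sigma>: "\<And>u v. u \<in> verts X \<Longrightarrow> v \<in> verts X \<Longrightarrow> \<tau> (g u) (g v) = \<sigma> u v"
  shows "bary_extend \<tau> (act g p) (act g q) = bary_extend \<sigma> p q"
proof -
  have inj: "inj_on g (verts X)" using g by (simp add: complex_iso_def bij_betw_def)
  have val: "act g r (g u) = r u" if r: "r \<in> points X" and u: "u \<in> supp r" for r u
  proof -
    have "{v \<in> supp r. g v = g u} = {u}" using supp_sub_verts[OF r] u inj by (auto simp: inj_on_def)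
    then show ?thesis by (simp add: act_def)
  qed
  have S: "supp (act g r) = g ` supp r" if r: "r \<in> points X" for r
  proof
    show "supp (act g r) \<subseteq> g ` supp r"
    proof
      fix w assume w: "w \<in> supp (act g r)"
      show "w \<in> g ` supp r"
      proof (rule ccontr)
        assume "w \<notin> g ` supp r"
        then have "{v \<in> supp r. g v = w} = {}" by auto
        then have "act g r w = 0" unfolding act_def by (metis sum.empty)
        then show False using w by (simp add: supp_def)
      qed
    qed
    show "g ` supp r \<subseteq> supp (act g r)" using val[OF r] by (auto simp: supp_def)
  qed
  have injS: "inj_on g (supp r)" if "r \<in> points X" for r using inj supp_sub_verts[OF that] by (rule inj_on_subset)
  show ?thesis unfolding bary_extend_def S[OF p] S[OF q]
    using supp_sub_verts[OF p] supp_sub_verts[OF q]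
    by (subst sum.reindex[OF injS[OF p]], subst sum.reindex[OF injS[OF q]])
       (auto intro!: sum.cong simp: val[OF p] val[OF q] \<sigma> subset_iff)
qed

section \<open>The invariant metric\<close>

definition vertex_fine :: "'a set \<Rightarrow> ('a \<Rightarrow> 'a \<Rightarrow> nat) \<Rightarrow> nat \<Rightarrow> bool" where
  "vertex_fine V d \<delta> \<longleftrightarrow> (\<forall>x\<in>V. \<forall>y\<in>V. \<forall>z\<in>V. \<forall>p\<in>V. \<forall>q\<in>V.
     d x p + d p y = d x y \<longrightarrow> d x q + d q z = d x z \<longrightarrow> d x p = d x q \<longrightarrow>
     2 * d x p + d y z \<le> d x y + d x z \<longrightarrow> d p q \<le> \<delta>)"

definition valence_le :: "'a set \<Rightarrow> ('a \<Rightarrow> 'a \<Rightarrow> nat) \<Rightarrow> nat \<Rightarrow> bool" where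
  "valence_le V d n \<longleftrightarrow> (\<forall>x\<in>V. finite {y \<in> V. d x y \<le> 1} \<and> card {y \<in> V. d x y \<le> 1} \<le> n)"

text \<open>The least constant is an isomorphism invariant and is at most every admissible \<delta>.
  Positivity keeps the spheres of the flow apart.\<close>

definition fine_const :: "'a set set \<Rightarrow> nat" where
  "fine_const X = (LEAST \<delta>. 0 < \<delta> \<and> vertex_fine (verts X) (gdist X) \<delta>)"

text \<open>Balls of radius 1 include their centre. The bound 2 keeps \<open>contraction\<close>
  positive.\<close>

definition valence :: "'a set set \<Rightarrow> nat" where
  "valence X = (LEAST n. 2 \<le> n \<and> valence_le (verts X) (gdist X) n)"

abbreviation vertex_dhat :: "'a set set \<Rightarrow> 'a \<Rightarrow> 'a \<Rightarrow> real" where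
  "vertex_dhat X \<equiv> vertex_metric (verts X) (gdist X) (fine_const X) (valence X)"

lemma hyperbolic_connected: "hyperbolic_complex X \<Longrightarrow> connected_complex X"
  by (simp add: hyperbolic_complex_def connected_complex_def)

lemma vertex_fine_if_fine_triangles:
  assumes "connected_complex X" "fine_triangles X \<epsilon>" "\<epsilon> \<le> real \<delta>"
  shows "vertex_fine (verts X) (gdist X) \<delta>"
  unfolding vertex_fine_def
  using connected_complex.fine_triangles_vertices[OF assms(1,2)] assms(3)
  by (meson of_nat_le_iff order_trans)

lemma fine_graph_complex:
  assumes X: "hyperbolic_complex X"
  shows "fine_graph (verts X) (gdist X) (fine_const X) (valence X)"
proof -
  interpret connected_complex X using X by (rule hyperbolic_connected)
  obtain \<epsilon> where ft: "fine_triangles X \<epsilon>" using X by (auto simp: hyperbolic_complex_def)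
  have "\<epsilon> \<le> real (nat \<lceil>\<epsilon>\<rceil> + 1)" by linarith
  then have "vertex_fine V d (nat \<lceil>\<epsilon>\<rceil> + 1)"
    by (rule vertex_fine_if_fine_triangles[OF connected_complex_axioms ft])
  then have "0 < nat \<lceil>\<epsilon>\<rceil> + 1 \<and> vertex_fine V d (nat \<lceil>\<epsilon>\<rceil> + 1)" by simp
  then have \<delta>: "0 < fine_const X \<and> vertex_fine V d (fine_const X)"
    unfolding fine_const_def by (rule LeastI)
  obtain N where N: "\<And>v. v \<in> V \<Longrightarrow> finite {s \<in> X. v \<in> s} \<and> card {s \<in> X. v \<in> s} \<le> N"
    using X by (auto simp: hyperbolic_complex_def unif_locally_finite_def)
  have "finite {y \<in> V. d x y \<le> 1} \<and> card {y \<in> V. d x y \<le> 1} \<le> N + 2" if x: "x \<in> V" for x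
  proof -
    \<comment> \<open>Neighbours \<open>y\<close> of \<open>x\<close>, including \<open>x\<close>
      itself, correspond injectively to simplices \<open>{x, y}\<close> containing
      \<open>x\<close>.\<close>
    have sub: "(\<lambda>y. {x, y}) ` {y \<in> V. d x y \<le> 1} \<subseteq> {s \<in> X. x \<in> s}" using gdist_1_edge[OF x] by auto
    have inj: "inj_on (\<lambda>y. {x, y}) {y \<in> V. d x y \<le> 1}" by (auto simp: inj_on_def doubleton_eq_iff)
    have "finite {y \<in> V. d x y \<le> 1}" using inj sub N[OF x] inj_on_finite by blast
    moreover have "card {y \<in> V. d x y \<le> 1} \<le> card {s \<in> X. x \<in> s}" using card_inj_on_le[OF inj sub] N[OF x] by blast
    ultimately show ?thesis using N[OF x] by linarith
  qed
  then have "2 \<le> N + 2 \<and> valence_le V d (N + 2)" by (simp add: valence_le_def)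
  then have v: "2 \<le> valence X \<and> valence_le V d (valence X)" unfolding valence_def by (rule LeastI)
  show ?thesis
    using gdist_eq_0 gdist_sym gdist_tri gdist_geo \<delta> v
    by unfold_locales (auto simp: vertex_fine_def valence_le_def)
qed

text \<open>Both parameters are least solutions of conditions on distances and cardinalities, so
  they agree for isomorphic complexes, and \<open>vertex_metric_transfer\<close> applies.\<close>

lemma vertex_dhat_iso:
  assumes X: "hyperbolic_complex X" and Y: "hyperbolic_complex Y" and g: "complex_iso g X Y"
    and V: "u \<in> verts X" "v \<in> verts X"
  shows "vertex_dhat Y (g u) (g v) = vertex_dhat X u v"
proof -
  have b: "bij_betw g (verts X) (verts Y)" using g by (simp add: complex_iso_def)
  then have inj: "inj_on g (verts X)" and im: "verts Y = g ` verts X" by (auto simp: bij_betw_def)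
  note iso = complex_iso_gdist[OF X[THEN hyperbolic_connected] Y[THEN hyperbolic_connected] g]
  have "vertex_fine (verts Y) (gdist Y) \<delta> = vertex_fine (verts X) (gdist X) \<delta>" for \<delta>
    unfolding vertex_fine_def im by (simp add: iso cong: ball_cong)
  then have f: "fine_const Y = fine_const X" by (simp add: fine_const_def)
  have "{y \<in> verts Y. gdist Y (g x) y \<le> 1} = g ` {y \<in> verts X. gdist X x y \<le> 1}" if "x \<in> verts X" for x
    unfolding im using iso that by auto
  moreover have "inj_on g {y \<in> verts X. gdist X x y \<le> 1}" for x using inj by (rule inj_on_subset) auto
  ultimately have "valence_le (verts Y) (gdist Y) n = valence_le (verts X) (gdist X) n" for n
    unfolding valence_le_def im by (simp add: card_image finite_image_iff cong: ball_cong)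
  then have "valence Y = valence X" by (simp add: valence_def)
  then show ?thesis
    using vertex_metric_transfer[where g = g and d = "gdist X" and d' = "gdist Y", OF b iso V] f by simp
qed

section \<open>The properties of the metric on the complex\<close>

lemma dhat_iso:
  assumes "hyperbolic_complex X" "hyperbolic_complex Y" "complex_iso g X Y" "x \<in> points X" "y \<in> points X"
  shows "bary_extend (vertex_dhat Y) (act g x) (act g y) = bary_extend (vertex_dhat X) x y"
  using bary_extend_act[OF assms(3-5)] vertex_dhat_iso[OF assms(1-3)] by blast

lemma dhat_complex_metric:
  assumes "hyperbolic_complex X" shows "complex_metric X (bary_extend (vertex_dhat X))"
proof -
  interpret fine_graph "verts X" "gdist X" "fine_const X" "valence X" by (rule fine_graph_complex[OF assms])
  show ?thesis using vertex_metric_pos vertex_metric_commute vertex_metric_triangle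
    by (intro bary_extend_complex_metric) auto
qed

lemma dhat_quasi_isometric:
  assumes X: "hyperbolic_complex X"
  shows "\<exists>A B. 1 \<le> A \<and> 0 \<le> B \<and> (\<forall>x\<in>points X. \<forall>y\<in>points X.
    word_metric X x y / A - B \<le> bary_extend (vertex_dhat X) x y \<and>
    bary_extend (vertex_dhat X) x y \<le> A * word_metric X x y + B)"
proof -
  interpret connected_complex X using X by (rule hyperbolic_connected)
  interpret G: fine_graph "verts X" "gdist X" "fine_const X" "valence X" by (rule fine_graph_complex[OF X])
  obtain A B where A: "1 \<le> A" and B: "0 \<le> B" and AB: "\<And>a b. a \<in> V \<Longrightarrow> b \<in> V \<Longrightarrow>
      real (d a b) / A - B \<le> vertex_dhat X a b \<and> vertex_dhat X a b \<le> A * real (d a b) + B"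
    using G.vertex_metric_quasi_isometric by blast
  have "word_metric X x y / A - B \<le> bary_extend (vertex_dhat X) x y \<and>
      bary_extend (vertex_dhat X) x y \<le> A * word_metric X x y + B" if x: "x \<in> points X" and y: "y \<in> points X" for x y
  proof -
    have w: "word_metric X x y = bary_extend (\<lambda>u v. real (d u v)) x y"
      unfolding word_metric_def using x y path_dist_vpt_vpt by (intro bary_extend_cong) auto
    \<comment> \<open>The lower bound is multiplied by \<open>A\<close> to become an affine upper
      bound for the word metric.\<close>
    have "word_metric X x y \<le> A * bary_extend (vertex_dhat X) x y + A * B"
      unfolding w using AB A by (intro bary_extend_affine_mono[OF x y]) (auto simp: field_simps)
    then have "word_metric X x y / A - B \<le> bary_extend (vertex_dhat X) x y" using A by (simp add: field_simps)
    moreover have "bary_extend (vertex_dhat X) x y \<le> A * word_metric X x y + B"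
      unfolding w using AB by (intro bary_extend_affine_mono[OF x y]) auto
    ultimately show ?thesis by simp
  qed
  then show ?thesis using A B by blast
qed

text \<open>The constants come from \<open>fine_const X\<close> and \<open>valence X\<close> alone,
  so they are fixed before \<delta>; a given \<delta> only enters through
  \<open>fine_const X \<le> \<delta>\<close>.\<close>

lemma dhat_double_difference:
  assumes X: "hyperbolic_complex X"
  shows "\<exists>L \<mu>. 0 \<le> L \<and> 0 \<le> \<mu> \<and> \<mu> < 1 \<and>
    (\<forall>\<delta>::nat. 0 < \<delta> \<and> fine_triangles X (real \<delta>) \<longrightarrow>
      (\<forall>a\<in>verts X. \<forall>a'\<in>verts X. \<forall>b\<in>verts X. \<forall>b'\<in>verts X.
       \<forall>\<alpha>\<in>Geod X (vpt a) (vpt a'). \<forall>\<beta>\<in>Geod X (vpt b) (vpt b').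
       let D = set_dist X (geod_image X (vpt a) (vpt a') \<alpha>) (geod_image X (vpt b) (vpt b') \<beta>)
       in 2 * real \<delta> \<le> D \<longrightarrow>
          \<bar>double_diff (bary_extend (vertex_dhat X)) a a' b b'\<bar> \<le> L * \<mu> powr D))"
proof -
  interpret connected_complex X using X by (rule hyperbolic_connected)
  interpret G: fine_graph "verts X" "gdist X" "fine_const X" "valence X" by (rule fine_graph_complex[OF X])
  define \<mu> where "\<mu> = rate (fine_const X) (valence X)"
  have \<mu>: "0 < \<mu>" "\<mu> < 1" using G.rho by (auto simp: \<mu>_def)
  obtain L where L: "0 \<le> L" and dd: "\<And>a a' b b' D. a \<in> V \<Longrightarrow> a' \<in> V \<Longrightarrow> b \<in> V \<Longrightarrow> b' \<in> V \<Longrightarrow> 0 < D \<Longrightarrow>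
      D \<le> d a b \<Longrightarrow> D \<le> d a' b \<Longrightarrow> D \<le> d a b' \<Longrightarrow> D \<le> d a' b' \<Longrightarrow>
      d a a' + d b b' + 2 * D \<le> d a' b + d a b' + (2 * G.overlap_bound (4 * fine_const X + 1) + 4 * fine_const X + 2) \<Longrightarrow>
      d a a' + d b b' + 2 * D \<le> d a b + d a' b' + (2 * G.overlap_bound (4 * fine_const X + 1) + 4 * fine_const X + 2) \<Longrightarrow>
      \<bar>vertex_dhat X a b - vertex_dhat X a' b - vertex_dhat X a b' + vertex_dhat X a' b'\<bar> \<le> L * \<mu> powr real D"
    using G.vertex_metric_double_difference unfolding \<mu>_def by blast
  have "\<bar>double_diff (bary_extend (vertex_dhat X)) a a' b b'\<bar> \<le> L * \<mu> powr D"
    if \<delta>: "0 < \<delta>" "fine_triangles X (real \<delta>)" and V: "a \<in> V" "a' \<in> V" "b \<in> V" "b' \<in> V"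
      and \<alpha>: "\<alpha> \<in> Geod X (vpt a) (vpt a')" and \<beta>: "\<beta> \<in> Geod X (vpt b) (vpt b')"
      and D: "D = set_dist X (geod_image X (vpt a) (vpt a') \<alpha>) (geod_image X (vpt b) (vpt b') \<beta>)" "2 * real \<delta> \<le> D"
    for \<delta> :: nat and a a' b b' \<alpha> \<beta> D
  proof -
    have "fine_const X \<le> \<delta>"
      unfolding fine_const_def using \<delta> vertex_fine_if_fine_triangles[OF connected_complex_axioms]
      by (intro Least_le) auto
    \<comment> \<open>\<open>D\<close> is real, but distances between vertices are integers, so they
      are bounded below by its ceiling.\<close>
    define k where "k = nat \<lceil>D\<rceil>"
    have k: "D \<le> real k" "fine_const X < k" using D \<delta> \<open>fine_const X \<le> \<delta>\<close> unfolding k_def by linarith+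
    obtain f where f: "\<And>i. i \<le> d a a' \<Longrightarrow> f i \<in> V \<and> d a (f i) = i \<and> d (f i) a' = d a a' - i"
      "\<And>i j. i \<le> j \<Longrightarrow> j \<le> d a a' \<Longrightarrow> d (f i) (f j) = j - i"
      "\<And>i. i \<le> d a a' \<Longrightarrow> vpt (f i) \<in> geod_image X (vpt a) (vpt a') \<alpha>"
      "f 0 = a" "f (d a a') = a'"
      using Geod_vertices[OF V(1,2) \<alpha>] by blast
    obtain g where g: "\<And>i. i \<le> d b b' \<Longrightarrow> g i \<in> V \<and> d b (g i) = i \<and> d (g i) b' = d b b' - i"
      "\<And>i j. i \<le> j \<Longrightarrow> j \<le> d b b' \<Longrightarrow> d (g i) (g j) = j - i"
      "\<And>i. i \<le> d b b' \<Longrightarrow> vpt (g i) \<in> geod_image X (vpt b) (vpt b') \<beta>"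
      "g 0 = b" "g (d b b') = b'"
      using Geod_vertices[OF V(3,4) \<beta>] by blast
    have kd: "k \<le> d (f i) (g j)" if "i \<le> d a a'" "j \<le> d b b'" for i j
    proof -
      have "D \<le> real (d (f i) (g j))" unfolding D(1)
        using f g that Geod_image_points[OF \<alpha>] Geod_image_points[OF \<beta>] by (intro set_dist_le) auto
      then show ?thesis unfolding k_def by linarith
    qed

    have ab: "k \<le> d a b" "k \<le> d a' b" "k \<le> d a b'" "k \<le> d a' b'"
      using kd[of 0 0] kd[of "d a a'" 0] kd[of 0 "d b b'"] kd[of "d a a'" "d b b'"] f(4,5) g(4,5) by auto
    have b1: "d a a' + d b b' + 2 * k \<le> d a' b + d a b' + (2 * G.overlap_bound (4 * fine_const X + 1) + 4 * fine_const X + 2)"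
      by (rule G.bridge[OF V f(1,2) g(1,2) kd k(2)])
    have sb: "d b' b = d b b'" using gdist_sym V by blast
    \<comment> \<open>The second bridge inequality is the first one for the reversed geodesic from
      \<open>b'\<close> to \<open>b\<close>.\<close>
    have "d a a' + d b' b + 2 * k \<le> d a' b' + d a b + (2 * G.overlap_bound (4 * fine_const X + 1) + 4 * fine_const X + 2)"
    proof (rule G.bridge[OF V(1,2,4,3) f(1,2), where \<beta> = "\<lambda>j. g (d b b' - j)"])
      fix j assume j: "j \<le> d b' b"
      then show "g (d b b' - j) \<in> V \<and> d b' (g (d b b' - j)) = j \<and> d (g (d b b' - j)) b = d b' b - j"
        using g(1)[of "d b b' - j"] gdist_sym[of "g (d b b' - j)"] V sb by auto
    next
      fix i j assume ij: "i \<le> j" "j \<le> d b' b"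
      have "d (g (d b b' - j)) (g (d b b' - i)) = j - i" using g(2)[of "d b b' - j" "d b b' - i"] ij sb by simp
      then show "d (g (d b b' - i)) (g (d b b' - j)) = j - i"
        using gdist_sym[of "g (d b b' - j)" "g (d b b' - i)"] g(1) by simp
    qed (use kd k sb in auto)
    then have b2: "d a a' + d b b' + 2 * k \<le> d a b + d a' b' + (2 * G.overlap_bound (4 * fine_const X + 1) + 4 * fine_const X + 2)"
      using sb by simp
    have "\<bar>double_diff (bary_extend (vertex_dhat X)) a a' b b'\<bar>
        = \<bar>vertex_dhat X a b - vertex_dhat X a' b - vertex_dhat X a b' + vertex_dhat X a' b'\<bar> / 2"
      by (simp add: double_diff_def)
    also have "\<dots> \<le> \<bar>vertex_dhat X a b - vertex_dhat X a' b - vertex_dhat X a b' + vertex_dhat X a' b'\<bar>" by simp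
    also have "\<dots> \<le> L * \<mu> powr real k" using dd[OF V _ ab b1 b2] k by simp
    also have "\<dots> \<le> L * \<mu> powr D" using k \<mu> L by (intro mult_left_mono powr_mono') auto
    finally show ?thesis .
  qed
  then show ?thesis using L \<mu> unfolding Let_def by (intro exI[of _ L] exI[of _ \<mu>]) auto
qed

theorem theorem32:
  "\<exists>dhat :: 'a set set \<Rightarrow> ('a \<Rightarrow> real) \<Rightarrow> ('a \<Rightarrow> real) \<Rightarrow> real.
     (\<forall>X Y g. hyperbolic_complex X \<and> hyperbolic_complex Y \<and> complex_iso g X Y \<longrightarrow>
        (\<forall>x\<in>points X. \<forall>y\<in>points X. dhat Y (act g x) (act g y) = dhat X x y)) \<and>
     (\<forall>X. hyperbolic_complex X \<longrightarrow>
        complex_metric X (dhat X) \<and>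
        (\<exists>A B. 1 \<le> A \<and> 0 \<le> B \<and>
           (\<forall>x\<in>points X. \<forall>y\<in>points X.
              word_metric X x y / A - B \<le> dhat X x y \<and>
              dhat X x y \<le> A * word_metric X x y + B)) \<and>
        (\<forall>g\<in>Isom X. \<forall>x\<in>points X. \<forall>y\<in>points X. dhat X (act g x) (act g y) = dhat X x y) \<and>
        metric_complex X (dhat X) \<and>
        (\<exists>L \<mu>. 0 \<le> L \<and> 0 \<le> \<mu> \<and> \<mu> < 1 \<and>
           (\<forall>\<delta>::nat. 0 < \<delta> \<and> fine_triangles X (real \<delta>) \<longrightarrow>
              (\<forall>a\<in>verts X. \<forall>a'\<in>verts X. \<forall>b\<in>verts X. \<forall>b'\<in>verts X.
               \<forall>\<alpha>\<in>Geod X (vpt a) (vpt a'). \<forall>\<beta>\<in>Geod X (vpt b) (vpt b').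
               let D = set_dist X (geod_image X (vpt a) (vpt a') \<alpha>)
                                  (geod_image X (vpt b) (vpt b') \<beta>)
               in 2 * real \<delta> \<le> D \<longrightarrow>
                  \<bar>double_diff (dhat X) a a' b b'\<bar> \<le> L * \<mu> powr D))))"
\<comment> \<open>One formula serves all complexes; invariance under \<open>Isom X\<close> is the
  case \<open>Y = X\<close> of compatibility with isomorphisms.\<close>
proof (intro exI[of _ "\<lambda>X. bary_extend (vertex_dhat X)"] conjI allI impI)
  fix X Y :: "'a set set" and g
  assume "hyperbolic_complex X \<and> hyperbolic_complex Y \<and> complex_iso g X Y"
  then show "\<forall>x\<in>points X. \<forall>y\<in>points X. bary_extend (vertex_dhat Y) (act g x) (act g y) = bary_extend (vertex_dhat X) x y"
    using dhat_iso by blast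
next
  fix X :: "'a set set" assume X: "hyperbolic_complex X"
  show cm: "complex_metric X (bary_extend (vertex_dhat X))" by (rule dhat_complex_metric[OF X])
  show "\<forall>g\<in>Isom X. \<forall>x\<in>points X. \<forall>y\<in>points X. bary_extend (vertex_dhat X) (act g x) (act g y) = bary_extend (vertex_dhat X) x y"
    using dhat_iso[OF X X] by (auto simp: Isom_def)
  show "metric_complex X (bary_extend (vertex_dhat X))"
    using cm X by (simp add: metric_complex_def induced_from_verts_def hyperbolic_complex_def)
qed (fact dhat_quasi_isometric dhat_double_difference)+

end
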